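(* Let $k,n$ be integers with $2\le k\le\frac n2$, let $\underline x$ be a cluster in $\mathcal A(k,n)$ and let $\varphi_{\underline x}:\mathcal A(k,n)\to\mathbb C$ be the specialization of $\underline x$ to $1$. Then $\varphi_{\underline x}(s\mathcal P_{(k,n)})$ is a tame integral $\mathrm{SL}_k$-frieze of width $w=n-k-1$.
   Context: **$\mathrm{SL}_k$-friezes.** Let $R$ be an integral domain, $k\ge 2$, $w\ge 1$. An $\mathrm{SL}_k$-frieze of width $w$ over $R$ is an array $a:\mathbb Z\times\{1,\dots,w+2k\}\to R$ (rows indexed by $m$, from bottom to top; $(r,m+1)$ is the upper-right and $(r+1,m-1)$ the lower-right neighbour of $(r,m)$) such that $a(r,m)=0$ for $m\le k-1$ and for $m\ge w+k+2$, $a(r,k)=a(r,w+k+1)=1$ for all $r$, and every $k\times k$-diamond has determinant $1$. Here an $s\times s$-diamond is a matrix $(a(r+i-1,\,m+j-i))_{1\le i,j\le s}$ all of whose positions lie in the grid. The frieze is tame if every $(k+1)\times(k+1)$-diamond has determinant $0$, and integral if all non-trivial entries $a(r,m)$, $k+1\le m\le w+k$, are positive integers. **Plücker coordinates.** $\mathcal A(k,n)=\mathbb C[\mathrm{Gr}(k,n)]$ is the homogeneous coordinate ring of the Grassmannian with respect to the Plücker embedding, with its cluster algebra structure due to Scott. $p_{i_1,\dots,i_k}$ are Plücker coordinates, extended to arbitrary $k$-tuples by antisymmetry (so $0$ if two indices coincide). Indices are reduced modulo $n$ to $[1,n]$. $o(J)$ is the tuple $J$ rearranged in weakly increasing order,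 and $[r]^{\ell}=\{r,r+1,\dots,r+\ell-1\}$ (modulo $n$). The consecutive Plücker coordinates $p_{o([r]^k)}$ are the frozen variables; clusters are regarded as ordered tuples and include the frozen variables, so a cluster has $(k-1)(n-k-1)+n$ elements. **Plücker friezes.** The Plücker frieze $\mathcal P_{(k,n)}$ is the $\mathbb Z\times\{1,\dots,n+k-1\}$-grid with entry $p_{o([r']^{k-1},m')}$ at $(r,m)$, where $r'\in[1,n]$ is $r$ modulo $n$ and $m'\in[1,n]$ is $m+r'-1$ modulo $n$. The special Plücker frieze $s\mathcal P_{(k,n)}$ is obtained by replacing every consecutive Plücker coordinate by $1$, i.e. by taking images in $s\mathcal A(k,n)=\mathcal A(k,n)/J$, where $J$ is generated by all $x-1$, $x$ a consecutive Plücker coordinate. **Specialization.** The specialization of a cluster $\underline x=(x_1,\dots,x_N)$ to $1$ is the algebra homomorphism $\varphi_{\underline x}:\mathcal A(k,n)\to\mathbb C$ determined by $x_i\mapsto 1$ for all $i$. It sends all frozen variables to $1$, hence factors through $s\mathcal A(k,n)$; $\varphi_{\underline x}(s\mathcal P_{(k,n)})$ is the grid obtained by applying the induced map to each entry. *)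

theory Defs
  imports
    Complex_Main
    "HOL-Library.Poly_Mapping"
    "HOL-Library.Nat_Bijection"
    "HOL-Computational_Algebra.Fraction_Field"
    "HOL-Algebra.Generated_Rings"
    "HOL-Algebra.QuotRing"
    "HOL-Algebra.Algebraic_Closure_Type"
    "Jordan_Normal_Form.Determinant"
begin

section \<open>Friezes\<close>

text \<open>
  A grid with rows indexed by \<open>{1..w+2k}\<close> is given by a function on all of
  \<open>int \<times> int\<close>; its values outside the rows \<open>{1..w+2k}\<close> are irrelevant. Matrices are
  indexed from 0, so the entry \<open>a (r+i-1) (m+j-i)\<close> of a diamond with \<open>1 \<le> i, j \<le> s\<close>
  becomes \<open>a (r+i) (m+j-i)\<close> with \<open>0 \<le> i, j < s\<close>.
\<close>

definition diamond :: "(int \<Rightarrow> int \<Rightarrow> 'a) \<Rightarrow> nat \<Rightarrow> int \<Rightarrow> int \<Rightarrow> 'a mat" where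
  "diamond a s r m = mat s s (\<lambda>(i, j). a (r + int i) (m + int j - int i))"

definition diamond_in_grid :: "nat \<Rightarrow> nat \<Rightarrow> nat \<Rightarrow> int \<Rightarrow> bool" where
  "diamond_in_grid k w s m \<longleftrightarrow>
     (\<forall>i<s. \<forall>j<s. m + int j - int i \<in> {1..int w + 2 * int k})"

definition SL_frieze :: "nat \<Rightarrow> nat \<Rightarrow> (int \<Rightarrow> int \<Rightarrow> 'a::idom) \<Rightarrow> bool" where
  "SL_frieze k w a \<longleftrightarrow> 2 \<le> k \<and> 1 \<le> w \<and>
     (\<forall>r. \<forall>m\<in>{1..int w + 2 * int k}.
        m \<le> int k - 1 \<or> m \<ge> int w + int k + 2 \<longrightarrow> a r m = 0) \<and>
     (\<forall>r. a r (int k) = 1 \<and> a r (int w + int k + 1) = 1) \<and>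
     (\<forall>r m. diamond_in_grid k w k m \<longrightarrow> det (diamond a k r m) = 1)"

definition tame_frieze :: "nat \<Rightarrow> nat \<Rightarrow> (int \<Rightarrow> int \<Rightarrow> 'a::idom) \<Rightarrow> bool" where
  "tame_frieze k w a \<longleftrightarrow>
     (\<forall>r m. diamond_in_grid k w (k + 1) m \<longrightarrow> det (diamond a (k + 1) r m) = 0)"

definition integral_frieze :: "nat \<Rightarrow> nat \<Rightarrow> (int \<Rightarrow> int \<Rightarrow> 'a::idom) \<Rightarrow> bool" where
  "integral_frieze k w a \<longleftrightarrow>
     (\<forall>r. \<forall>m\<in>{int k + 1..int w + int k}. \<exists>c::nat. c > 0 \<and> a r m = of_nat c)"


section \<open>The homogeneous coordinate ring of the Grassmannian\<close>

text \<open>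
  The field \<open>\<complex>(x\<^sub>i\<^sub>j)\<close> in the entries of a generic matrix; the variable \<open>x\<^sub>i\<^sub>j\<close> is numbered
  \<open>prod_encode (i, j)\<close>. The affine cone over the Grassmannian consists of the
  vectors of maximal minors of the complex \<open>k \<times> n\<close> matrices. Hence the polynomials in the
  Pluecker coordinates that vanish on the Grassmannian are exactly those that become \<open>0\<close> on
  substituting the maximal minors of the generic matrix, and the homogeneous coordinate ring
  \<open>\<A>(k,n)\<close> is the subalgebra of \<open>\<complex>[x\<^sub>i\<^sub>j]\<close> generated by these minors.
\<close>

type_synonym ratfun = "((nat \<Rightarrow>\<^sub>0 nat) \<Rightarrow>\<^sub>0 complex) fract"

definition const :: "complex \<Rightarrow> ratfun" where
  "const c = Fract (Poly_Mapping.single 0 c) 1"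

definition gen_entry :: "nat \<Rightarrow> nat \<Rightarrow> ratfun" where
  "gen_entry i j =
     Fract (Poly_Mapping.single (Poly_Mapping.single (prod_encode (i, j)) 1) 1) 1"

text \<open>
  The Pluecker coordinate of an arbitrary \<open>k\<close>-tuple of column indices. Being a determinant, it is
  antisymmetric in the tuple.
\<close>

definition plucker :: "nat \<Rightarrow> nat list \<Rightarrow> ratfun" where
  "plucker k J = det (mat k k (\<lambda>(i, j). gen_entry i (J ! j)))"

definition grass_ring :: "nat \<Rightarrow> nat \<Rightarrow> ratfun ring" where
  "grass_ring k n = ring_of_type_algebra \<lparr>carrier :=
     generate_ring ring_of_type_algebra
       (range const \<union> {plucker k J | J. length J = k \<and> set J \<subseteq> {1..n}})\<rparr>"

definition grass_alg_hom :: "nat \<Rightarrow> nat \<Rightarrow> (ratfun \<Rightarrow> complex) \<Rightarrow> bool" where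
  "grass_alg_hom k n \<phi> \<longleftrightarrow>
     \<phi> \<in> Ring.ring_hom (grass_ring k n) ring_of_type_algebra \<and> (\<forall>c. \<phi> (const c) = c)"

text \<open>The representative of \<open>z\<close> modulo \<open>n\<close> in \<open>{1..n}\<close>, and the tuple \<open>[r]\<^sup>l\<close>.\<close>

definition red :: "nat \<Rightarrow> int \<Rightarrow> nat" where
  "red n z = nat ((z - 1) mod int n) + 1"

definition cyc :: "nat \<Rightarrow> nat \<Rightarrow> nat \<Rightarrow> nat list" where
  "cyc n r l = map (\<lambda>i. red n (int r + int i)) [0..<l]"

definition consecutive_pluckers :: "nat \<Rightarrow> nat \<Rightarrow> ratfun set" where
  "consecutive_pluckers k n = {plucker k (sort (cyc n r k)) | r. r \<in> {1..n}}"


section \<open>Pluecker friezes\<close>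

definition plucker_frieze :: "nat \<Rightarrow> nat \<Rightarrow> int \<Rightarrow> int \<Rightarrow> ratfun" where
  "plucker_frieze k n r m =
     (let r' = red n r; m' = red n (m + int r' - 1)
      in plucker k (sort (cyc n r' (k - 1) @ [m'])))"

definition special_ideal :: "nat \<Rightarrow> nat \<Rightarrow> ratfun set" where
  "special_ideal k n = genideal (grass_ring k n) {x - 1 | x. x \<in> consecutive_pluckers k n}"

definition special_grass_ring :: "nat \<Rightarrow> nat \<Rightarrow> ratfun set ring" where
  "special_grass_ring k n = grass_ring k n Quot special_ideal k n"

definition special_plucker_frieze :: "nat \<Rightarrow> nat \<Rightarrow> int \<Rightarrow> int \<Rightarrow> ratfun set" where
  "special_plucker_frieze k n r m =
     a_r_coset (grass_ring k n) (special_ideal k n) (plucker_frieze k n r m)"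


section \<open>Cluster structure\<close>

text \<open>
  A seed on the vertex set \<open>V\<close> is a pair of a family \<open>x\<close> of elements of the ambient field and
  a skew-symmetric matrix \<open>b\<close>, where \<open>b u v\<close> counts the arrows \<open>u \<rightarrow> v\<close> minus the arrows
  \<open>v \<rightarrow> u\<close>. Only entries with a mutable row or column are meaningful: entries between frozen
  vertices never affect a mutation at a mutable vertex.
\<close>

definition mutate_var ::
  "'v set \<Rightarrow> ('v \<Rightarrow> 'v \<Rightarrow> int) \<Rightarrow> 'v \<Rightarrow> ('v \<Rightarrow> 'a::field) \<Rightarrow> 'v \<Rightarrow> 'a" where
  "mutate_var V b t x = x(t :=
     ((\<Prod>u\<in>{u\<in>V. b u t > 0}. x u ^ nat (b u t)) +
      (\<Prod>u\<in>{u\<in>V. b u t < 0}. x u ^ nat (- b u t))) / x t)"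

definition mutate_matrix :: "('v \<Rightarrow> 'v \<Rightarrow> int) \<Rightarrow> 'v \<Rightarrow> 'v \<Rightarrow> 'v \<Rightarrow> int" where
  "mutate_matrix b t u v =
     (if u = t \<or> v = t then - b u v
      else b u v + sgn (b u t) * max (b u t * b t v) 0)"

text \<open>
  Scott's cluster structure is given here by its rectangles seed, one of the seeds attached
  to Postnikov diagrams, all of which are mutation equivalent. Its vertices are the rectangles \<open>i \<times> j\<close> contained in a \<open>k \<times> (n-k)\<close> rectangle, with \<open>(0, 0)\<close> standing for
  the empty one; the rectangle \<open>i \<times> j\<close> carries the Pluecker coordinate of
  \<open>{1..k-i} \<union> {k-i+j+1..k+j}\<close>. The frozen vertices \<open>(0, 0)\<close>, \<open>(k, j)\<close>, \<open>(i, n-k)\<close> carry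
  exactly the consecutive Pluecker coordinates.
\<close>

definition verts :: "nat \<Rightarrow> nat \<Rightarrow> (nat \<times> nat) set" where
  "verts k n = insert (0, 0) ({1..k} \<times> {1..n - k})"

definition mutable_verts :: "nat \<Rightarrow> nat \<Rightarrow> (nat \<times> nat) set" where
  "mutable_verts k n = {1..<k} \<times> {1..<n - k}"

definition initial_var :: "nat \<Rightarrow> nat \<times> nat \<Rightarrow> ratfun" where
  "initial_var k = (\<lambda>(i, j). plucker k ([1..<k - i + 1] @ [k - i + j + 1..<k + j + 1]))"

definition rect_arrow :: "nat \<times> nat \<Rightarrow> nat \<times> nat \<Rightarrow> bool" where
  "rect_arrow u v \<longleftrightarrow>
     (if u = (0, 0) then v = (1, 1)
      else v \<noteq> (0, 0) \<and>
        (v = (fst u, snd u + 1) \<or> v = (fst u + 1, snd u) \<or> u = (fst v + 1, snd v + 1)))"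

definition initial_matrix :: "nat \<Rightarrow> nat \<Rightarrow> nat \<times> nat \<Rightarrow> nat \<times> nat \<Rightarrow> int" where
  "initial_matrix k n u v =
     (if u \<in> verts k n \<and> v \<in> verts k n \<and> (u \<in> mutable_verts k n \<or> v \<in> mutable_verts k n)
      then of_bool (rect_arrow u v) - of_bool (rect_arrow v u) else 0)"

inductive grass_seed ::
  "nat \<Rightarrow> nat \<Rightarrow> (nat \<times> nat \<Rightarrow> ratfun) \<Rightarrow> (nat \<times> nat \<Rightarrow> nat \<times> nat \<Rightarrow> int) \<Rightarrow> bool"
  for k n where
  initial: "grass_seed k n (initial_var k) (initial_matrix k n)"
| mutate: "grass_seed k n x b \<Longrightarrow> t \<in> mutable_verts k n \<Longrightarrow>
     grass_seed k n (mutate_var (verts k n) b t x) (mutate_matrix b t)"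

definition grass_cluster :: "nat \<Rightarrow> nat \<Rightarrow> ratfun list \<Rightarrow> bool" where
  "grass_cluster k n xs \<longleftrightarrow>
     (\<exists>x b. grass_seed k n x b \<and> mset xs = image_mset x (mset_set (verts k n)))"


section \<open>Specialization\<close>

text \<open>
  A map on \<open>\<A>(k,n)\<close> is a total function on the ambient field of which only the values on
  \<open>\<A>(k,n)\<close> matter, hence the membership \<open>x \<in> carrier (grass_ring k n)\<close>: it makes \<open>\<phi> x\<close>
  meaningful, and holds for all elements of clusters because \<open>\<A>(k,n)\<close> is the cluster
  algebra.
\<close>

definition specialization_to_1 :: "nat \<Rightarrow> nat \<Rightarrow> ratfun list \<Rightarrow> (ratfun \<Rightarrow> complex) \<Rightarrow> bool" where
  "specialization_to_1 k n xs \<phi> \<longleftrightarrow> grass_alg_hom k n \<phi> \<and>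
     (\<forall>x\<in>set xs. x \<in> carrier (grass_ring k n) \<and> \<phi> x = 1)"

text \<open>The map on \<^term>\<open>special_grass_ring k n\<close> induced by \<open>\<phi>\<close>.\<close>

definition induced_map :: "(ratfun \<Rightarrow> complex) \<Rightarrow> ratfun set \<Rightarrow> complex" where
  "induced_map \<phi> A = the_elem (\<phi> ` A)"

definition specialized_frieze :: "nat \<Rightarrow> nat \<Rightarrow> (ratfun \<Rightarrow> complex) \<Rightarrow> int \<Rightarrow> int \<Rightarrow> complex" where
  "specialized_frieze k n \<phi> r m = induced_map \<phi> (special_plucker_frieze k n r m)"

end

theory Submission
  imports Defs
begin

text \<open>
There are two things to prove: the determinants of the diamonds, which is linear algebra in the
columns of the generic matrix, and that the non-trivial entries become positive integers, which
is an instance of the Laurent phenomenon.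

\<^bold>\<open>Determinants.\<close> Continue the columns of the generic matrix to a sequence \<open>v\<^sub>z\<close> with \<open>v\<^sub>z\<^sub>+\<^sub>n =
(-1)\<^sup>k\<^sup>-\<^sup>1 v\<^sub>z\<close>. These signs absorb the sorting of the index tuples: the entry \<open>(r, m)\<close> of the
Pluecker frieze is the determinant of \<open>v\<^sub>r, ..., v\<^sub>r\<^sub>+\<^sub>k\<^sub>-\<^sub>2, v\<^sub>r\<^sub>+\<^sub>m\<^sub>-\<^sub>1\<close>
(\<open>plucker_frieze_row_minor\<close>). It is linear in its last column, and inside a diamond that column
does not depend on the row. So a diamond is a product of a matrix with \<open>k\<close> columns and a matrix
with \<open>k\<close> rows. Diamonds of size \<open>k + 1\<close> are therefore singular (\<open>diamond_tame\<close>), and the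
determinant of a diamond of size \<open>k\<close> is found by comparison with a triangular one
(\<open>diamond_det\<close>): up to factors that are consecutive minors it is a product of consecutive
minors, and these specialize to \<open>1\<close>.

\<^bold>\<open>Integrality.\<close> The non-trivial entries are the variables \<open>1 \<times> j\<close> of the rectangles seed and of
its cyclic rotations. Mutating once at every mutable vertex, column by column and in each column
from the bottom to the top, rotates the rectangles seed by one step (\<open>rotation\<close>); the exchange
relations are three-term Pluecker relations (\<open>rect_minor_exchange\<close>). The given cluster is
reached from the rectangles seed by mutations, and mutations are involutions. Hence a sequence
of mutations leads from the given seed back to the rectangles seed and on to any rotation of it.
It starts with all values equal to \<open>1\<close>, so the values that it produces are Laurent polynomials
with integer coefficients evaluated at \<open>(1, ..., 1)\<close>: they are integers, and they are positive
because no mutation involves a subtraction (\<open>mutate_along_ones\<close>).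

Only numbers are moved along these mutations. An element of the ambient field is said to have
the value \<open>r > 0\<close> if it is a quotient of two elements of the coordinate ring on which \<open>\<phi>\<close> is
positive. Such elements are closed under addition, multiplication and division, and none of them
is \<open>0\<close>; so all cluster variables on the way back to the rectangles seed have values
(\<open>seed_backwards\<close>), and these values are obtained from the values \<open>1\<close> of the given cluster by
the same mutations.

\<^bold>\<open>The Laurent phenomenon\<close> (\<open>laurent_phenomenon\<close>) is proved for functions on the positive
orthant, by induction on the length of the mutation sequence \<open>t, s, ...\<close>. The final variable \<open>f\<close>
is a Laurent polynomial in the seed reached by \<open>t\<close>, so in the first seed its denominator is a
power of \<open>P = 1 + y\<^sup>c\<close>, where \<open>c\<close> is the column of the exchange matrix at \<open>t\<close>. It is also a
Laurent polynomial in the seed reached by \<open>t, s, t\<close>, since a further mutation at \<open>t\<close> shortens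
the remaining sequence to \<open>t, ...\<close>; so the denominator is also a power of the product of two
polynomials \<open>Q\<close> and \<open>W\<close>. Both are non-zero-divisors modulo \<open>P\<close>, as a grading of the Laurent
polynomials shows, and therefore \<open>f\<close> has no denominator at all. When no arrow joins \<open>s\<close> and \<open>t\<close>,
this needs independent columns of the exchange matrix; the property \<open>unimodular\<close> expresses that,
is preserved by mutation, and holds for the rectangles seed.
\<close>

section \<open>Laurent polynomials on the positive orthant\<close>

definition positive_on :: "'v set \<Rightarrow> ('v \<Rightarrow> real) \<Rightarrow> bool" where
  "positive_on V y \<longleftrightarrow> (\<forall>v\<in>V. 0 < y v)"

definition lmonom :: "'v set \<Rightarrow> ('v \<Rightarrow> int) \<Rightarrow> ('v \<Rightarrow> real) \<Rightarrow> real" where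
  "lmonom V m y = (\<Prod>v\<in>V. y v powi m v)"

definition lpoly :: "'v set \<Rightarrow> (int \<times> ('v \<Rightarrow> int)) list \<Rightarrow> ('v \<Rightarrow> real) \<Rightarrow> real" where
  "lpoly V ts y = (\<Sum>(c, m)\<leftarrow>ts. of_int c * lmonom V m y)"

text \<open>
Laurent polynomials with integer coefficients are represented by the functions that they define
on the positive orthant. Exchange relations never divide by zero there, and substituting the
variables of one seed into a Laurent polynomial in another one is just composition of functions.
\<close>

definition laurent :: "'v set \<Rightarrow> (('v \<Rightarrow> real) \<Rightarrow> real) \<Rightarrow> bool" where
  "laurent V f \<longleftrightarrow> (\<exists>ts. \<forall>y. positive_on V y \<longrightarrow> f y = lpoly V ts y)"

lemma lmonom_pos: "positive_on V y \<Longrightarrow> 0 < lmonom V m y"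
  unfolding lmonom_def positive_on_def by (intro prod_pos) auto

lemma lmonom_zero [simp]: "lmonom V (\<lambda>_. 0) y = 1"
  by (simp add: lmonom_def)

lemma lmonom_add: "positive_on V y \<Longrightarrow> lmonom V (\<lambda>v. m v + m' v) y = lmonom V m y * lmonom V m' y"
  unfolding lmonom_def prod.distrib [symmetric]
  by (intro prod.cong refl power_int_add) (auto simp: positive_on_def)

lemma lmonom_uminus: "lmonom V (\<lambda>v. - m v) y = 1 / lmonom V m y"
  unfolding lmonom_def by (simp add: power_int_minus prod_inversef[symmetric] divide_inverse)

lemma lmonom_diff: "positive_on V y \<Longrightarrow> lmonom V (\<lambda>v. m v - m' v) y = lmonom V m y / lmonom V m' y"
  using lmonom_add[of V y m "\<lambda>v. - m' v"] by (simp add: lmonom_uminus)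

lemma lmonom_mult: "lmonom V (\<lambda>v. int n * m v) y = lmonom V m y ^ n"
  unfolding lmonom_def prod_power_distrib
  by (intro prod.cong refl) (simp add: power_int_power' mult.commute)

lemma lmonom_unit:
  assumes "finite V" "v \<in> V"
  shows "lmonom V (\<lambda>u. if u = v then c else 0) y = y v powi c"
proof -
  have "lmonom V (\<lambda>u. if u = v then c else 0) y = (\<Prod>u\<in>V. if u = v then y v powi c else 1)"
    unfolding lmonom_def by (intro prod.cong) auto
  then show ?thesis using assms by (simp add: prod.delta)
qed

lemma lmonom_single:
  assumes "finite V" "v \<in> V"
  shows "lmonom V (\<lambda>u. of_bool (u = v)) y = y v"
  using lmonom_unit[OF assms, of 1 y] by (simp add: of_bool_def)

lemma lpoly_Nil [simp]: "lpoly V [] y = 0"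
  and lpoly_Cons [simp]: "lpoly V ((c, m) # ts) y = of_int c * lmonom V m y + lpoly V ts y"
  and lpoly_append [simp]: "lpoly V (ts @ us) y = lpoly V ts y + lpoly V us y"
  by (simp_all add: lpoly_def)

lemma laurent_cong:
  "laurent V f \<Longrightarrow> (\<And>y. positive_on V y \<Longrightarrow> g y = f y) \<Longrightarrow> laurent V g"
  unfolding laurent_def by auto

lemma laurent_term: "laurent V (\<lambda>y. of_int c * lmonom V m y)"
  unfolding laurent_def by (rule exI[of _ "[(c, m)]"]) simp

lemma laurent_lmonom: "laurent V (lmonom V m)"
  using laurent_term[of V 1 m] by simp

lemma laurent_of_int: "laurent V (\<lambda>y. of_int c)"
  using laurent_term[of V c "\<lambda>_. 0"] by simp

lemma laurent_0: "laurent V (\<lambda>y. 0)" and laurent_1: "laurent V (\<lambda>y. 1)"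
  using laurent_of_int[of V 0] laurent_of_int[of V 1] by simp_all

lemma laurent_add: "laurent V f \<Longrightarrow> laurent V g \<Longrightarrow> laurent V (\<lambda>y. f y + g y)"
  unfolding laurent_def by (metis lpoly_append)

lemma laurent_induct [consumes 1, case_names zero add cong]:
  assumes "laurent V f"
    and zero: "P (\<lambda>_. 0)"
    and add: "\<And>c m g. laurent V g \<Longrightarrow> P g \<Longrightarrow> P (\<lambda>y. of_int c * lmonom V m y + g y)"
    and cong: "\<And>f g. P f \<Longrightarrow> (\<And>y. positive_on V y \<Longrightarrow> g y = f y) \<Longrightarrow> P g"
  shows "P f"
proof -
  from assms(1) obtain ts where ts: "\<And>y. positive_on V y \<Longrightarrow> f y = lpoly V ts y"
    unfolding laurent_def by blast
  have "P (lpoly V ts)"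
  proof (induction ts)
    case Nil
    show ?case using zero by (rule cong) simp
  next
    case (Cons t ts)
    obtain c m where t: "t = (c, m)" by force
    have "laurent V (lpoly V ts)" unfolding laurent_def by blast
    from add[OF this Cons] show ?case by (rule cong) (simp add: t)
  qed
  then show ?thesis by (rule cong) (simp add: ts)
qed

lemma laurent_term_mult: "laurent V f \<Longrightarrow> laurent V (\<lambda>y. of_int c * lmonom V m y * f y)"
proof (induction rule: laurent_induct)
  case zero
  show ?case by (simp add: laurent_0)
next
  case (add c' m' g)
  have "laurent V (\<lambda>y. of_int (c * c') * lmonom V (\<lambda>v. m v + m' v) y + of_int c * lmonom V m y
      * g y)"
    by (intro laurent_add laurent_term add)
  then show ?case by (rule laurent_cong) (simp add: lmonom_add algebra_simps)
next
  case (cong f g)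
  then show ?case by (auto elim: laurent_cong)
qed

lemma laurent_mult: "laurent V f \<Longrightarrow> laurent V g \<Longrightarrow> laurent V (\<lambda>y. f y * g y)"
proof (induction f rule: laurent_induct)
  case zero
  show ?case by (simp add: laurent_0)
next
  case (add c m f)
  have "laurent V (\<lambda>y. of_int c * lmonom V m y * g y + f y * g y)"
    by (intro laurent_add laurent_term_mult add)
  then show ?case by (rule laurent_cong) (simp add: algebra_simps)
next
  case (cong f f')
  then show ?case by (auto elim: laurent_cong)
qed

lemma laurent_uminus: "laurent V f \<Longrightarrow> laurent V (\<lambda>y. - f y)"
  using laurent_mult[OF laurent_of_int[of V "-1"]] by simp

lemma laurent_diff: "laurent V f \<Longrightarrow> laurent V g \<Longrightarrow> laurent V (\<lambda>y. f y - g y)"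
  using laurent_add[OF _ laurent_uminus, of V f g] by simp

lemma laurent_power: "laurent V f \<Longrightarrow> laurent V (\<lambda>y. f y ^ n)"
  by (induction n) (auto intro: laurent_mult simp: laurent_1)

lemma laurent_sum:
  "(\<And>i. i \<in> I \<Longrightarrow> laurent V (f i)) \<Longrightarrow> laurent V (\<lambda>y. \<Sum>i\<in>I. f i y)"
  by (induction I rule: infinite_finite_induct) (auto intro: laurent_add simp: laurent_0)

lemma laurent_prod:
  "(\<And>i. i \<in> I \<Longrightarrow> laurent V (f i)) \<Longrightarrow> laurent V (\<lambda>y. \<Prod>i\<in>I. f i y)"
  by (induction I rule: infinite_finite_induct) (auto intro: laurent_mult simp: laurent_1)

lemma laurent_coord:
  assumes "finite V" "v \<in> V"
  shows "laurent V (\<lambda>y. y v)" "laurent V (\<lambda>y. 1 / y v)"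
  by (rule laurent_cong[OF laurent_lmonom[of V "\<lambda>u. of_bool (u = v)"]],
      simp add: lmonom_single[OF assms])
    (rule laurent_cong[OF laurent_lmonom[of V "\<lambda>u. - of_bool (u = v)"]],
      simp add: lmonom_single[OF assms] lmonom_uminus)

lemma laurent_divide_lmonom: "laurent V f \<Longrightarrow> laurent V (\<lambda>y. f y / lmonom V m y)"
  using laurent_mult[OF _ laurent_lmonom[of V "\<lambda>v. - m v"], of f] by (simp add: lmonom_uminus)

lemma lmonom_cong: "(\<And>u. u \<in> V \<Longrightarrow> m u \<noteq> 0 \<Longrightarrow> y u = y' u) \<Longrightarrow> lmonom V m y = lmonom V m y'"
  unfolding lmonom_def by (intro prod.cong refl) (metis power_int_0_right)

lemma lmonom_cong_exp: "(\<And>u. u \<in> V \<Longrightarrow> m u = m' u) \<Longrightarrow> lmonom V m y = lmonom V m' y"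
  unfolding lmonom_def by (intro prod.cong) auto

text \<open>
The form of the new value is the one that a mutation produces: a monomial times an exchange
polynomial.
\<close>

lemma lmonom_upd:
  assumes "finite V" "t \<in> V" "positive_on V y"
  shows "lmonom V m (y(t := lmonom V a y * F)) =
    lmonom V (\<lambda>u. of_bool (u \<noteq> t) * m u + m t * a u) y * F powi m t"
proof -
  have "lmonom V m (y(t := x)) = lmonom V (\<lambda>u. of_bool (u \<noteq> t) * m u) y * x powi m t" for x
    using assms unfolding lmonom_def
    by (simp add: prod.remove[of V t])
  moreover have "lmonom V a y powi m t = lmonom V (\<lambda>u. m t * a u) y"
    unfolding lmonom_def
    by (induction V rule: infinite_finite_induct)
      (auto simp: power_int_mult_distrib power_int_mult[symmetric] mult.commute)
  ultimately show ?thesis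
    by (simp add: lmonom_add[OF assms(3)] power_int_mult_distrib)
qed

section \<open>Cancellation modulo an exchange polynomial\<close>

definition weight :: "'v set \<Rightarrow> ('v \<Rightarrow> int) \<Rightarrow> ('v \<Rightarrow> int) \<Rightarrow> int" where
  "weight V l m = (\<Sum>v\<in>V. l v * m v)"

text \<open>
Giving the variable \<open>v\<close> the weight \<open>l v\<close> grades the Laurent polynomials. The grading is
accessible on functions through the rescaling \<open>y\<^sub>v \<mapsto> q\<^bsup>l v\<^esup> y\<^sub>v\<close>, which multiplies the part of
weight \<open>d\<close> by \<open>q\<^sup>d\<close>.
\<close>

definition rescale :: "('v \<Rightarrow> int) \<Rightarrow> real \<Rightarrow> ('v \<Rightarrow> real) \<Rightarrow> 'v \<Rightarrow> real" where
  "rescale l q y v = q powi l v * y v"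

definition graded_part :: "'v set \<Rightarrow> ('v \<Rightarrow> int) \<Rightarrow> (int \<times> ('v \<Rightarrow> int)) list \<Rightarrow> int \<Rightarrow> ('v \<Rightarrow> real) \<Rightarrow>
    real" where
  "graded_part V l ts d y = lpoly V (filter (\<lambda>(c, m). weight V l m = d) ts) y"

lemma positive_on_scale: "0 < q \<Longrightarrow> positive_on V y \<Longrightarrow> positive_on V (rescale l q y)"
  by (auto simp: positive_on_def rescale_def)

lemma lmonom_scale:
  assumes "0 < q"
  shows "lmonom V m (rescale l q y) = q powi weight V l m * lmonom V m y"
proof -
  have "q powi weight V l m = (\<Prod>v\<in>V. (q powi l v) powi m v)"
    unfolding weight_def using assms
    by (induction V rule: infinite_finite_induct) (auto simp: power_int_add power_int_mult)
  then show ?thesis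
    by (simp add: lmonom_def rescale_def power_int_mult_distrib prod.distrib)
qed

lemma laurent_part: "laurent V (graded_part V l ts d)"
  unfolding laurent_def graded_part_def by blast

lemma part_outside: "(\<And>c m. (c, m) \<in> set ts \<Longrightarrow> weight V l m \<noteq> d) \<Longrightarrow> graded_part V l ts d y = 0"
  unfolding graded_part_def lpoly_def by (subst filter_False) auto

lemma lpoly_scale:
  assumes "0 < q" "finite D" "\<And>c m. (c, m) \<in> set ts \<Longrightarrow> weight V l m \<in> D"
  shows "lpoly V ts (rescale l q y) = (\<Sum>d\<in>D. graded_part V l ts d y * q powi d)"
  using assms(3)
proof (induction ts)
  case Nil
  then show ?case by (simp add: graded_part_def)
next
  case (Cons t ts)
  obtain c m where t: "t = (c, m)" by force
  have w: "weight V l m \<in> D" using Cons.prems t by auto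
  have "(\<Sum>d\<in>D. graded_part V l (t # ts) d y * q powi d)
      = (\<Sum>d\<in>D. (if d = weight V l m then of_int c * lmonom V m y * q powi d else 0)
          + graded_part V l ts d y * q powi d)"
    by (intro sum.cong) (auto simp: t graded_part_def algebra_simps)
  also have "\<dots> = of_int c * lmonom V m y * q powi weight V l m
       + (\<Sum>d\<in>D. graded_part V l ts d y * q powi d)"
    using w assms(2) by (simp add: sum.distrib sum.delta)
  also have "(\<Sum>d\<in>D. graded_part V l ts d y * q powi d) = lpoly V ts (rescale l q y)"
    by (rule Cons.IH [symmetric]) (use Cons.prems in auto)
  also have "of_int c * lmonom V m y * q powi weight V l m + lpoly V ts (rescale l q y)
      = lpoly V (t # ts) (rescale l q y)"
    by (simp add: t lmonom_scale[OF assms(1)])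
  finally show ?case by simp
qed

lemma lpoly_parts:
  assumes "finite D" "\<And>c m. (c, m) \<in> set ts \<Longrightarrow> weight V l m \<in> D"
  shows "lpoly V ts y = (\<Sum>d\<in>D. graded_part V l ts d y)"
proof -
  have "rescale l 1 y = y" by (simp add: rescale_def fun_eq_iff)
  with lpoly_scale[where q = 1 and y = y, OF _ assms] show ?thesis by simp
qed

text \<open>
Multiplied by \<open>q\<^sup>N\<close>, the sum is a polynomial in \<open>q\<close> with infinitely many roots.
\<close>

lemma power_sum_coeffs_zero:
  fixes a :: "int \<Rightarrow> real"
  assumes z: "\<And>q. 0 < q \<Longrightarrow> (\<Sum>d\<in>{-int N..int N}. a d * q powi d) = 0"
    and d: "d \<in> {-int N..int N}"
  shows "a d = 0"
proof (rule ccontr)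
  assume nz: "a d \<noteq> 0"
  have "(\<Sum>i\<le>2 * N. a (int i - int N) * q ^ i) = 0" if l: "0 < q" for q
  proof -
    have "(\<Sum>i\<le>2 * N. a (int i - int N) * q ^ i) =
        (\<Sum>d\<in>{-int N..int N}. a d * q powi d * q ^ N)"
      by (rule sum.reindex_bij_witness[of _ "\<lambda>d. nat (d + int N)" "\<lambda>i. int i - int N"])
         (use l in \<open>auto simp: power_int_diff\<close>)
    also have "\<dots> = 0" using z[OF l] by (simp add: sum_distrib_right[symmetric])
    finally show ?thesis .
  qed
  then have "{0<..} \<subseteq> {q. (\<Sum>i\<le>2 * N. a (int i - int N) * q ^ i) = 0}" by auto
  moreover have "infinite {0::real<..}" by (rule infinite_Ioi)
  ultimately have "infinite {q. (\<Sum>i\<le>2 * N. a (int i - int N) * q ^ i) = 0}"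
    using finite_subset by blast
  then have "\<forall>i\<le>2 * N. a (int i - int N) = 0"
    using polyfun_finite_roots[of "\<lambda>i. a (int i - int N)" "2 * N"] by blast
  moreover have "nat (d + int N) \<le> 2 * N" using d by auto
  ultimately have "a (int (nat (d + int N)) - int N) = 0" by blast
  with d nz show False by auto
qed

text \<open>
\<open>Q\<close> is a non-zero-divisor modulo \<open>P\<close> in the ring of Laurent polynomials.
\<close>

definition cancels :: "'v set \<Rightarrow> (('v \<Rightarrow> real) \<Rightarrow> real) \<Rightarrow> (('v \<Rightarrow> real) \<Rightarrow> real) \<Rightarrow> bool" where
  "cancels V P Q \<longleftrightarrow>
     (\<forall>g. laurent V g \<longrightarrow> laurent V (\<lambda>y. g y * Q y / P y) \<longrightarrow> laurent V (\<lambda>y. g y / P y))"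

lemma cancels_mult:
  assumes "cancels V P Q" "cancels V P R" "laurent V Q"
  shows "cancels V P (\<lambda>y. Q y * R y)"
  unfolding cancels_def
proof (intro allI impI)
  fix g assume g: "laurent V g" and h: "laurent V (\<lambda>y. g y * (Q y * R y) / P y)"
  have gQ: "laurent V (\<lambda>y. g y * Q y)" using g assms(3) by (rule laurent_mult)
  have "laurent V (\<lambda>y. g y * Q y * R y / P y)" using h by (simp add: mult.assoc)
  then have "laurent V (\<lambda>y. g y * Q y / P y)" using assms(2) gQ unfolding cancels_def by blast
  then show "laurent V (\<lambda>y. g y / P y)" using assms(1) g unfolding cancels_def by blast
qed

lemma cancels_power: "cancels V P Q \<Longrightarrow> laurent V Q \<Longrightarrow> cancels V P (\<lambda>y. Q y ^ n)"
proof (induction n)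
  case 0
  then show ?case by (simp add: cancels_def)
next
  case (Suc n)
  then show ?case using cancels_mult[of V P Q "\<lambda>y. Q y ^ n"] by simp
qed

text \<open>
The factors \<open>P\<close> of the denominator are removed one at a time: if \<open>f P\<^sup>N\<^sup>+\<^sup>1\<close> is a Laurent
polynomial, then \<open>P\<close> divides \<open>f P\<^sup>N\<^sup>+\<^sup>1 Q\<^sup>M\<close>, hence divides \<open>f P\<^sup>N\<^sup>+\<^sup>1\<close>.
\<close>

lemma cancels_coprime:
  assumes "cancels V P Q" "laurent V Q"
    and "laurent V (\<lambda>y. f y * P y ^ N)" "laurent V (\<lambda>y. f y * Q y ^ M)"
    and P: "laurent V P" "\<And>y. positive_on V y \<Longrightarrow> 0 < P y"
  shows "laurent V f"
  using assms(3)
proof (induction N)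
  case 0
  then show ?case by simp
next
  case (Suc N)
  have "laurent V (\<lambda>y. f y * Q y ^ M * P y ^ N)"
    by (intro laurent_mult laurent_power assms)
  then have "laurent V (\<lambda>y. f y * P y ^ Suc N * Q y ^ M / P y)"
    by (rule laurent_cong) (drule P(2), simp)
  then have "laurent V (\<lambda>y. f y * P y ^ Suc N / P y)"
    using cancels_power[OF assms(1,2), of M] Suc.prems unfolding cancels_def by blast
  then have "laurent V (\<lambda>y. f y * P y ^ N)"
    by (rule laurent_cong) (drule P(2), simp)
  then show ?case by (rule Suc.IH)
qed

text \<open>
Monomials are units, and modulo \<open>P\<close> only the monomial in \<open>Q\<close> remains.
\<close>

lemma cancels_unit:
  assumes P: "laurent V P" "\<And>y. positive_on V y \<Longrightarrow> 0 < P y"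
    and H: "laurent V H" and Q: "\<And>y. positive_on V y \<Longrightarrow> Q y = lmonom V m y + P y * H y"
  shows "cancels V P Q"
  unfolding cancels_def
proof (intro allI impI)
  fix g assume g: "laurent V g" and h: "laurent V (\<lambda>y. g y * Q y / P y)"
  have "laurent V (\<lambda>y. (g y * Q y / P y - g y * H y) / lmonom V m y)"
    by (intro laurent_divide_lmonom laurent_diff laurent_mult g h H)
  then show "laurent V (\<lambda>y. g y / P y)"
  proof (rule laurent_cong)
    fix y assume y: "positive_on V y"
    show "g y / P y = (g y * Q y / P y - g y * H y) / lmonom V m y"
      using P(2)[OF y] lmonom_pos[OF y, of m] Q[OF y] by (simp add: field_simps)
  qed
qed

text \<open>
Here \<open>P\<close> is homogeneous of weight \<open>0\<close>, while the two terms of \<open>Q\<close> have different weights. If \<open>P\<close>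
divides \<open>g Q\<close>, it divides every homogeneous part of \<open>g Q\<close>. The part of lowest weight is the
lowest part of \<open>g\<close> times the lower term of \<open>Q\<close>, so \<open>P\<close> divides the lowest part of \<open>g\<close>. Its
contribution can be subtracted, and the argument continues upwards through the weights.
\<close>

lemma cancels_binomial:
  assumes P: "\<And>y. positive_on V y \<Longrightarrow> 0 < P y"
      "\<And>y q. 0 < q \<Longrightarrow> positive_on V y \<Longrightarrow> P (rescale l q y) = P y"
    and Q: "\<And>y. positive_on V y \<Longrightarrow> Q y = lmonom V m y + lmonom V m' y"
    and lt: "weight V l m < weight V l m'"
  shows "cancels V P Q"
  unfolding cancels_def
proof (intro allI impI)
  fix g assume g: "laurent V g" and h: "laurent V (\<lambda>y. g y * Q y / P y)"
  let ?a = "weight V l m" and ?b = "weight V l m'"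
  obtain ts where ts: "\<And>y. positive_on V y \<Longrightarrow> g y = lpoly V ts y"
    using g unfolding laurent_def by blast
  obtain us where us: "\<And>y. positive_on V y \<Longrightarrow> g y * Q y / P y = lpoly V us y"
    using h unfolding laurent_def by blast
  let ?g = "graded_part V l ts" and ?h = "graded_part V l us"
  define S where "S = (\<lambda>(c, m). weight V l m) ` (set ts \<union> set us)"
  have finS: "finite S" by (simp add: S_def)
  \<comment> \<open>large enough for all weights that occur, also after shifting by the weights of \<open>Q\<close>\<close>
  define N where "N = nat (Max (insert 0 (abs ` S)) + \<bar>?a\<bar> + \<bar>?b\<bar>)"
  have bound: "\<bar>d\<bar> \<le> int N - \<bar>?a\<bar> - \<bar>?b\<bar>" if "d \<in> S" for d
  proof -
    have "0 \<le> Max (insert 0 (abs ` S))" using finS by (intro Max_ge) auto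
    moreover have "\<bar>d\<bar> \<le> Max (insert 0 (abs ` S))" using finS that by (intro Max_ge) auto
    ultimately show ?thesis by (simp add: N_def)
  qed
  let ?D = "{-int N..int N}"
  have g0: "?g d y = 0" if "d \<notin> S" for d y
    by (rule part_outside) (use that in \<open>force simp: S_def\<close>)
  have SD: "S \<subseteq> ?D" using bound by fastforce
  have shift: "(\<Sum>d\<in>?D. ?g d y * q powi d) * q powi e = (\<Sum>d\<in>?D. ?g (d - e) y * q powi d)"
    if l: "0 < q" and e: "\<bar>e\<bar> \<le> \<bar>?a\<bar> + \<bar>?b\<bar>" for q e y
  proof -
    have "(\<Sum>d\<in>?D. ?g d y * q powi d) * q powi e = (\<Sum>d\<in>S. ?g d y * q powi (d + e))"
      unfolding sum_distrib_right using SD l g0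
      by (intro sum.mono_neutral_cong_right) (auto simp: power_int_add)
    also have "\<dots> = (\<Sum>d\<in>(\<lambda>d. d + e) ` S. ?g (d - e) y * q powi d)"
      by (subst sum.reindex) auto
    also have "\<dots> = (\<Sum>d\<in>?D. ?g (d - e) y * q powi d)"
    proof (intro sum.mono_neutral_left ballI)
      show "(\<lambda>d. d + e) ` S \<subseteq> ?D" using bound e by fastforce
      fix d assume "d \<in> ?D - (\<lambda>d. d + e) ` S"
      then have "d - e \<notin> S" by (metis DiffD2 diff_add_cancel image_eqI)
      then show "?g (d - e) y * q powi d = 0" using g0 by simp
    qed simp
    finally show ?thesis .
  qed
  \<comment> \<open>the parts of weight \<open>d\<close> in \<open>g Q = P h\<close>\<close>
  have rel: "lmonom V m y * ?g (d - ?a) y + lmonom V m' y * ?g (d - ?b) y = P y * ?h d y"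
    if y: "positive_on V y" and d: "d \<in> ?D" for y d
  proof -
    have "(\<Sum>d\<in>?D. (lmonom V m y * ?g (d - ?a) y + lmonom V m' y * ?g (d - ?b) y - P y * ?h d y)
             * q powi d) = 0" if l: "0 < q" for q
    proof -
      let ?z = "rescale l q y"
      have z: "positive_on V ?z" using l y by (rule positive_on_scale)
      have "g ?z * (lmonom V m ?z + lmonom V m' ?z) = P ?z * lpoly V us ?z"
        using us[OF z] P(1)[OF z] Q[OF z] by (simp add: field_simps)
      moreover have "g ?z = (\<Sum>d\<in>?D. ?g d y * q powi d)"
        unfolding ts[OF z] using SD by (intro lpoly_scale l) (auto simp: S_def)
      moreover have "lpoly V us ?z = (\<Sum>d\<in>?D. ?h d y * q powi d)"
        using SD by (intro lpoly_scale l) (auto simp: S_def)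
      ultimately have e: "(\<Sum>d\<in>?D. ?g d y * q powi d) * q powi ?a * lmonom V m y
          + (\<Sum>d\<in>?D. ?g d y * q powi d) * q powi ?b * lmonom V m' y
          = P y * (\<Sum>d\<in>?D. ?h d y * q powi d)"
        by (simp add: lmonom_scale[OF l] P(2)[OF l y] algebra_simps)
      have "(\<Sum>d\<in>?D. (lmonom V m y * ?g (d - ?a) y + lmonom V m' y * ?g (d - ?b) y - P y * ?h d y)
             * q powi d)
          = lmonom V m y * (\<Sum>d\<in>?D. ?g (d - ?a) y * q powi d)
            + lmonom V m' y * (\<Sum>d\<in>?D. ?g (d - ?b) y * q powi d)
            - P y * (\<Sum>d\<in>?D. ?h d y * q powi d)"
        by (simp add: algebra_simps sum.distrib sum_subtractf sum_distrib_left)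
      also have "\<dots> = 0"
        using e shift[OF l, of ?a y] shift[OF l, of ?b y] by (simp add: mult.commute)
      finally show ?thesis .
    qed
    from power_sum_coeffs_zero[OF this d] show ?thesis by simp
  qed
  have graded_part: "laurent V (\<lambda>y. ?g d y / P y)" for d
  proof (induction "nat (d + int N)" arbitrary: d rule: less_induct)
    case less
    show ?case
    proof (cases "d \<in> S")
      case False
      then have "(\<lambda>y. ?g d y / P y) = (\<lambda>y. 0)" using g0 by auto
      then show ?thesis by (simp add: laurent_0)
    next
      case True
      let ?e = "d + ?a - ?b"
      have dD: "d + ?a \<in> ?D" using bound[OF True] by auto
      have dN: "- int N \<le> d" using bound[OF True] by auto
      have "laurent V (\<lambda>y. ?g ?e y / P y)"
      proof (cases "?e \<in> S")
        case False
        then have "(\<lambda>y. ?g ?e y / P y) = (\<lambda>y. 0)" using g0 by auto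
        then show ?thesis by (simp add: laurent_0)
      next
        case True
        from less(1)[of ?e] lt bound[OF True] dN show ?thesis by auto
      qed
      then have "laurent V (\<lambda>y. (?h (d + ?a) y - lmonom V m' y * (?g ?e y / P y)) / lmonom V m y)"
        by (intro laurent_divide_lmonom laurent_diff laurent_part laurent_mult laurent_lmonom)
      then show ?thesis
      proof (rule laurent_cong)
        fix y assume y: "positive_on V y"
        show "?g d y / P y = (?h (d + ?a) y - lmonom V m' y * (?g ?e y / P y)) / lmonom V m y"
          using rel[OF y dD] P(1)[OF y] lmonom_pos[OF y, of m] by (simp add: field_simps)
      qed
    qed
  qed
  have "laurent V (\<lambda>y. \<Sum>d\<in>?D. ?g d y / P y)" by (intro laurent_sum graded_part)
  then show "laurent V (\<lambda>y. g y / P y)"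
  proof (rule laurent_cong)
    fix y assume y: "positive_on V y"
    have "g y = (\<Sum>d\<in>?D. ?g d y)" unfolding ts[OF y] using SD
      by (intro lpoly_parts) (auto simp: S_def)
    then show "g y / P y = (\<Sum>d\<in>?D. ?g d y / P y)" by (simp add: sum_divide_distrib)
  qed
qed

text \<open>
Denominators arise only from the inverses of the new coordinates, and each of these is \<open>1 / R\<close>
times a Laurent polynomial.
\<close>

lemma laurent_subst:
  assumes g: "laurent V g"
    and z: "\<And>y. positive_on V y \<Longrightarrow> positive_on V (z y)"
    and R: "laurent V R"
    and num: "\<And>u. u \<in> V \<Longrightarrow> laurent V (\<lambda>y. z y u)"
    and den: "\<And>u. u \<in> V \<Longrightarrow> laurent V (\<lambda>y. R y / z y u)"
  shows "\<exists>N. laurent V (\<lambda>y. g (z y) * R y ^ N)"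
  using g
proof (induction rule: laurent_induct)
  case zero
  show ?case by (simp add: laurent_0)
next
  case (add c m g)
  then obtain N where N: "laurent V (\<lambda>y. g (z y) * R y ^ N)" by blast
  define M where "M = (\<Sum>u\<in>V. nat \<bar>m u\<bar>)"
  have "laurent V (\<lambda>y. \<Prod>u\<in>V. if m u \<ge> 0 then z y u ^ nat (m u) * R y ^ nat (m u)
          else (R y / z y u) ^ nat (- m u))" (is "laurent V ?p")
  proof (intro laurent_prod)
    fix u assume u: "u \<in> V"
    show "laurent V (\<lambda>y. if m u \<ge> 0 then z y u ^ nat (m u) * R y ^ nat (m u)
          else (R y / z y u) ^ nat (- m u))"
      using laurent_power[OF num[OF u]] laurent_power[OF den[OF u]] laurent_power[OF R]
      by (cases "m u \<ge> 0") (auto intro: laurent_mult)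
  qed
  then have "laurent V (\<lambda>y. of_int c * ?p y * R y ^ N + g (z y) * R y ^ N * R y ^ M)"
    by (intro laurent_add laurent_mult laurent_power laurent_of_int N R)
  then have "laurent V (\<lambda>y. (of_int c * lmonom V m (z y) + g (z y)) * R y ^ (M + N))"
  proof (rule laurent_cong)
    fix y assume y: "positive_on V y"
    have "lmonom V m (z y) * R y ^ M = (\<Prod>u\<in>V. z y u powi m u * R y ^ nat \<bar>m u\<bar>)"
      by (simp add: lmonom_def M_def power_sum prod.distrib)
    also have "\<dots> = ?p y"
      by (intro prod.cong) (auto simp: power_int_def field_simps)
    finally show "(of_int c * lmonom V m (z y) + g (z y)) * R y ^ (M + N) =
       of_int c * ?p y * R y ^ N + g (z y) * R y ^ N * R y ^ M"
      by (simp add: power_add algebra_simps)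
  qed
  then show ?case by blast
next
  case (cong f g)
  then obtain N where N: "laurent V (\<lambda>y. f (z y) * R y ^ N)" by blast
  then have "laurent V (\<lambda>y. g (z y) * R y ^ N)"
    by (rule laurent_cong) (simp add: cong(2) z)
  then show ?case by blast
qed

section \<open>Seed mutation\<close>

definition skew :: "('v \<Rightarrow> 'v \<Rightarrow> int) \<Rightarrow> bool" where
  "skew b \<longleftrightarrow> (\<forall>u v. b u v = - b v u)"

text \<open>
The columns of the exchange matrix at \<open>T\<close> are linearly independent in a strong sense: an
integral weight function can take arbitrary prescribed values on them. In particular there are
gradings in which one column has weight \<open>0\<close> and another one has weight \<open>1\<close>.
\<close>

definition unimodular :: "'v set \<Rightarrow> 'v set \<Rightarrow> ('v \<Rightarrow> 'v \<Rightarrow> int) \<Rightarrow> bool" where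
  "unimodular V T b \<longleftrightarrow> (\<forall>a. \<exists>l. \<forall>s\<in>T. weight V l (\<lambda>u. b u s) = a s)"

fun mutate_along :: "'v set \<Rightarrow> ('v \<Rightarrow> 'v \<Rightarrow> int) \<Rightarrow> 'v list \<Rightarrow> ('v \<Rightarrow> 'a::field) \<Rightarrow> 'v \<Rightarrow> 'a" where
  "mutate_along V b [] y = y"
| "mutate_along V b (t # w) y = mutate_along V (mutate_matrix b t) w (mutate_var V b t y)"

fun matrix_along :: "('v \<Rightarrow> 'v \<Rightarrow> int) \<Rightarrow> 'v list \<Rightarrow> 'v \<Rightarrow> 'v \<Rightarrow> int" where
  "matrix_along b [] = b"
| "matrix_along b (t # w) = matrix_along (mutate_matrix b t) w"

lemma mutate_along_append: "mutate_along V b (w @ w') y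
    = mutate_along V (matrix_along b w) w' (mutate_along V b w y)"
  by (induction w arbitrary: b y) auto

lemma matrix_along_append: "matrix_along b (w @ w') = matrix_along (matrix_along b w) w'"
  by (induction w arbitrary: b) auto

lemma mutate_along_frozen: "v \<notin> set w \<Longrightarrow> mutate_along V b w y v = y v"
  by (induction w arbitrary: b y) (auto simp: mutate_var_def)

lemma mutate_along_of_real: "mutate_along V b w (\<lambda>v. of_real (y v) :: complex) v
    = of_real (mutate_along V b w y v)"
proof (induction w arbitrary: b y)
  case (Cons t w)
  have "mutate_var V b t (\<lambda>v. of_real (y v) :: complex) = (\<lambda>v. of_real (mutate_var V b t y v))"
    by (auto simp: mutate_var_def fun_eq_iff)
  then show ?case by (simp add: Cons)
qed simp

lemma skew_diag: "skew b \<Longrightarrow> b t t = (0::int)"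
  unfolding skew_def by (metis equal_neg_zero)

text \<open>
With \<open>x = b\<^sub>u\<^sub>t\<close> and \<open>c = b\<^sub>t\<^sub>v\<close> this makes the rule for the mutation of column \<open>v\<close> linear in
the positive and negative parts of column \<open>t\<close>.
\<close>

lemma sgn_max_eq:
  "sgn x * max (x * c) 0 = max c 0 * x + c * max (- x) (0::int)"
proof (cases "x \<ge> 0")
  case True
  then have "max (x * c) 0 = x * max c 0" by (simp add: max_mult_distrib_left)
  with True show ?thesis by (cases "x = 0") (auto simp: max_def sgn_if)
next
  case False
  then have "max (x * c) 0 = - x * max (- c) 0"
    using max_mult_distrib_left[of "- x" "- c" 0] by simp
  moreover have "sgn x = - 1" "max (- x) 0 = - x" using False by simp_all
  ultimately show ?thesis by (cases "c \<ge> 0") (simp_all add: max_def)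
qed

lemma skew_mutate:
  assumes "skew b"
  shows "skew (mutate_matrix b t)"
  unfolding skew_def
proof (intro allI)
  fix u v
  have *: "b u v = - b v u" "b v t = - b t v" "b t u = - b u t" using assms unfolding skew_def
      by blast+
  have **: "sgn (b u t) * max (b u t * b t v) 0 = - (sgn (b v t) * max (b v t * b t u) 0)"
    unfolding sgn_max_eq *(2,3) by (simp add: mult.commute)
  show "mutate_matrix b t u v = - mutate_matrix b t v u"
  proof (cases "u = t \<or> v = t")
    case True
    then have "mutate_matrix b t u v = - b u v" "mutate_matrix b t v u = - b v u"
      by (auto simp: mutate_matrix_def)
    with *(1) show ?thesis by linarith
  next
    case False
    then show ?thesis using ** *(1) unfolding mutate_matrix_def by auto
  qed
qed

lemma mutate_matrix_involution: "mutate_matrix (mutate_matrix b t) t = b"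
  by (intro ext) (simp add: mutate_matrix_def)

text \<open>
By \<open>sgn_max_eq\<close> the new column \<open>v\<close> is \<open>E (b\<^sub>v + [b\<^sub>t\<^sub>v]\<^sub>+ b\<^sub>t)\<close>, where \<open>b\<^sub>v\<close> is the old column,
the linear map \<open>E\<close> is given by \<open>E m = m + m t \<cdot> (n - 2 e\<^sub>t)\<close>, and \<open>n\<close> is the negative part of
column \<open>t\<close>. Composing a weight function with \<open>E\<close> gives \<open>l'\<close>, and the prescribed values change by
the triangular substitution \<open>a'\<close>.
\<close>

lemma unimodular_mutate:
  assumes "finite V" "t \<in> T" "T \<subseteq> V" "skew b" "unimodular V T b"
  shows "unimodular V T (mutate_matrix b t)"
  unfolding unimodular_def
proof
  fix a :: "'a \<Rightarrow> int"
  have tV: "t \<in> V" using assms by blast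
  define a' where "a' v = (if v = t then - a t else a v + max (b t v) 0 * a t)" for v
  obtain l where l: "\<And>v. v \<in> T \<Longrightarrow> weight V l (\<lambda>u. b u v) = a' v"
    using assms(5) unfolding unimodular_def by metis
  define n where "n u = max (- b u t) 0" for u
  define l' where "l' = l(t := weight V l n - l t)"
  have btt: "b t t = 0" by (rule skew_diag[OF assms(4)])
  have V: "V = insert t (V - {t})" using tV by auto
  have w: "weight V l' m = weight V l m + m t * (weight V l n - 2 * l t)" for m
    unfolding weight_def l'_def using assms(1) tV
    by (simp add: sum.remove[of V t] algebra_simps)
  have "weight V l' (\<lambda>u. mutate_matrix b t u v) = a v" if v: "v \<in> T" for v
  proof (cases "v = t")
    case True
    have "weight V l' (\<lambda>u. mutate_matrix b t u v) = - weight V l (\<lambda>u. b u t)"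
      unfolding w by (simp add: True mutate_matrix_def btt weight_def sum_negf)
    with l[OF assms(2)] show ?thesis by (simp add: True a'_def)
  next
    case False
    have "weight V l (\<lambda>u. mutate_matrix b t u v)
        = (\<Sum>u\<in>V. l u * (b u v + max (b t v) 0 * b u t + b t v * n u)
             - (if u = t then 2 * l t * b t v else 0))"
      unfolding weight_def using False
      by (intro sum.cong) (auto simp: mutate_matrix_def sgn_max_eq btt n_def algebra_simps)
    also have "\<dots> = weight V l (\<lambda>u. b u v) + max (b t v) 0 * weight V l (\<lambda>u. b u t)
        + b t v * weight V l n - 2 * l t * b t v"
      using assms(1) tV
      by (simp add: weight_def sum_subtractf sum.delta algebra_simps sum.distrib sum_distrib_left)
    finally show ?thesis
      using l[OF v] l[OF assms(2)] False
      by (simp add: w mutate_matrix_def a'_def algebra_simps)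
  qed
  then show "\<exists>l. \<forall>s\<in>T. weight V l (\<lambda>u. mutate_matrix b t u s) = a s" by blast
qed

lemma mutate_var_real:
  fixes y :: "'v \<Rightarrow> real"
  assumes "finite V" "positive_on V y"
  shows "mutate_var V b t y =
    y(t := (lmonom V (\<lambda>u. max (b u t) 0) y + lmonom V (\<lambda>u. max (- b u t) 0) y) / y t)"
proof -
  have "(\<Prod>u\<in>{u \<in> V. b u t > 0}. y u ^ nat (b u t)) = lmonom V (\<lambda>u. max (b u t) 0) y"
    unfolding lmonom_def using assms(1)
    by (intro prod.mono_neutral_cong_left) (auto simp: max_def power_int_def)
  moreover have "(\<Prod>u\<in>{u \<in> V. b u t < 0}. y u ^ nat (- b u t)) = lmonom V (\<lambda>u. max (- b u t) 0) y"
    unfolding lmonom_def using assms(1)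
    by (intro prod.mono_neutral_cong_left) (auto simp: max_def power_int_def)
  ultimately show ?thesis by (simp add: mutate_var_def)
qed

lemma lmonom_max:
  assumes "positive_on V y"
  shows "lmonom V (\<lambda>u. max (c u) 0) y + lmonom V (\<lambda>u. max (- c u) 0) y
    = lmonom V (\<lambda>u. max (- c u) 0) y * (1 + lmonom V c y)"
proof -
  have "lmonom V (\<lambda>u. max (c u) 0) y = lmonom V (\<lambda>u. max (- c u) 0 + c u) y"
    by (rule arg_cong[where f = "\<lambda>m. lmonom V m y"]) (auto simp: max_def)
  then show ?thesis by (simp add: lmonom_add[OF assms] algebra_simps)
qed

lemma positive_on_mutate:
  fixes y :: "'v \<Rightarrow> real"
  assumes "finite V" "t \<in> V" "positive_on V y"
  shows "positive_on V (mutate_var V b t y)"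
  using assms lmonom_pos[OF assms(3)]
  by (auto simp: mutate_var_real positive_on_def add_pos_pos intro!: divide_pos_pos)

lemma positive_on_mseq:
  fixes y :: "'v \<Rightarrow> real"
  shows "finite V \<Longrightarrow> set w \<subseteq> V \<Longrightarrow> positive_on V y \<Longrightarrow> positive_on V (mutate_along V b w y)"
  by (induction w arbitrary: b y) (auto simp: positive_on_mutate)

lemma mutate_var_involution:
  fixes y :: "'v \<Rightarrow> 'a::field"
  assumes "b t t = 0" "y t \<noteq> 0" "mutate_var V b t y t \<noteq> 0"
  shows "mutate_var V (mutate_matrix b t) t (mutate_var V b t y) = y"
proof -
  let ?P = "\<lambda>y::'v \<Rightarrow> 'a. \<Prod>u\<in>{u \<in> V. b u t > 0}. y u ^ nat (b u t)"
  let ?N = "\<lambda>y::'v \<Rightarrow> 'a. \<Prod>u\<in>{u \<in> V. b u t < 0}. y u ^ nat (- b u t)"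
  have neg: "mutate_matrix b t u t = - b u t" for u by (simp add: mutate_matrix_def)
  have P: "?P (y(t := x)) = ?P y" and N: "?N (y(t := x)) = ?N y" for x
    using assms(1) by (auto intro!: prod.cong)
  have m: "mutate_var V b t y = y(t := (?P y + ?N y) / y t)" by (simp add: mutate_var_def)
  have step: "mutate_var V (mutate_matrix b t) t z = z(t := (?P z + ?N z) / z t)" for z
    unfolding mutate_var_def neg by (simp add: add.commute)
  have "mutate_var V (mutate_matrix b t) t (y(t := x)) = y(t := (?P y + ?N y) / x)" for x
    unfolding step P N by (simp only: fun_upd_upd fun_upd_same)
  with assms(2,3) show ?thesis unfolding m by (simp only: fun_upd_same) simp
qed

lemma mutate_matrix_uminus: "mutate_matrix (\<lambda>u v. - b u v) t = (\<lambda>u v. - mutate_matrix b t u v)"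
  by (intro ext) (simp add: mutate_matrix_def sgn_minus)

lemma mutate_along_uminus: "mutate_along V (\<lambda>u v. - b u v) w y = mutate_along V b w y"
proof (induction w arbitrary: b y)
  case (Cons t w)
  have "mutate_var V (\<lambda>u v. - b u v) t y = mutate_var V b t y"
    by (simp add: mutate_var_def add.commute)
  then show ?case unfolding mutate_along.simps mutate_matrix_uminus by (simp only: Cons)
qed simp

lemma unimodular_uminus:
  assumes "unimodular V T b"
  shows "unimodular V T (\<lambda>u v. - b u v)"
  unfolding unimodular_def
proof
  fix a :: "'a \<Rightarrow> int"
  obtain l where "\<forall>s\<in>T. weight V l (\<lambda>u. b u s) = - a s"
    using assms[unfolded unimodular_def, THEN spec, of "\<lambda>s. - a s"] by (rule exE)
  moreover have "weight V l (\<lambda>u. - b u s) = - weight V l (\<lambda>u. b u s)" for s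
    by (simp add: weight_def sum_negf)
  ultimately have "\<forall>s\<in>T. weight V l (\<lambda>u. - b u s) = a s" by simp
  then show "\<exists>l. \<forall>s\<in>T. weight V l (\<lambda>u. - b u s) = a s" by (rule exI[of _ l])
qed

text \<open>
The form in which \<open>laurent_subst\<close> is applied to mutations: each new coordinate is a monomial
times a positive factor \<open>F u\<close> that divides \<open>R\<close>.
\<close>

lemma laurent_subst_units:
  assumes g: "laurent V g"
    and z: "\<And>y u. positive_on V y \<Longrightarrow> u \<in> V \<Longrightarrow> z y u = lmonom V (a u) y * F u y"
    and F: "\<And>u. u \<in> V \<Longrightarrow> laurent V (F u)" "\<And>u y. u \<in> V \<Longrightarrow> positive_on V y \<Longrightarrow> 0 < F u y"
    and R: "laurent V R" "\<And>u. u \<in> V \<Longrightarrow> laurent V (\<lambda>y. R y / F u y)"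
  shows "\<exists>N. laurent V (\<lambda>y. g (z y) * R y ^ N)"
proof (rule laurent_subst[OF g _ R(1)])
  fix y assume y: "positive_on V y"
  show "positive_on V (z y)" unfolding positive_on_def
    using z[OF y] F(2)[OF _ y] lmonom_pos[OF y] by auto
next
  fix u assume u: "u \<in> V"
  show "laurent V (\<lambda>y. z y u)"
    by (rule laurent_cong[OF laurent_mult[OF laurent_lmonom[of V "a u"] F(1)[OF u]]]) (simp add: z
        u)
  show "laurent V (\<lambda>y. R y / z y u)"
    by (rule laurent_cong[OF laurent_divide_lmonom[OF R(2)[OF u], of "a u"]]) (simp add: z u)
qed

section \<open>The Laurent phenomenon\<close>

lemma weight_of_bool:
  "finite V \<Longrightarrow> t \<in> V \<Longrightarrow> weight V (\<lambda>u. of_bool (u = t)) m = m t"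
  unfolding weight_def of_bool_def by (simp add: sum.delta if_distrib[of "\<lambda>x. x * _"] cong: if_cong)

text \<open>
Only the coordinate at \<open>t\<close> changes, to \<open>1 + y\<^sup>c\<close> times a monomial, with \<open>c\<close> the column at \<open>t\<close>.
\<close>

lemma laurent_mutate_once:
  fixes b :: "'v \<Rightarrow> 'v \<Rightarrow> int"
  assumes V: "finite V" "t \<in> V" and g: "laurent V g"
  shows "\<exists>N. laurent V (\<lambda>y. g (mutate_var V b t y) * (1 + lmonom V (\<lambda>u. b u t) y) ^ N)"
proof -
  define P where "P = (\<lambda>y. 1 + lmonom V (\<lambda>u. b u t) y)"
  have P: "laurent V P" unfolding P_def by (intro laurent_add laurent_1 laurent_lmonom)
  have Ppos: "0 < P y" if "positive_on V y" for y
    using lmonom_pos[OF that] by (simp add: P_def add_pos_pos)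
  define F where "F u = (if u = t then P else (\<lambda>y. 1))" for u
  define a where "a u = (if u = t then (\<lambda>v. max (- b v t) 0 - of_bool (v = t))
      else (\<lambda>v. of_bool (v = u)))" for u
  have "\<exists>N. laurent V (\<lambda>y. g (mutate_var V b t y) * P y ^ N)"
  proof (rule laurent_subst_units[OF g _ _ _ P])
    fix u y assume u: "u \<in> V" and y: "positive_on V y"
    show "mutate_var V b t y u = lmonom V (a u) y * F u y"
      using V u by (simp add: mutate_var_real[OF V(1) y] lmonom_max[OF y] a_def F_def P_def
          lmonom_single
          lmonom_diff[OF y])
    show "0 < F u y" using Ppos[OF y] by (simp add: F_def)
  next
    fix u assume u: "u \<in> V"
    show "laurent V (F u)" by (simp add: F_def P laurent_1)
    have "laurent V (\<lambda>y. if u = t then 1 else P y)" by (cases "u = t") (simp_all add: P laurent_1)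
    then show "laurent V (\<lambda>y. P y / F u y)"
      by (rule laurent_cong) (use Ppos in \<open>force simp: F_def\<close>)
  qed
  then show ?thesis by (simp add: P_def)
qed

text \<open>
If no arrow joins \<open>s\<close> and \<open>t\<close>, the mutations at \<open>s\<close> and \<open>t\<close> commute, so the two mutations at \<open>t\<close>
undo each other.
\<close>

lemma mutate_thrice_commuting:
  fixes y :: "'v \<Rightarrow> real"
  assumes V: "finite V" "t \<in> V" "s \<in> V" "s \<noteq> t" and b: "skew b" "b t s = 0" and y: "positive_on V y"
  defines "b1 \<equiv> mutate_matrix b t"
  defines "b2 \<equiv> mutate_matrix b1 s"
  shows "mutate_var V b2 t (mutate_var V b1 s (mutate_var V b t y)) = mutate_var V b s y"
proof -
  have diag: "b t t = 0" "b s s = 0" using b(1) by (auto intro: skew_diag)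
  have st: "b s t = 0" using b by (metis neg_equal_0_iff_equal skew_def)
  have b1s: "b1 u s = b u s" for u
    using V diag st b(2) by (simp add: b1_def mutate_matrix_def)
  have b1t: "b1 u t = - b u t" for u by (simp add: b1_def mutate_matrix_def)
  have b2t: "b2 u t = - b u t" for u
    using V diag st b(2) by (simp add: b2_def mutate_matrix_def b1s b1t)
  define y1 where "y1 = mutate_var V b t y"
  define y2 where "y2 = mutate_var V b1 s y1"
  have pos1: "positive_on V y1" unfolding y1_def by (rule positive_on_mutate[OF V(1,2) y])
  have pos2: "positive_on V y2" unfolding y2_def by (rule positive_on_mutate[OF V(1,3) pos1])
  define c where "c = lmonom V (\<lambda>u. max (b u t) 0) y + lmonom V (\<lambda>u. max (- b u t) 0) y"
  have c: "0 < c" using lmonom_pos[OF y] by (simp add: c_def add_pos_pos)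
  have e1: "y1 = y(t := c / y t)"
    unfolding y1_def c_def by (rule mutate_var_real[OF V(1) y])
  have f: "lmonom V m y1 = lmonom V m y" if "m t = 0" for m
    using that by (intro lmonom_cong) (auto simp: e1)
  define d where "d = (lmonom V (\<lambda>u. max (b u s) 0) y + lmonom V (\<lambda>u. max (- b u s) 0) y) / y s"
  have e2: "y2 = y1(s := d)"
    unfolding y2_def mutate_var_real[OF V(1) pos1] b1s d_def using b(2) V(4)
    by (simp add: f) (simp add: e1)
  have g: "lmonom V m y2 = lmonom V m y" if "m t = 0" "m s = 0" for m
    using that by (intro lmonom_cong) (auto simp: e1 e2)
  have yt: "0 < y t" using y V by (simp add: positive_on_def)
  have "mutate_var V b2 t y2 = y2(t := c / y2 t)"
    unfolding mutate_var_real[OF V(1) pos2] b2t using diag st by (simp add: g add.commute c_def)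
  also have "y2 t = c / y t" unfolding e2 using V(4) by (simp add: e1)
  also have "c / (c / y t) = y t" using c yt by simp
  also have "y2(t := y t) = y(s := d)"
    unfolding e2 e1 using V(4) by (auto simp: fun_eq_iff)
  also have "\<dots> = mutate_var V b s y" by (simp add: mutate_var_real[OF V(1) y] d_def)
  finally show ?thesis by (simp add: y2_def y1_def)
qed

text \<open>
A weight function that vanishes on the column at \<open>t\<close> but not on the column at \<open>s\<close> puts the two
exchange polynomials into the situation of \<open>cancels_binomial\<close>.
\<close>

lemma cancels_commuting:
  fixes b :: "'v \<Rightarrow> 'v \<Rightarrow> int"
  assumes V: "finite V" and T: "t \<in> T" "s \<in> T" "s \<noteq> t" and full: "unimodular V T b"
  shows "cancels V (\<lambda>y. 1 + lmonom V (\<lambda>u. b u t) y) (\<lambda>y. 1 + lmonom V (\<lambda>u. b u s) y)"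
proof -
  obtain l where l: "\<And>v. v \<in> T \<Longrightarrow> weight V l (\<lambda>u. b u v) = (if v = s then 1 else 0)"
    using full[unfolded unimodular_def, THEN spec, of "\<lambda>v. if v = s then 1 else 0"] by blast
  show ?thesis
  proof (rule cancels_binomial[where l = l and m = "\<lambda>_. 0" and m' = "\<lambda>u. b u s"])
    show "weight V l (\<lambda>_. 0) < weight V l (\<lambda>u. b u s)"
      using l[OF T(2)] by (simp add: weight_def)
  qed (use l[OF T(1)] T(3) in \<open>auto simp: lmonom_scale lmonom_pos add_pos_pos\<close>)
qed

text \<open>
Let \<open>n > 0\<close> arrows lead from \<open>t\<close> to \<open>s\<close>, and write \<open>c\<close>, \<open>e\<close>, \<open>f\<close> for the columns at \<open>t\<close>, \<open>s\<close>,
\<open>t\<close> used by the successive mutations at \<open>t\<close>, \<open>s\<close>, \<open>t\<close>. The first one replaces \<open>y\<^sub>t\<close> by \<open>P\<close> times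
a monomial. Since \<open>t\<close> occurs with exponent \<open>n\<close> in exactly one term of the exchange polynomial at
\<open>s\<close>, that polynomial is \<open>Q = N + K P\<^sup>n\<close> with monomials \<open>N\<close> and \<open>K\<close>; so \<open>Q\<close> is a unit modulo \<open>P\<close>.
The last exchange polynomial turns out to be a monomial times \<open>N\<^sup>n + y\<^sup>c Q\<^sup>n = P Q\<^sup>n - (Q\<^sup>n -
N\<^sup>n)\<close>, and it is divided by the value \<open>P\<close> (times a monomial) at \<open>t\<close>. As \<open>Q\<^sup>n - N\<^sup>n\<close> is divisible
by \<open>Q - N = K P\<^sup>n\<close>, the quotient \<open>W\<close> is a Laurent polynomial. If \<open>n \<ge> 2\<close>, then \<open>W\<close> is congruent
to the unit \<open>N\<^sup>n\<close> modulo \<open>P\<close>. If \<open>n = 1\<close>, then \<open>W = N + K y\<^sup>c\<close> is a binomial whose terms have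
different degrees in \<open>y\<^sub>t\<close>, while \<open>P\<close> has degree \<open>0\<close>.
\<close>

lemma mutate_thrice:
  fixes b :: "'v \<Rightarrow> 'v \<Rightarrow> int"
  assumes V: "finite V" "t \<in> V" "s \<in> V" "s \<noteq> t" and b: "skew b" "b t s = int n" "0 < n"
  defines "P \<equiv> \<lambda>y. 1 + lmonom V (\<lambda>u. b u t) y"
  defines "b1 \<equiv> mutate_matrix b t"
  defines "b2 \<equiv> mutate_matrix b1 s"
  shows "\<exists>Q W a a'. laurent V Q \<and> laurent V W \<and> cancels V P Q \<and> cancels V P W \<and>
    (\<forall>y. positive_on V y \<longrightarrow> 0 < Q y \<and> 0 < W y \<and>
      mutate_var V b2 t (mutate_var V b1 s (mutate_var V b t y)) =
        y(s := lmonom V a y * Q y, t := lmonom V a' y * W y))"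
proof -
  have diag: "b t t = 0" "b s s = 0" using b(1) by (auto intro: skew_diag)
  have st: "b s t = - int n" using b unfolding skew_def by metis
  define c where "c u = b u t" for u
  define e where "e u = b1 u s" for u
  define f where "f u = b2 u t" for u
  have c: "c t = 0" "c s = - int n" by (simp_all add: c_def diag st)
  have e: "e t = - int n" "e s = 0"
    using V diag st b by (simp_all add: e_def b1_def mutate_matrix_def)
  have b1st: "b1 s t = int n" using V by (simp add: b1_def mutate_matrix_def st)
  have f_s: "f s = - int n" using b1st by (simp add: f_def b2_def mutate_matrix_def)
  have f_u: "f u = - c u + int n * max (e u) 0" if "u \<noteq> s" for u
  proof -
    have "f u = b1 u t + sgn (b1 u s) * max (b1 u s * b1 s t) 0"
      using that V by (simp add: f_def b2_def mutate_matrix_def)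
    also have "b1 u t = - c u" by (simp add: b1_def mutate_matrix_def c_def)
    also have "sgn (b1 u s) * max (b1 u s * b1 s t) 0 = int n * max (e u) 0"
      unfolding sgn_max_eq b1st by (simp add: e_def[symmetric] max_def)
    finally show ?thesis .
  qed
  have f_t: "f t = 0" using f_u[of t] V c e by simp

  have Pc: "P y = 1 + lmonom V c y" for y by (simp add: P_def c_def[abs_def])
  define \<alpha> where "\<alpha> u = max (- c u) 0 - of_bool (u = t)" for u
  define \<kappa> where "\<kappa> u = of_bool (u \<noteq> t) * max (- e u) 0 + int n * \<alpha> u" for u
  define \<psi> where "\<psi> u = of_bool (u \<noteq> s) * max (- f u) 0 - int n * of_bool (u = s)" for u
  define N where "N = lmonom V (\<lambda>u. max (e u) 0)"
  define K where "K = lmonom V \<kappa>"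
  define Q where "Q y = N y + K y * P y ^ n" for y
  define G where "G y = (\<Sum>i<n. N y ^ (n - Suc i) * Q y ^ i)" for y
  define W where "W y = Q y ^ n - K y * P y ^ (n - 1) * G y" for y
  have lN: "laurent V N" and lK: "laurent V K"
    unfolding N_def K_def by (rule laurent_lmonom)+
  have lP: "laurent V P" unfolding P_def by (intro laurent_add laurent_1 laurent_lmonom)
  have lQ: "laurent V Q" unfolding Q_def[abs_def]
      by (intro laurent_add laurent_mult laurent_power lN lK lP)
  have lG: "laurent V G" unfolding G_def[abs_def]
      by (intro laurent_sum laurent_mult laurent_power lN lQ)
  have lW: "laurent V W" unfolding W_def[abs_def]
    by (intro laurent_diff laurent_mult laurent_power lK lQ lP lG)
  have Ppos: "0 < P y" if "positive_on V y" for y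
    using lmonom_pos[OF that] by (simp add: P_def add_pos_pos)
  have Npos: "0 < N y" and Kpos: "0 < K y" if "positive_on V y" for y
    using lmonom_pos[OF that] by (simp_all add: N_def K_def)
  have Qpos: "0 < Q y" if "positive_on V y" for y
    using Ppos[OF that] Npos[OF that] Kpos[OF that] by (simp add: Q_def add_pos_pos)
  have QN: "Q y ^ n - N y ^ n = K y * P y ^ n * G y" for y
    using power_diff_sumr2[of "Q y" n "N y"] by (simp add: Q_def G_def)
  have Pn: "P y ^ n = P y * P y ^ (n - 1)" for y
    using b(3) by (cases n) auto
  \<comment> \<open>the exchange polynomial of the last mutation, up to a monomial\<close>
  have WP: "P y * W y = N y ^ n + lmonom V c y * Q y ^ n" for y
  proof -
    have "P y * W y = P y * Q y ^ n - (Q y ^ n - N y ^ n)"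
      unfolding QN Pn by (simp add: W_def algebra_simps)
    then show ?thesis by (simp add: Pc algebra_simps)
  qed
  have Wpos: "0 < W y" if "positive_on V y" for y
  proof -
    have "0 < P y * W y" unfolding WP
      using Npos[OF that] Qpos[OF that] lmonom_pos[OF that] by (simp add: add_pos_pos)
    then show ?thesis using Ppos[OF that] by (simp add: zero_less_mult_iff)
  qed
  have cQ: "cancels V P Q"
  proof (rule cancels_unit[OF lP Ppos])
    show "laurent V (\<lambda>y. K y * P y ^ (n - 1))" by (intro laurent_mult laurent_power lK lP)
    show "Q y = lmonom V (\<lambda>u. max (e u) 0) y + P y * (K y * P y ^ (n - 1))" for y
      unfolding Q_def Pn by (simp add: N_def)
  qed
  have cW: "cancels V P W"
  proof (cases "n = 1")
    case True
    have W1: "W y = lmonom V (\<lambda>u. \<kappa> u + c u) y + lmonom V (\<lambda>u. max (e u) 0) y"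
        if y: "positive_on V y" for y
      unfolding lmonom_add[OF y] using True
      by (simp add: W_def Q_def G_def N_def K_def Pc algebra_simps)
    show ?thesis
    proof (rule cancels_binomial[OF Ppos _ W1])
      show "weight V (\<lambda>u. of_bool (u = t)) (\<lambda>u. \<kappa> u + c u)
          < weight V (\<lambda>u. of_bool (u = t)) (\<lambda>u. max (e u) 0)"
        using V True c e by (simp add: weight_of_bool \<kappa>_def \<alpha>_def)
    next
      fix y and q :: real
      assume "0 < q" "positive_on V y"
      then show "P (rescale (\<lambda>u. of_bool (u = t)) q y) = P y"
        using V c by (simp add: Pc lmonom_scale weight_of_bool)
    qed auto
  next
    case False
    then obtain m where m: "n = Suc (Suc m)" using b(3)
        by (metis One_nat_def not0_implies_Suc less_numeral_extra(3))
    show ?thesis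
    proof (rule cancels_unit[OF lP Ppos])
      show "laurent V (\<lambda>y. K y * P y ^ m * (P y - 1) * G y)"
        by (intro laurent_mult laurent_diff laurent_power laurent_1 lK lP lG)
      fix y
      have "W y = N y ^ n + (Q y ^ n - N y ^ n) - K y * P y ^ (n - 1) * G y"
        by (simp add: W_def)
      also have "\<dots> = N y ^ n + P y * (K y * P y ^ m * (P y - 1) * G y)"
        unfolding QN by (simp add: m algebra_simps)
      finally show "W y = lmonom V (\<lambda>u. int n * max (e u) 0) y + P y * (K y * P y ^ m * (P y - 1)
          * G y)"
        by (simp add: lmonom_mult N_def)
    qed auto
  qed
  have mut: "mutate_var V b2 t (mutate_var V b1 s (mutate_var V b t y)) =
        y(s := lmonom V (\<lambda>u. - of_bool (u = s)) y * Q y, t := lmonom V (\<lambda>u. \<psi> u - c u - \<alpha> u) y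
            * W y)"
    if y: "positive_on V y" for y
  proof -
    define y1 where "y1 = mutate_var V b t y"
    define y2 where "y2 = mutate_var V b1 s y1"
    have pos1: "positive_on V y1" unfolding y1_def by (rule positive_on_mutate[OF V(1,2) y])
    have pos2: "positive_on V y2" unfolding y2_def by (rule positive_on_mutate[OF V(1,3) pos1])
    have \<alpha>: "lmonom V \<alpha> y = lmonom V (\<lambda>u. max (- c u) 0) y / y t"
      unfolding \<alpha>_def[abs_def] using lmonom_diff[OF y] lmonom_single[OF V(1,2)] by simp
    have e1: "y1 = y(t := lmonom V \<alpha> y * P y)"
      unfolding y1_def mutate_var_real[OF V(1) y] c_def[symmetric] lmonom_max[OF y] \<alpha>
      by (simp add: Pc)
    have "lmonom V (\<lambda>u. max (e u) 0) y1 = N y"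
      unfolding e1 lmonom_upd[OF V(1,2) y] N_def using e
      by (auto intro!: lmonom_cong_exp)
    moreover have "lmonom V (\<lambda>u. max (- e u) 0) y1 = K y * P y ^ n"
      unfolding e1 lmonom_upd[OF V(1,2) y] using e by (simp add: K_def \<kappa>_def[abs_def])
    ultimately have e2: "y2 = y1(s := Q y / y s)"
      unfolding y2_def mutate_var_real[OF V(1) pos1] e_def[symmetric] Q_def
      using V by (simp add: e1)
    have minus_s: "lmonom V (\<lambda>u. - of_bool (u = s)) y * Q y = Q y / y s"
      using lmonom_single[OF V(1,3)] by (simp add: lmonom_uminus)
    have f2: "lmonom V m y2 = lmonom V m (y(s := lmonom V (\<lambda>u. - of_bool (u = s)) y * Q y))"
        if "m t = 0" for m
      using that V unfolding minus_s by (intro lmonom_cong) (auto simp: e1 e2)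
    have p1: "lmonom V (\<lambda>u. max (f u) 0) y2 = lmonom V (\<lambda>u. max (f u) 0) y"
      using f_s f_t by (subst f2) (auto intro!: lmonom_cong_exp simp: lmonom_upd[OF V(1,3) y])
    have p2: "lmonom V (\<lambda>u. max (- f u) 0) y2 = lmonom V \<psi> y * Q y ^ n"
      using f_s f_t by (subst f2) (auto intro!: lmonom_cong_exp simp: lmonom_upd[OF V(1,3) y] \<psi>_def)
    have p3: "lmonom V (\<lambda>u. max (f u) 0) y = lmonom V \<psi> y * (N y ^ n / lmonom V c y)"
    proof -
      have "lmonom V (\<lambda>u. max (f u) 0) y = lmonom V (\<lambda>u. \<psi> u + (int n * max (e u) 0 - c u)) y"
        using f_u f_s e c by (intro lmonom_cong_exp) (force simp: \<psi>_def max_def)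
      then show ?thesis by (simp add: lmonom_add[OF y] lmonom_diff[OF y] lmonom_mult N_def)
    qed
    have "mutate_var V b2 t y2 = y2(t := lmonom V \<psi> y * (N y ^ n / lmonom V c y + Q y ^ n) / y2 t)"
      unfolding mutate_var_real[OF V(1) pos2] f_def[symmetric] p1 p2 p3 by (simp add: algebra_simps)
    also have "N y ^ n / lmonom V c y + Q y ^ n = P y * W y / lmonom V c y"
      unfolding WP using lmonom_pos[OF y, of c] by (simp add: add_divide_distrib)
    also have "y2 t = lmonom V \<alpha> y * P y" unfolding e2 e1 using V by simp
    also have "lmonom V \<psi> y * (P y * W y / lmonom V c y) / (lmonom V \<alpha> y * P y)
        = lmonom V (\<lambda>u. \<psi> u - c u - \<alpha> u) y * W y"
      using Ppos[OF y] by (simp add: lmonom_diff[OF y])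
    finally show ?thesis
      unfolding y2_def[symmetric] y1_def[symmetric] minus_s using V
      by (simp add: y1_def[symmetric] y2_def[symmetric]) (auto simp: e2 e1 fun_eq_iff)
  qed
  show ?thesis
    using lQ lW cQ cW Qpos Wpos mut by blast
qed

text \<open>
The inductive step for a mutation sequence that starts with two different vertices \<open>t\<close> and \<open>s\<close>.
By \<open>g1\<close> the denominator of the result is a power of \<open>P\<close>. Mutating \<open>t, s, t\<close> and then \<open>t\<close> again
amounts to mutating \<open>t, s\<close>, so by \<open>g3\<close> the result is a Laurent polynomial in the seed reached by
\<open>t, s, t\<close>, and its denominator is a power of something that can be cancelled modulo \<open>P\<close>.
\<close>

lemma laurent_step:
  fixes b :: "'v \<Rightarrow> 'v \<Rightarrow> int"
  assumes V: "finite V" "T \<subseteq> V" and T: "t \<in> T" "s \<in> T" "s \<noteq> t" and w: "set w \<subseteq> T"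
    and b: "skew b" "unimodular V T b" "0 \<le> b t s"
  defines "b1 \<equiv> mutate_matrix b t"
  defines "b2 \<equiv> mutate_matrix b1 s"
  defines "b3 \<equiv> mutate_matrix b2 t"
  assumes g1: "laurent V (\<lambda>z. mutate_along V b1 (s # w) z v)"
    and g3: "laurent V (\<lambda>z. mutate_along V b3 (t # w) z v)"
  shows "laurent V (\<lambda>y. mutate_along V b (t # s # w) y v)"
proof -
  have tV: "t \<in> V" and sV: "s \<in> V" using V T by auto
  define P where "P = (\<lambda>y. 1 + lmonom V (\<lambda>u. b u t) y)"
  have lP: "laurent V P" unfolding P_def by (intro laurent_add laurent_1 laurent_lmonom)
  have Ppos: "0 < P y" if "positive_on V y" for y
    using lmonom_pos[OF that] by (simp add: P_def add_pos_pos)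
  obtain N where N: "laurent V (\<lambda>y. mutate_along V b (t # s # w) y v * P y ^ N)"
    using laurent_mutate_once[OF V(1) tV g1, of b] by (auto simp: P_def b1_def)
  let ?y2 = "\<lambda>y. mutate_var V b1 s (mutate_var V b t y)"
  let ?y3 = "\<lambda>y. mutate_var V b2 t (?y2 y)"
  \<comment> \<open>a further mutation at \<open>t\<close> undoes the last one\<close>
  have f3: "mutate_along V b3 (t # w) (?y3 y) v = mutate_along V b (t # s # w) y v"
      if y: "positive_on V y" for y
  proof -
    have pos2: "positive_on V (?y2 y)" by (intro positive_on_mutate[OF V(1)] tV sV y)
    have pos3: "positive_on V (?y3 y)" by (rule positive_on_mutate[OF V(1) tV pos2])
    have "skew b2" unfolding b2_def b1_def by (rule skew_mutate[OF skew_mutate[OF b(1)]])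
    then have "b2 t t = 0" by (rule skew_diag)
    then have "mutate_var V b3 t (?y3 y) = ?y2 y"
      unfolding b3_def using pos2 pos3 tV
      by (intro mutate_var_involution) (auto simp: positive_on_def)
    then show ?thesis by (simp add: b3_def mutate_matrix_involution) (simp add: b2_def b1_def)
  qed
  have "\<exists>Q M. cancels V P Q \<and> laurent V Q \<and> laurent V (\<lambda>y. mutate_along V b (t # s # w) y v
      * Q y ^ M)"
  proof (cases "b t s = 0")
    case True
    define Q where "Q = (\<lambda>y. 1 + lmonom V (\<lambda>u. b u s) y)"
    have lQ: "laurent V Q" unfolding Q_def by (intro laurent_add laurent_1 laurent_lmonom)
    obtain M where M: "laurent V (\<lambda>y. mutate_along V b3 (t # w) (mutate_var V b s y) v * Q y ^ M)"
      using laurent_mutate_once[OF V(1) sV g3, of b] by (auto simp: Q_def)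
    have "laurent V (\<lambda>y. mutate_along V b (t # s # w) y v * Q y ^ M)"
    proof (rule laurent_cong[OF M])
      fix y assume y: "positive_on V y"
      have "?y3 y = mutate_var V b s y"
        unfolding b2_def b1_def by (rule mutate_thrice_commuting[OF V(1) tV sV T(3) b(1) True y])
      then show "mutate_along V b (t # s # w) y v * Q y ^ M
          = mutate_along V b3 (t # w) (mutate_var V b s y) v * Q y ^ M"
        by (simp only: f3[OF y, symmetric])
    qed
    moreover have "cancels V P Q" unfolding P_def Q_def by (rule cancels_commuting[OF V(1) T b(2)])
    ultimately show ?thesis using lQ by blast
  next
    case False
    then obtain n where n: "b t s = int n" "0 < n"
      using b(3) by (metis gr0I int_ops(1) nonneg_int_cases)
    obtain Q W a a' where Q: "laurent V Q" and W: "laurent V W"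
      and cQ: "cancels V P Q" and cW: "cancels V P W"
      and pos: "\<And>y. positive_on V y \<Longrightarrow> 0 < Q y" "\<And>y. positive_on V y \<Longrightarrow> 0 < W y"
      and y3: "\<And>y. positive_on V y \<Longrightarrow> ?y3 y = y(s := lmonom V a y * Q y, t := lmonom V a' y * W y)"
      using mutate_thrice[OF V(1) tV sV T(3) b(1) n]
      unfolding b1_def[symmetric] b2_def[symmetric] P_def[symmetric] by blast
    define F where "F u = (if u = t then W else if u = s then Q else (\<lambda>y. 1))" for u
    define d where "d u = (if u = t then a' else if u = s then a else (\<lambda>v. of_bool (v = u)))" for u
    have QW: "laurent V (\<lambda>y. Q y * W y)" by (intro laurent_mult Q W)
    have "\<exists>M. laurent V (\<lambda>y. mutate_along V b3 (t # w) (?y3 y) v * (Q y * W y) ^ M)"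
    proof (rule laurent_subst_units[where g = "\<lambda>z. mutate_along V b3 (t # w) z v", OF g3 _ _ _ QW])
      fix u y assume u: "u \<in> V" and y: "positive_on V y"
      show "?y3 y u = lmonom V (d u) y * F u y"
        using lmonom_single[OF V(1) u] by (simp add: y3[OF y] d_def F_def)
      show "0 < F u y" using pos[OF y] by (simp add: F_def)
    next
      fix u assume u: "u \<in> V"
      show "laurent V (F u)" by (simp add: F_def Q W laurent_1)
      have "laurent V (\<lambda>y. if u = t then Q y else if u = s then W y else Q y * W y)"
        using Q W QW by (cases "u = t"; cases "u = s") simp_all
      then show "laurent V (\<lambda>y. Q y * W y / F u y)"
      proof (rule laurent_cong)
        fix y assume y: "positive_on V y"
        show "Q y * W y / F u y = (if u = t then Q y else if u = s then W y else Q y * W y)"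
          using pos(1)[OF y] pos(2)[OF y] by (simp add: F_def)
      qed
    qed
    then obtain M where "laurent V (\<lambda>y. mutate_along V b3 (t # w) (?y3 y) v * (Q y * W y) ^ M)"
        by blast
    then have "laurent V (\<lambda>y. mutate_along V b (t # s # w) y v * (Q y * W y) ^ M)"
      by (rule laurent_cong) (simp only: f3)
    moreover have "cancels V P (\<lambda>y. Q y * W y)" by (rule cancels_mult[OF cQ cW Q])
    ultimately show ?thesis using QW by blast
  qed
  then obtain Q M where "cancels V P Q" "laurent V Q"
    "laurent V (\<lambda>y. mutate_along V b (t # s # w) y v * Q y ^ M)"
    by blast
  then show ?thesis by (rule cancels_coprime[OF _ _ N _ lP Ppos])
qed

text \<open>
Sequences of length at most \<open>1\<close> are immediate, and equal first vertices cancel. Otherwise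
\<open>laurent_step\<close> refers to the sequences \<open>s, ...\<close> and \<open>t, ...\<close>, which are shorter by one. An arrow
from \<open>s\<close> to \<open>t\<close> becomes one from \<open>t\<close> to \<open>s\<close> when the sign of the exchange matrix is reversed,
and this affects no mutation.
\<close>

theorem laurent_phenomenon:
  fixes b :: "'v \<Rightarrow> 'v \<Rightarrow> int"
  assumes V: "finite V" "T \<subseteq> V" and "v \<in> V" and "skew b" "unimodular V T b" "set w \<subseteq> T"
  shows "laurent V (\<lambda>y. mutate_along V b w y v)"
  using assms(4-)
proof (induction "length w" arbitrary: b w rule: less_induct)
  case less
  have mut: "skew (mutate_matrix b t) \<and> unimodular V T (mutate_matrix b t)"
    if "skew b" "unimodular V T b" "t \<in> T" for b t
    using skew_mutate[OF that(1), of t] unimodular_mutate[OF V(1) that(3) V(2) that(1,2)] by blast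
  consider "w = []" | t where "w = [t]" | t s w' where "w = t # s # w'"
    by (metis list.exhaust)
  then show ?case
  proof cases
    case 1
    then show ?thesis using laurent_coord(1)[OF V(1) \<open>v \<in> V\<close>] by simp
  next
    case (2 t)
    then have t: "t \<in> V" using less V by auto
    have "laurent V (\<lambda>y. (lmonom V (\<lambda>u. max (b u t) 0) y + lmonom V (\<lambda>u. max (- b u t) 0) y)
        * (1 / y t))"
      by (intro laurent_mult laurent_add laurent_lmonom laurent_coord V t)
    moreover have "laurent V (\<lambda>y. y v)" by (rule laurent_coord(1)[OF V(1) \<open>v \<in> V\<close>])
    ultimately have "laurent V (\<lambda>y. if v = t
        then (lmonom V (\<lambda>u. max (b u t) 0) y + lmonom V (\<lambda>u. max (- b u t) 0) y) * (1 / y t)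
            else y v)"
      by (cases "v = t") simp_all
    then show ?thesis
      by (rule laurent_cong) (simp add: 2 mutate_var_real[OF V(1)])
  next
    case (3 t s w')
    then have T: "t \<in> T" "s \<in> T" "set w' \<subseteq> T" using less by auto
    show ?thesis
    proof (cases "s = t")
      case True
      have "laurent V (\<lambda>y. mutate_along V b w' y v)" using less 3 T by simp
      then show ?thesis
      proof (rule laurent_cong)
        fix y :: "'v \<Rightarrow> real" assume y: "positive_on V y"
        have t: "t \<in> V" using T V by auto
        have "mutate_var V (mutate_matrix b t) t (mutate_var V b t y) = y"
          using y t positive_on_mutate[OF V(1) t y, of b] less(2)
          by (intro mutate_var_involution) (auto simp: positive_on_def skew_diag)
        then show "mutate_along V b w y v = mutate_along V b w' y v"
          by (simp add: 3 True mutate_matrix_involution)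
      qed
    next
      case False
      let ?b1 = "mutate_matrix b t"
      let ?b2 = "mutate_matrix ?b1 s"
      let ?b3 = "mutate_matrix ?b2 t"
      have b1: "skew ?b1 \<and> unimodular V T ?b1" using mut[of b t] less T by blast
      then have "skew ?b2 \<and> unimodular V T ?b2" using mut[of ?b1 s] T by blast
      then have b3: "skew ?b3 \<and> unimodular V T ?b3" using mut[of ?b2 t] T by blast
      have g1: "laurent V (\<lambda>z. mutate_along V ?b1 (s # w') z v)"
        by (rule less(1)) (use 3 T b1 in auto)
      have g3: "laurent V (\<lambda>z. mutate_along V ?b3 (t # w') z v)"
        by (rule less(1)) (use 3 T b3 in auto)
      show ?thesis
      proof (cases "0 \<le> b t s")
        case True
        show ?thesis unfolding 3
          by (rule laurent_step[OF V T(1,2) False T(3) less(2,3) True g1 g3])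
      next
        case neg: False
        have "laurent V (\<lambda>y. mutate_along V (\<lambda>u v. - b u v) (t # s # w') y v)"
        proof (rule laurent_step[OF V T(1,2) False T(3)])
          show "skew (\<lambda>u v. - b u v)"
            using less(2) unfolding skew_def by (metis (no_types))
          show "unimodular V T (\<lambda>u v. - b u v)" using less(3) by (rule unimodular_uminus)
          show "0 \<le> - b t s" using neg by simp
          show "laurent V (\<lambda>z. mutate_along V (mutate_matrix (\<lambda>u v. - b u v) t) (s # w') z v)"
            unfolding mutate_matrix_uminus mutate_along_uminus by (rule g1)
          show "laurent V (\<lambda>z. mutate_along V (mutate_matrix (mutate_matrix
              (mutate_matrix (\<lambda>u v. - b u v) t) s) t) (t # w') z v)"
            unfolding mutate_matrix_uminus mutate_along_uminus by (rule g3)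
        qed
        then show ?thesis unfolding 3 by (simp only: mutate_along_uminus)
      qed
    qed
  qed
qed

text \<open>
At \<open>(1, ..., 1)\<close> a Laurent polynomial takes the sum of its coefficients as its value.
\<close>

corollary mutate_along_ones:
  fixes b :: "'v \<Rightarrow> 'v \<Rightarrow> int"
  assumes V: "finite V" "T \<subseteq> V" and "v \<in> V" and b: "skew b" "unimodular V T b" and w: "set w \<subseteq> T"
  shows "\<exists>c::nat. 0 < c \<and> mutate_along V b w (\<lambda>_. 1::real) v = of_nat c"
proof -
  have one: "positive_on V (\<lambda>_. 1::real)" by (simp add: positive_on_def)
  obtain ts where ts: "mutate_along V b w (\<lambda>_. 1::real) v = lpoly V ts (\<lambda>_. 1::real)"
    using laurent_phenomenon[OF assms] one unfolding laurent_def by blast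
  have "lpoly V ts (\<lambda>_. 1::real) \<in> \<int>"
    by (induction ts) (auto simp: lmonom_def)
  then obtain i where "lpoly V ts (\<lambda>_. 1::real) = of_int i"
    by (auto elim: Ints_cases)
  with ts have i: "mutate_along V b w (\<lambda>_. 1::real) v = of_int i" by simp
  have "0 < mutate_along V b w (\<lambda>_. 1::real) v"
    using positive_on_mseq[OF V(1) _ one, of w b] w V \<open>v \<in> V\<close> by (auto simp: positive_on_def)
  with i have "0 < nat i \<and> mutate_along V b w (\<lambda>_. 1::real) v = of_nat (nat i)" by simp
  then show ?thesis by blast
qed

section \<open>Determinants in terms of their columns\<close>

definition coldet :: "nat \<Rightarrow> ('b \<Rightarrow> nat \<Rightarrow> 'a::comm_ring_1) \<Rightarrow> 'b list \<Rightarrow> 'a" where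
  "coldet k v zs = det (mat k k (\<lambda>(i, j). v (zs ! j) i))"

lemma coldet_cong: "length zs = k \<Longrightarrow> (\<And>z i. z \<in> set zs \<Longrightarrow> i < k \<Longrightarrow> v z i = v' z i) \<Longrightarrow> coldet k v zs
    = coldet k v' zs"
  unfolding coldet_def by (intro arg_cong[where f = det] cong_mat) auto

lemma coldet_map: "length zs = k \<Longrightarrow> coldet k v (map f zs) = coldet k (\<lambda>z. v (f z)) zs"
  unfolding coldet_def by (intro arg_cong[where f = det] cong_mat) auto

lemma coldet_not_distinct:
  fixes v :: "'b \<Rightarrow> nat \<Rightarrow> 'a::idom"
  assumes "length zs = k" "\<not> distinct zs"
  shows "coldet k v zs = 0"
proof -
  obtain i j where ij: "i < k" "j < k" "i \<noteq> j" "zs ! i = zs ! j"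
    using assms by (auto simp: distinct_conv_nth)
  show ?thesis unfolding coldet_def
    by (rule det_identical_columns[OF _ ij(3,1,2)]) (use ij in \<open>auto intro!: eq_vecI\<close>)
qed

lemma coldet_scale:
  fixes v :: "'b \<Rightarrow> nat \<Rightarrow> 'a::idom"
  assumes "length zs = k"
  shows "coldet k (\<lambda>z i. c z * v z i) zs = prod_list (map c zs) * coldet k v zs"
proof -
  let ?A = "mat k k (\<lambda>(i, j). v (zs ! j) i)"
  let ?D = "mat k k (\<lambda>(i, j). if i = j then c (zs ! j) else 0)"
  have eq: "mat k k (\<lambda>(i, j). c (zs ! j) * v (zs ! j) i) = ?A * ?D"
  proof (rule eq_matI)
    fix i j assume "i < dim_row (?A * ?D)" "j < dim_col (?A * ?D)"
    then have ij: "i < k" "j < k" by auto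
    have "(?A * ?D) $$ (i, j) = (\<Sum>l<k. v (zs ! l) i * (if l = j then c (zs ! j) else 0))"
      using ij by (auto simp: scalar_prod_def lessThan_atLeast0 intro!: sum.cong)
    also have "\<dots> = c (zs ! j) * v (zs ! j) i"
      using ij by (simp add: if_distrib[of "\<lambda>x. _ * x"] sum.delta cong: if_cong)
    finally show "mat k k (\<lambda>(i, j). c (zs ! j) * v (zs ! j) i) $$ (i, j) = (?A * ?D) $$ (i, j)"
      using ij by simp
  qed auto
  have "det ?D = prod_list (diag_mat ?D)"
    by (rule det_upper_triangular[of _ k]) (auto simp: upper_triangular_def)
  also have "diag_mat ?D = map c zs"
    using assms by (intro nth_equalityI) (auto simp: diag_mat_def)
  finally show ?thesis
    unfolding coldet_def eq by (subst det_mult[of _ k]) auto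
qed

lemma coldet_swap_final:
  assumes "length ps + length xs + length ys = k"
  shows "coldet k v (ps @ xs @ ys) = (-1) ^ (length xs * length ys) * coldet k v (ps @ ys @ xs)"
proof -
  let ?A = "mat k k (\<lambda>(i, j). v ((ps @ xs @ ys) ! j) i)"
  have k: "k = length ps + length xs + length ys" using assms by simp
  have "det ?A = (-1) ^ (length xs * length ys) * det (mat k k (\<lambda>(i, j). ?A $$
      (i, if j < length ps then j else if j < length ps + length ys then j + length xs
          else j - length ys)))"
    by (rule det_swap_final_cols[OF _ k]) simp
  also have "mat k k (\<lambda>(i, j). ?A $$
      (i, if j < length ps then j else if j < length ps + length ys then j + length xs
          else j - length ys)) = mat k k (\<lambda>(i, j). v ((ps @ ys @ xs) ! j) i)"
    by (rule cong_mat) (use k in \<open>auto simp: nth_append add.commute\<close>)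
  finally show ?thesis by (simp add: coldet_def)
qed

lemma coldet_swap:
  fixes v :: "'b \<Rightarrow> nat \<Rightarrow> 'a::comm_ring_1"
  assumes "length ps + length xs + length ys + length qs = k"
  shows "coldet k v (ps @ xs @ ys @ qs) = (-1) ^ (length xs * length ys)
      * coldet k v (ps @ ys @ xs @ qs)"
proof -
  have "coldet k v (ps @ xs @ ys @ qs) = (-1) ^ (length xs * length (ys @ qs))
      * coldet k v ((ps @ ys) @ qs @ xs)"
    using coldet_swap_final[of ps xs "ys @ qs" k v] assms by simp
  also have "coldet k v ((ps @ ys) @ qs @ xs) = (-1) ^ (length qs * length xs)
      * coldet k v ((ps @ ys) @ xs @ qs)"
    by (rule coldet_swap_final) (use assms in simp)
  also have "(-1) ^ (length xs * length (ys @ qs)) * ((-1) ^ (length qs * length xs) * x)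
      = (-1) ^ (length xs * length ys) * (x::'a)" for x
    by (auto simp: minus_one_power_iff)
  finally show ?thesis by simp
qed

text \<open>
The function \<open>g\<close> gives the coordinates with respect to the basis formed by the columns \<open>B\<close>.
\<close>

lemma coldet_change_basis:
  fixes v :: "'b \<Rightarrow> nat \<Rightarrow> 'a::field"
  assumes B: "length B = k" "coldet k v B \<noteq> 0"
  obtains g where "\<And>zs. length zs = k \<Longrightarrow> coldet k v zs = coldet k v B * coldet k g zs"
    and "\<And>i j. i < k \<Longrightarrow> j < k \<Longrightarrow> g (B ! j) i = of_bool (i = j)"
proof -
  let ?M = "mat k k (\<lambda>(i, j). v (B ! j) i)"
  have M: "?M \<in> carrier_mat k k" by simp
  from det_non_zero_imp_unit[OF M, of "()"] B(2)
  obtain N where N: "N * ?M = 1\<^sub>m k" "?M * N = 1\<^sub>m k" "N \<in> carrier_mat k k"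
    unfolding coldet_def Units_def ring_mat_def by auto
  define g where "g z i = (\<Sum>l<k. N $$ (i, l) * v z l)" for z i
  show ?thesis
  proof
    fix zs :: "'b list"
    let ?Z = "mat k k (\<lambda>(i, j). v (zs ! j) i)"
    have G: "mat k k (\<lambda>(i, j). g (zs ! j) i) = N * ?Z"
      by (rule eq_matI)
        (use N(3) in \<open>auto simp: g_def scalar_prod_def lessThan_atLeast0 intro!: sum.cong\<close>)
    have "?M * (N * ?Z) = ?Z"
      using N(2,3) by (subst assoc_mult_mat[symmetric, of _ k k _ k _ k]) auto
    then have "det ?Z = det ?M * det (N * ?Z)"
      using N(3) by (subst det_mult[symmetric, of _ k]) auto
    then show "coldet k v zs = coldet k v B * coldet k g zs" by (simp add: coldet_def G)
  next
    fix i j assume ij: "i < k" "j < k"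
    have "g (B ! j) i = (N * ?M) $$ (i, j)"
      using N(3) ij by (auto simp: g_def scalar_prod_def lessThan_atLeast0 intro!: sum.cong)
    then show "g (B ! j) i = of_bool (i = j)" using N(1) ij by simp
  qed
qed

lemma det_2: "det (mat 2 2 f) = f (0, 0) * f (1, 1) - f (0, 1) * (f (1, 0) :: 'a :: comm_ring_1)"
proof -
  have "det (mat 2 2 f) = (\<Sum>i<2. mat 2 2 f $$ (i, 0) * cofactor (mat 2 2 f) i 0)"
    by (rule laplace_expansion_column) auto
  then show ?thesis
    by (simp add: numeral_2_eq_2 cofactor_def mat_delete_def det_single)
qed

text \<open>
With respect to the basis \<open>S, a, b\<close> the determinant of \<open>S, x, y\<close> is the \<open>2 \<times> 2\<close> minor of \<open>x, y\<close>
in the last two coordinates, and \<open>a, b\<close> have the coordinates \<open>(1, 0)\<close> and \<open>(0, 1)\<close>.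
\<close>

lemma plucker_three_term:
  fixes v :: "'b \<Rightarrow> nat \<Rightarrow> 'a::field"
  assumes S: "length S + 2 = k" and nz: "coldet k v (S @ [a, b]) \<noteq> 0"
  shows "coldet k v (S @ [a, c]) * coldet k v (S @ [b, d]) =
    coldet k v (S @ [a, b]) * coldet k v (S @ [c, d]) + coldet k v (S @ [a, d])
        * coldet k v (S @ [b, c])"
proof -
  let ?B = "S @ [a, b]" and ?m = "length S"
  have len: "length ?B = k" using S by simp
  obtain g where g: "\<And>zs. length zs = k \<Longrightarrow> coldet k v zs = coldet k v ?B * coldet k g zs"
    and e: "\<And>i j. i < k \<Longrightarrow> j < k \<Longrightarrow> g (?B ! j) i = of_bool (i = j)"
    using coldet_change_basis[OF len nz] by metis
  have minor: "coldet k g (S @ [x, y]) = g x ?m * g y (Suc ?m) - g y ?m * g x (Suc ?m)" for x y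
  proof -
    let ?A2 = "mat ?m 2 (\<lambda>(i, j). g ([x, y] ! j) i)"
    let ?A4 = "mat 2 2 (\<lambda>(i, j). g ([x, y] ! j) (?m + i))"
    have "mat k k (\<lambda>(i, j). g ((S @ [x, y]) ! j) i) = four_block_mat (1\<^sub>m ?m) ?A2 (0\<^sub>m 2 ?m) ?A4"
    proof (rule eq_matI)
      fix i j
      assume ij: "i < dim_row (four_block_mat (1\<^sub>m ?m) ?A2 (0\<^sub>m 2 ?m) ?A4)"
        "j < dim_col (four_block_mat (1\<^sub>m ?m) ?A2 (0\<^sub>m 2 ?m) ?A4)"
      have "g (S ! j) i = of_bool (i = j)" if "j < ?m" "i < k"
        using e[of i j] that S by (simp add: nth_append)
      with ij S show "mat k k (\<lambda>(i, j). g ((S @ [x, y]) ! j) i) $$ (i, j)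
          = four_block_mat (1\<^sub>m ?m) ?A2 (0\<^sub>m 2 ?m) ?A4 $$ (i, j)"
        by (auto simp: nth_append)
    qed (use S in auto)
    then have "coldet k g (S @ [x, y]) = det (1\<^sub>m ?m) * det ?A4"
      unfolding coldet_def by (simp add: det_four_block_mat_lower_left_zero[of _ ?m _ 2])
    then show ?thesis by (simp add: det_2)
  qed
  have ab: "g a ?m = 1" "g a (Suc ?m) = 0" "g b ?m = 0" "g b (Suc ?m) = 1"
    using e[of ?m ?m] e[of "Suc ?m" ?m] e[of ?m "Suc ?m"] e[of "Suc ?m" "Suc ?m"] S
    by (simp_all add: nth_append)
  define D where "D = coldet k v ?B"
  have E: "coldet k v (S @ [x, y]) = D * (g x ?m * g y (Suc ?m) - g y ?m * g x (Suc ?m))" for x y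
    using g[of "S @ [x, y]"] S by (simp add: minor D_def)
  show ?thesis unfolding E by (simp add: ab algebra_simps)
qed

text \<open>
The coefficients of a determinant as a linear form in its last column.
\<close>

definition last_cofactor :: "nat \<Rightarrow> ('b \<Rightarrow> nat \<Rightarrow> 'a::comm_ring_1) \<Rightarrow> 'b list \<Rightarrow> nat \<Rightarrow> 'a" where
  "last_cofactor k v ws l = (-1) ^ (l + (k - 1)) *
     det (mat (k - 1) (k - 1) (\<lambda>(i, j). v (ws ! j) (if i < l then i else Suc i)))"

lemma coldet_last:
  assumes "length ws + 1 = k"
  shows "coldet k v (ws @ [z]) = (\<Sum>l<k. last_cofactor k v ws l * v z l)"
proof -
  let ?A = "mat k k (\<lambda>(i, j). v ((ws @ [z]) ! j) i)"
  have "det ?A = (\<Sum>l<k. ?A $$ (l, k - 1) * cofactor ?A l (k - 1))"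
    by (rule laplace_expansion_column) (use assms in auto)
  also have "\<dots> = (\<Sum>l<k. last_cofactor k v ws l * v z l)"
  proof (rule sum.cong[OF refl])
    fix l assume "l \<in> {..<k}"
    moreover have "mat_delete ?A l (k - 1) =
        mat (k - 1) (k - 1) (\<lambda>(i, j). v (ws ! j) (if i < l then i else Suc i))"
      by (rule eq_matI) (use assms in \<open>auto simp: mat_delete_def nth_append\<close>)
    ultimately show "?A $$ (l, k - 1) * cofactor ?A l (k - 1) = last_cofactor k v ws l * v z l"
      using assms by (auto simp: cofactor_def last_cofactor_def nth_append)
  qed
  finally show ?thesis by (simp add: coldet_def)
qed

text \<open>
The row index enters only through the linear form and the column index only through the vector
to which it is applied, so the matrix is a product.
\<close>

lemma det_coldet_square:
  fixes v :: "'b \<Rightarrow> nat \<Rightarrow> 'a::idom"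
  assumes "\<And>i. i < k \<Longrightarrow> length (ws i) + 1 = k"
  shows "det (mat k k (\<lambda>(i, j). coldet k v (ws i @ [c j]))) =
    det (mat k k (\<lambda>(i, l). last_cofactor k v (ws i) l)) * det (mat k k (\<lambda>(l, j). v (c j) l))"
proof -
  have "mat k k (\<lambda>(i, j). coldet k v (ws i @ [c j])) =
      mat k k (\<lambda>(i, l). last_cofactor k v (ws i) l) * mat k k (\<lambda>(l, j). v (c j) l)"
    by (rule eq_matI)
      (use assms in \<open>auto simp: coldet_last scalar_prod_def lessThan_atLeast0 intro!: sum.cong\<close>)
  then show ?thesis by (simp add: det_mult[of _ k])
qed

text \<open>
The same factorization as for \<open>det_coldet_square\<close>, with factors of rank at most \<open>k\<close>: filled up
by a zero column and a zero row they become square.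
\<close>

lemma det_coldet_Suc:
  fixes v :: "'b \<Rightarrow> nat \<Rightarrow> 'a::idom"
  assumes "\<And>i. i \<le> k \<Longrightarrow> length (ws i) + 1 = k"
  shows "det (mat (k + 1) (k + 1) (\<lambda>(i, j). coldet k v (ws i @ [c j]))) = 0"
proof -
  let ?O = "mat (k + 1) (k + 1) (\<lambda>(i, l). if l < k then last_cofactor k v (ws i) l else 0)"
  let ?C = "mat (k + 1) (k + 1) (\<lambda>(l, j). if l < k then v (c j) l else 0)"
  have "mat (k + 1) (k + 1) (\<lambda>(i, j). coldet k v (ws i @ [c j])) = ?O * ?C"
    by (rule eq_matI)
      (use assms in \<open>auto simp: coldet_last scalar_prod_def lessThan_atLeast0 intro!: sum.cong\<close>)
  moreover have "det ?C = (\<Sum>j<k + 1. ?C $$ (k, j) * cofactor ?C k j)"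
    by (rule laplace_expansion_row) auto
  ultimately show ?thesis by (simp add: det_mult[of _ "k + 1"])
qed

section \<open>Minors with twisted periodic columns\<close>

text \<open>
The columns of the generic matrix, continued over all \<open>z \<ge> 1\<close> by \<open>v\<^sub>z\<^sub>+\<^sub>n = (-1)\<^sup>k\<^sup>-\<^sup>1 v\<^sub>z\<close>.
Moving a column past the \<open>k - 1\<close> others costs the same sign, so minors of twisted columns are
invariant under cyclic rotation.
\<close>

definition twisted :: "nat \<Rightarrow> nat \<Rightarrow> nat \<Rightarrow> nat \<Rightarrow> ratfun" where
  "twisted k n z i = (-1) ^ ((k - 1) * ((z - 1) div n)) * gen_entry i (red n (int z))"

definition twisted_minor :: "nat \<Rightarrow> nat \<Rightarrow> nat list \<Rightarrow> ratfun" where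
  "twisted_minor k n zs = coldet k (twisted k n) zs"

lemma red_of_nat: "1 \<le> z \<Longrightarrow> red n (int z) = (z - 1) mod n + 1"
proof -
  assume "1 \<le> z"
  then have "(int z - 1) mod int n = int ((z - 1) mod n)" by (simp add: of_nat_diff zmod_int)
  then show ?thesis by (simp add: red_def)
qed

lemma red_id: "1 \<le> z \<Longrightarrow> z \<le> n \<Longrightarrow> red n (int z) = z"
proof -
  assume z: "1 \<le> z" "z \<le> n"
  then have "(z - 1) mod n = z - 1" by (intro mod_less) linarith
  then show ?thesis using z by (simp add: red_of_nat del: One_nat_def)
qed

lemma map_plus_upt: "map (\<lambda>z. z + n) [a..<b] = [a + n..<b + n]"
  by (induction b) auto

lemma red_add: "red n (z + int n) = red n z"
proof -
  have "(z + int n - 1) mod int n = (z - 1) mod int n"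
    by (metis add_diff_eq add.commute mod_add_self1 diff_add_eq)
  then show ?thesis by (simp add: red_def)
qed

lemma red_mem: "1 \<le> n \<Longrightarrow> red n z \<in> {1..n}"
  using pos_mod_bound[of "int n" "z - 1"] pos_mod_sign[of "int n" "z - 1"]
  by (auto simp: red_def nat_less_iff Suc_le_eq)

lemma twisted_add:
  assumes "1 \<le> z" "1 \<le> n"
  shows "twisted k n (z + n) i = (-1) ^ (k - 1) * twisted k n z i"
proof -
  have "(z + n - 1) div n = (z - 1) div n + 1"
    using assms by (metis Nat.add_diff_assoc2 div_add_self2 not_one_le_zero)
  then show ?thesis using red_add[of n "int z"]
    by (simp add: twisted_def algebra_simps power_add)
qed

lemma prod_list_const: "(\<And>x. x \<in> set xs \<Longrightarrow> f x = c) \<Longrightarrow> prod_list (map f xs) = c ^ length xs"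
  by (induction xs) auto

lemma twisted_minor_plucker:
  assumes "length zs = k"
  shows "twisted_minor k n zs = prod_list (map (\<lambda>z. (-1) ^ ((k - 1) * ((z - 1) div n))) zs) *
    plucker k (map (\<lambda>z. red n (int z)) zs)"
proof -
  have "plucker k (map (\<lambda>z. red n (int z)) zs)
      = coldet k (\<lambda>j i. gen_entry i j) (map (\<lambda>z. red n (int z)) zs)"
    by (simp add: plucker_def coldet_def)
  also have "\<dots> = coldet k (\<lambda>z i. gen_entry i (red n (int z))) zs" by (rule coldet_map[OF assms])
  finally show ?thesis
    unfolding twisted_minor_def twisted_def[abs_def] coldet_scale[OF assms] by simp
qed

text \<open>
Each of the \<open>k\<close> columns contributes \<open>(-1)\<^sup>k\<^sup>-\<^sup>1\<close>, and \<open>k (k - 1)\<close> is even.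
\<close>

lemma twisted_minor_shift:
  assumes "length zs = k" "\<And>z. z \<in> set zs \<Longrightarrow> 1 \<le> z" "1 \<le> n"
  shows "twisted_minor k n (map (\<lambda>z. z + n) zs) = twisted_minor k n zs"
proof -
  have "twisted_minor k n (map (\<lambda>z. z + n) zs) = coldet k (\<lambda>z. twisted k n (z + n)) zs"
    unfolding twisted_minor_def by (rule coldet_map[OF assms(1)])
  also have "\<dots> = coldet k (\<lambda>z i. (-1) ^ (k - 1) * twisted k n z i) zs"
    by (rule coldet_cong[OF assms(1)]) (rule twisted_add[OF assms(2,3)])
  also have "\<dots> = ((-1) ^ (k - 1)) ^ k * twisted_minor k n zs"
    unfolding coldet_scale[OF assms(1)] twisted_minor_def
    using prod_list_const[of zs "\<lambda>_. (-1) ^ (k - 1)" "(-1) ^ (k - 1) :: ratfun"] assms(1) by simp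
  also have "((-1) ^ (k - 1)) ^ k = (1 :: ratfun)"
    unfolding power_mult[symmetric] by (cases k) (auto simp: minus_one_power_iff)
  finally show ?thesis by simp
qed

text \<open>
With \<open>h\<close> the length of \<open>ys\<close>, the twist contributes \<open>(-1)\<close> to the power \<open>h (k - 1)\<close> and the
exchange of the blocks \<open>(-1)\<close> to the power \<open>h (k - h)\<close>. The exponents have the same parity.
\<close>

lemma twisted_minor_wrap:
  assumes len: "length xs + length ys = k" and n: "1 \<le> n" and ys: "\<And>z. z \<in> set ys \<Longrightarrow> 1 \<le> z"
  shows "twisted_minor k n (xs @ map (\<lambda>z. z + n) ys) = twisted_minor k n (ys @ xs)"
proof -
  let ?f = "\<lambda>b. if b then 1 else (-1) ^ (k - 1) :: ratfun"
  let ?l = "map (Pair True) xs @ map (Pair False) ys"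
  let ?g = "\<lambda>p. snd p + (if fst p then 0 else n)"
  have k: "length ?l = k" using len by simp
  have "twisted_minor k n (xs @ map (\<lambda>z. z + n) ys) = coldet k (twisted k n) (map ?g ?l)"
    by (simp add: twisted_minor_def comp_def)
  also have "\<dots> = coldet k (\<lambda>p. twisted k n (?g p)) ?l" by (rule coldet_map[OF k])
  also have "\<dots> = coldet k (\<lambda>p i. ?f (fst p) * twisted k n (snd p) i) ?l"
  proof (rule coldet_cong[OF k])
    fix p i assume "p \<in> set ?l"
    then have "\<not> fst p \<Longrightarrow> 1 \<le> snd p" using ys by auto
    then show "twisted k n (?g p) i = ?f (fst p) * twisted k n (snd p) i"
      using twisted_add[OF _ n, of "snd p" k i] by (cases "fst p") simp_all
  qed
  also have "\<dots> = prod_list (map (\<lambda>p. ?f (fst p)) ?l) * coldet k (\<lambda>p. twisted k n (snd p)) ?l"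
    by (rule coldet_scale[OF k])
  also have "coldet k (\<lambda>p. twisted k n (snd p)) ?l = twisted_minor k n (map snd ?l)"
    unfolding twisted_minor_def by (rule coldet_map[OF k, symmetric])
  also have "map snd ?l = [] @ xs @ ys" by (simp add: comp_def)
  also have "twisted_minor k n ([] @ xs @ ys) = (-1) ^ (length xs * length ys)
      * twisted_minor k n ([] @ ys @ xs)"
    unfolding twisted_minor_def by (rule coldet_swap_final) (use len in simp)
  also have "prod_list (map (\<lambda>p. ?f (fst p)) ?l) = ((-1) ^ (k - 1)) ^ length ys"
    by (simp add: comp_def map_replicate_const)
  also have "((-1) ^ (k - 1)) ^ length ys * ((-1) ^ (length xs * length ys) * x) = x"
      for x :: ratfun
    unfolding len[symmetric] by (cases ys) (auto simp: minus_one_power_iff simp flip: power_mult)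
  finally show ?thesis by simp
qed

lemma plucker_not_distinct: "length J = k \<Longrightarrow> \<not> distinct J \<Longrightarrow> plucker k J = 0"
  using coldet_not_distinct[of J k "\<lambda>j i. gen_entry i j"] by (simp add: plucker_def coldet_def)

lemma twisted_minor_not_distinct:
  "length zs = k \<Longrightarrow> \<not> distinct (map (\<lambda>z. red n (int z)) zs) \<Longrightarrow> twisted_minor k n zs = 0"
  by (simp add: twisted_minor_plucker plucker_not_distinct)

lemma twisted_minor_low:
  assumes "length zs = k" "\<And>z. z \<in> set zs \<Longrightarrow> 1 \<le> z \<and> z \<le> n"
  shows "twisted_minor k n zs = plucker k zs"
proof -
  have "map (\<lambda>z. red n (int z)) zs = zs"
  proof (intro map_idI)
    fix z assume "z \<in> set zs"
    from assms(2)[OF this] show "red n (int z) = z" by (intro red_id) blast+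
  qed
  moreover have "prod_list (map (\<lambda>z. (-1) ^ ((k - 1) * ((z - 1) div n))) zs)
      = (1::ratfun) ^ length zs"
  proof (rule prod_list_const)
    fix z assume "z \<in> set zs"
    with assms(2) have "(z - 1) div n = 0" by (intro div_less) force
    then show "(-1) ^ ((k - 1) * ((z - 1) div n)) = (1::ratfun)" by simp
  qed
  ultimately show ?thesis using assms(1) by (simp add: twisted_minor_plucker)
qed

text \<open>
An increasing list inside a window of length \<open>n\<close> consists of a part up to \<open>n\<close> and a part beyond
\<open>n\<close>. Sorting the residues moves the latter to the front, and by \<open>twisted_minor_wrap\<close> this does
not change the minor.
\<close>

lemma twisted_minor_window:
  assumes r: "1 \<le> r" "r \<le> n" and zs: "sorted_wrt (<) zs" "length zs = k" "set zs \<subseteq> {r..<r + n}"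
  shows "plucker k (sort (map (\<lambda>z. red n (int z)) zs)) = twisted_minor k n zs"
proof -
  define xs where "xs = takeWhile (\<lambda>z. z \<le> n) zs"
  define us where "us = dropWhile (\<lambda>z. z \<le> n) zs"
  define ys where "ys = map (\<lambda>z. z - n) us"
  have zs_eq: "zs = xs @ us" by (simp add: xs_def us_def)
  have xs: "z \<le> n \<and> r \<le> z" if "z \<in> set xs" for z
    using that zs(3) unfolding zs_eq by (auto simp: xs_def dest: set_takeWhileD)
  have us: "n < z \<and> z < r + n" if z: "z \<in> set us" for z
  proof -
    have s: "sorted_wrt (<) us" using zs(1) unfolding zs_eq by (simp add: sorted_wrt_append)
    obtain u us' where u: "us = u # us'" using z by (cases us) auto
    then have "\<not> u \<le> n" unfolding us_def by (simp add: dropWhile_eq_Cons_conv)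
    then have "n < z" using s z u by auto
    then show ?thesis using z zs(3) unfolding zs_eq by auto
  qed
  have us_eq: "us = map (\<lambda>z. z + n) ys" unfolding ys_def map_map
    by (rule sym, rule map_idI) (use us in force)
  have ys: "1 \<le> z \<and> z < r" if "z \<in> set ys" for z
    using that us unfolding ys_def by force
  have len: "length xs + length ys = k" using zs(2) unfolding zs_eq by (simp add: ys_def)
  have "sorted_wrt (<) xs" "sorted_wrt (<) us" using zs(1) unfolding zs_eq
      by (auto simp: sorted_wrt_append)
  then have sx: "sorted xs" and su: "sorted us" by (auto intro: strict_sorted_imp_sorted)
  from su have sy: "sorted ys" unfolding ys_def
      by (auto simp: sorted_map intro: sorted_wrt_mono_rel[of _ "(\<le>)"])
  have redx: "map (\<lambda>z. red n (int z)) xs = xs" using xs r by (intro map_idI red_id) force+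
  have redy: "map (\<lambda>z. red n (int z)) us = ys"
  proof -
    have "red n (int (z + n)) = z" if "z \<in> set ys" for z
      using ys[OF that] r red_add[of n "int z"] red_id[of z n] by (simp del: One_nat_def)
    then show ?thesis unfolding us_eq map_map by (intro map_idI) simp
  qed
  have "sort (map (\<lambda>z. red n (int z)) zs) = ys @ xs"
    unfolding zs_eq map_append redx redy
    by (rule properties_for_sort) (use sx sy xs ys in \<open>force simp: sorted_append\<close>)+
  moreover have "twisted_minor k n zs = twisted_minor k n (ys @ xs)"
    unfolding zs_eq us_eq by (rule twisted_minor_wrap[OF len]) (use r ys in auto)
  moreover have "twisted_minor k n (ys @ xs) = plucker k (ys @ xs)"
    by (rule twisted_minor_low) (use len xs ys r in force)+
  ultimately show ?thesis by simp
qed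

definition consec_minor :: "nat \<Rightarrow> nat \<Rightarrow> nat \<Rightarrow> ratfun" where
  "consec_minor k n z = twisted_minor k n [z..<z + k]"

text \<open>
For \<open>s = 0\<close> these are the variables of the rectangles seed; increasing \<open>s\<close> rotates them
cyclically. The indices \<open>i = 0\<close> and \<open>j = 0\<close> are included because they occur in the exchange
relations.
\<close>

definition rect_minor :: "nat \<Rightarrow> nat \<Rightarrow> nat \<Rightarrow> nat \<Rightarrow> nat \<Rightarrow> ratfun" where
  "rect_minor k n s i j =
     twisted_minor k n ([s + 1..<s + (k - i) + 1] @ [s + (k - i) + j + 1..<s + k + j + 1])"

lemma initial_var_rect_minor:
  assumes "i \<le> k" "k + j \<le> n"
  shows "initial_var k (i, j) = rect_minor k n 0 i j"
proof -
  have "twisted_minor k n ([1..<k - i + 1] @ [k - i + j + 1..<k + j + 1]) =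
      plucker k ([1..<k - i + 1] @ [k - i + j + 1..<k + j + 1])"
    by (rule twisted_minor_low) (use assms in \<open>auto simp del: upt_Suc\<close>)
  then show ?thesis by (simp only: rect_minor_def initial_var_def prod.case add_0)
qed

lemma consec_minor_add: "1 \<le> n \<Longrightarrow> 1 \<le> z \<Longrightarrow> consec_minor k n (z + n) = consec_minor k n z"
  using twisted_minor_shift[of "[z..<z + k]" k n] unfolding map_plus_upt consec_minor_def
  by (simp add: ac_simps)

lemma rect_minor_boundary:
  assumes "i \<le> k"
  shows "rect_minor k n s 0 j = consec_minor k n (s + 1)"
    and "rect_minor k n s i 0 = consec_minor k n (s + 1)"
    and "rect_minor k n s k j = consec_minor k n (s + j + 1)"
proof -
  show "rect_minor k n s 0 j = consec_minor k n (s + 1)" "rect_minor k n s k j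
      = consec_minor k n (s + j + 1)"
    by (simp_all add: rect_minor_def consec_minor_def algebra_simps)
  have "[s + 1..<s + (k - i) + 1] @ [s + (k - i) + 0 + 1..<s + k + 0 + 1] = [s + 1..<s + 1 + k]"
  proof -
    have "s + (k - i) + 1 + i = s + 1 + k" using assms by simp
    then show ?thesis using upt_add_eq_append[of "s + 1" "s + (k - i) + 1" i] by simp
  qed
  then show "rect_minor k n s i 0 = consec_minor k n (s + 1)"
      by (simp only: rect_minor_def consec_minor_def)
qed

text \<open>
The block at the beginning of the window continues the block at its end cyclically.
\<close>

lemma rect_minor_last:
  assumes "i \<le> k" "k \<le> n" "1 \<le> n"
  shows "rect_minor k n s i (n - k) = consec_minor k n (s + (n - i) + 1)"
proof -
  let ?xs = "[s + (n - i) + 1..<s + n + 1]" and ?ys = "[s + 1..<s + (k - i) + 1]"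
  have e: "s + n + 1 + (k - i) = s + (n - i) + 1 + k" "s + (k - i) + 1 + n = s + (n - i) + 1 + k"
    "s + 1 + n = s + n + 1" "s + (n - i) + 1 \<le> s + n + 1"
    using assms by auto
  have "?xs @ map (\<lambda>z. z + n) ?ys = [s + (n - i) + 1..<s + (n - i) + 1 + k]"
    unfolding map_plus_upt using upt_add_eq_append[OF e(4), of "k - i"] unfolding e by simp
  then have "consec_minor k n (s + (n - i) + 1) = twisted_minor k n (?xs @ map (\<lambda>z. z + n) ?ys)"
    by (simp add: consec_minor_def)
  also have "\<dots> = twisted_minor k n (?ys @ ?xs)" by (rule twisted_minor_wrap) (use assms in auto)
  also have "?xs = [s + (k - i) + (n - k) + 1..<s + k + (n - k) + 1]"
    by (rule arg_cong2[where f = upt]) (use assms in auto)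
  finally show ?thesis by (simp add: rect_minor_def)
qed

text \<open>
The three-term relation with the columns in increasing order. Moving \<open>a\<close>, \<open>b\<close>, \<open>c\<close>, \<open>d\<close> to the
end costs the same sign in all three products.
\<close>

lemma coldet_exchange:
  fixes v :: "'b \<Rightarrow> nat \<Rightarrow> 'a::field"
  assumes len: "length S + length U + 2 = k" and nz: "coldet k v ([a] @ S @ [b] @ U) \<noteq> 0"
  shows "coldet k v ([a] @ S @ [c] @ U) * coldet k v (S @ [b] @ U @ [d]) =
    coldet k v ([a] @ S @ [b] @ U) * coldet k v (S @ [c] @ U @ [d]) +
    coldet k v ([a] @ S @ U @ [d]) * coldet k v (S @ [b] @ [c] @ U)"
proof -
  let ?D = "\<lambda>x y. coldet k v ((S @ U) @ [x, y])"
  define p q where "p = (-1 :: 'a) ^ length S" and "q = (-1 :: 'a) ^ length U"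
  have sq: "p * p = 1" "q * q = 1" by (simp_all add: p_def q_def flip: power_mult_distrib)
  have 1: "coldet k v (S @ [x] @ U @ [y]) = q * ?D x y" for x y
    using coldet_swap[of S "[x]" U "[y]" k v] len by (simp add: q_def)
  have 2: "coldet k v ([a] @ S @ U @ [y]) = p * q * ?D a y" for y
    using coldet_swap[of "[]" "[a]" "S @ U" "[y]" k v] len by (simp add: p_def q_def power_add)
  have 3: "coldet k v ([a] @ S @ [x] @ U) = p * ?D a x" for x
  proof -
    have "coldet k v ([a] @ S @ [x] @ U) = q * coldet k v ([a] @ S @ U @ [x])"
      using coldet_swap_final[of "[a] @ S" "[x]" U k v] len by (simp add: q_def)
    also have "\<dots> = (q * q) * (p * ?D a x)" unfolding 2 by (simp only: ac_simps)
    finally show ?thesis by (simp only: sq mult_1)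
  qed
  have 4: "coldet k v (S @ [b] @ [c] @ U) = ?D b c"
    using coldet_swap_final[of S "[b, c]" U k v] len by simp
  have "?D a b \<noteq> 0" using nz unfolding 3 by auto
  then have "?D a c * ?D b d = ?D a b * ?D c d + ?D a d * ?D b c"
    using plucker_three_term[of "S @ U" k v a b c d] len by simp
  then show ?thesis unfolding 1 2 3 4 by (simp add: algebra_simps)
qed

text \<open>
This is \<open>coldet_exchange\<close> for \<open>a = s + 1\<close>, \<open>b = s + k - i + 1\<close>, \<open>c = s + k - i + j + 1\<close> and \<open>d =
s + k + j + 1\<close>: the columns are those in \<open>[a, b)\<close> and \<open>[c, d)\<close> before the rotation, and those in
\<open>(a, b]\<close> and \<open>(c, d]\<close> after it.
\<close>

lemma rect_minor_exchange:
  assumes i: "1 \<le> i" "i < k" and j: "1 \<le> j" and nz: "rect_minor k n s (i - 1) j \<noteq> 0"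
  shows "rect_minor k n s i j * rect_minor k n (Suc s) i j =
    rect_minor k n s (i - 1) j * rect_minor k n (Suc s) (i + 1) j + rect_minor k n s i (j + 1)
        * rect_minor k n (Suc s) i (j - 1)"
proof -
  obtain h where k: "k = h + 1 + i" using i by (metis add.commute add.left_commute
      less_iff_Suc_add Suc_eq_plus1)
  obtain l where l: "j = l + 1" using j by (metis add.commute le_Suc_ex)
  let ?S = "[s + 2..<s + h + 2]" and ?U = "[s + h + j + 3..<s + k + j + 1]"
  let ?a = "s + 1" and ?b = "s + h + 2" and ?c = "s + h + j + 2" and ?d = "s + k + j + 1"
  have h: "k - i = h + 1" "k - (i - 1) = h + 2" "k - (i + 1) = h" using i k by auto
  have cons: "[x..<y] = x # [x + 1..<y]" if "x < y" for x y :: nat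
    using that by (simp add: upt_conv_Cons del: upt_Suc)
  have snoc: "[x..<y + 1] = [x..<y] @ [y]" if "x \<le> y" for x y :: nat using that by simp
  have 1: "[s + 1..<s + (h + 1) + 1] = [?a] @ ?S"
    using cons[of "s + 1" "s + h + 2"] by (simp add: eval_nat_numeral del: upt_Suc)
  have 2: "[s + 1..<s + (h + 2) + 1] = [?a] @ ?S @ [?b]"
    using cons[of "s + 1" "s + h + 3"] snoc[of "s + 2" "s + h + 2"]
    by (simp add: eval_nat_numeral del: upt_Suc)
  have 3: "[Suc s + 1..<Suc s + (h + 1) + 1] = ?S @ [?b]"
    using snoc[of "s + 2" "s + h + 2"] by (simp add: eval_nat_numeral del: upt_Suc)
  have 4: "[Suc s + 1..<Suc s + h + 1] = ?S" by (simp add: eval_nat_numeral del: upt_Suc)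
  have 5: "[s + (h + 1) + j + 1..<s + k + j + 1] = [?c] @ ?U"
    using i k cons[of "s + h + j + 2" "s + k + j + 1"] by (simp add: eval_nat_numeral del: upt_Suc)
  have 6: "[Suc s + (h + 1) + j + 1..<Suc s + k + j + 1] = ?U @ [?d]"
    using i k snoc[of "s + h + j + 3" "s + k + j + 1"] by (simp add: eval_nat_numeral del: upt_Suc)
  have 7: "[s + (h + 2) + j + 1..<s + k + j + 1] = ?U" by (simp add: eval_nat_numeral del: upt_Suc)
  have 8: "[Suc s + h + j + 1..<Suc s + k + j + 1] = [?c] @ ?U @ [?d]"
    using i k cons[of "s + h + j + 2" "s + k + j + 2"] snoc[of "s + h + j + 3" "s + k + j + 1"]
    by (simp add: eval_nat_numeral del: upt_Suc)
  have 9: "[s + (h + 1) + (j + 1) + 1..<s + k + (j + 1) + 1] = ?U @ [?d]"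
    using i k snoc[of "s + h + j + 3" "s + k + j + 1"] by (simp add: eval_nat_numeral del: upt_Suc)
  have 10: "[Suc s + (h + 1) + (j - 1) + 1..<Suc s + k + (j - 1) + 1] = [?c] @ ?U"
    using i k l cons[of "s + h + j + 2" "s + k + j + 1"]
        by (simp add: eval_nat_numeral del: upt_Suc)
  have len: "length ?S + length ?U + 2 = k" using i k by auto
  have r: "rect_minor k n s i j = coldet k (twisted k n) ([?a] @ ?S @ [?c] @ ?U)"
    "rect_minor k n (Suc s) i j = coldet k (twisted k n) (?S @ [?b] @ ?U @ [?d])"
    "rect_minor k n s (i - 1) j = coldet k (twisted k n) ([?a] @ ?S @ [?b] @ ?U)"
    "rect_minor k n (Suc s) (i + 1) j = coldet k (twisted k n) (?S @ [?c] @ ?U @ [?d])"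
    "rect_minor k n s i (j + 1) = coldet k (twisted k n) ([?a] @ ?S @ ?U @ [?d])"
    "rect_minor k n (Suc s) i (j - 1) = coldet k (twisted k n) (?S @ [?b] @ [?c] @ ?U)"
    unfolding rect_minor_def twisted_minor_def h 1 2 3 4 5 6 7 8 9 10 by simp_all
  show ?thesis using coldet_exchange[OF len, of "twisted k n" ?a ?b ?c ?d] nz unfolding r by simp
qed

lemma twisted_minor_shift_mult:
  assumes "length zs = k" "\<And>z. z \<in> set zs \<Longrightarrow> 1 \<le> z" "1 \<le> n"
  shows "twisted_minor k n (map (\<lambda>z. z + q * n) zs) = twisted_minor k n zs"
proof (induction q)
  case (Suc q)
  have "map (\<lambda>z. z + Suc q * n) zs = map (\<lambda>z. z + n) (map (\<lambda>z. z + q * n) zs)"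
    by (simp add: comp_def algebra_simps)
  also have "twisted_minor k n \<dots> = twisted_minor k n (map (\<lambda>z. z + q * n) zs)"
    by (rule twisted_minor_shift) (use assms in \<open>auto intro: trans_le_add1\<close>)
  finally show ?case using Suc by simp
qed simp

text \<open>
The entry \<open>(r, m)\<close> of the Pluecker frieze, see \<open>plucker_frieze_row_minor\<close>.
\<close>

definition row_minor :: "nat \<Rightarrow> nat \<Rightarrow> nat \<Rightarrow> nat \<Rightarrow> ratfun" where
  "row_minor k n r m = twisted_minor k n ([r..<r + (k - 1)] @ [r + m - 1])"

text \<open>
For these \<open>m\<close> the last column repeats one of the others, up to a period.
\<close>

lemma row_minor_zero:
  assumes "1 \<le> k" "1 \<le> r" "1 \<le> m" "m < n + k" "m < k \<or> n < m"
  shows "\<not> distinct (map (\<lambda>z. red n (int z)) ([r..<r + (k - 1)] @ [r + m - 1]))"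
    and "row_minor k n r m = 0"
proof -
  let ?f = "\<lambda>z. red n (int z)"
  have "?f (r + m - 1) \<in> ?f ` set [r..<r + (k - 1)]"
  proof (cases "m < k")
    case True
    then have "r + m - 1 \<in> set [r..<r + (k - 1)]" using assms(2,3) by auto
    then show ?thesis by (rule imageI)
  next
    case False
    define x where "x = r + m - 1 - n"
    have x: "r + m - 1 = x + n" "r \<le> x" "x < r + (k - 1)"
      using assms False unfolding x_def by arith+
    have "?f (r + m - 1) = ?f x" unfolding x(1) using red_add[of n "int x"] by simp
    then show ?thesis using x by (intro image_eqI[of _ _ x]) auto
  qed
  then show nd: "\<not> distinct (map ?f ([r..<r + (k - 1)] @ [r + m - 1]))" by auto
  show "row_minor k n r m = 0"
    unfolding row_minor_def by (rule twisted_minor_not_distinct[OF _ nd]) (use assms(1) in simp)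
qed

text \<open>
Any positive representative of \<open>r\<close> modulo \<open>n\<close> may be used. This makes it possible to run through
the rows of a diamond without wrapping around.
\<close>

lemma plucker_frieze_row_minor:
  assumes n: "1 \<le> n" "1 \<le> k" "k \<le> n" and m: "1 \<le> m" "m < n + k"
    and r: "1 \<le> \<rho>" "red n (int \<rho>) = red n r"
  shows "plucker_frieze k n r (int m) = row_minor k n \<rho> m"
proof -
  let ?f = "\<lambda>z. red n (int z)"
  define r' where "r' = red n r"
  have r': "1 \<le> r'" "r' \<le> n" using red_mem[OF n(1), of r] by (auto simp: r'_def)
  let ?zs = "[r'..<r' + (k - 1)] @ [r' + m - 1]"
  have len: "length ?zs = k" using n by simp
  have "cyc n r' (k - 1) = map ?f (map (\<lambda>i. i + r') [0..<k - 1])"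
    by (simp add: cyc_def add.commute)
  also have "\<dots> = map ?f [r'..<r' + (k - 1)]" unfolding map_plus_upt by (simp add: add.commute)
  finally have c: "cyc n r' (k - 1) = map ?f [r'..<r' + (k - 1)]" .
  have m': "red n (int m + int r' - 1) = ?f (r' + m - 1)"
    using r' by (simp add: of_nat_diff add.commute)
  have "plucker_frieze k n r (int m) = plucker k (sort (map ?f ?zs))"
    unfolding plucker_frieze_def Let_def r'_def[symmetric] c m' by simp
  also have "\<dots> = twisted_minor k n ?zs"
  proof (cases "m < k \<or> n < m")
    case True
    have "\<not> distinct (map ?f ?zs)" using row_minor_zero(1)[OF n(2) r'(1) m True] .
    then have "plucker k (sort (map ?f ?zs)) = 0" using len by (intro plucker_not_distinct) auto
    then show ?thesis using row_minor_zero(2)[OF n(2) r'(1) m True] by (simp add: row_minor_def)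
  next
    case False
    show ?thesis
      by (rule twisted_minor_window[OF r']) (use False n m r' in \<open>auto simp: sorted_wrt_append\<close>)
  qed
  also have "\<dots> = row_minor k n \<rho> m"
  proof -
    define q where "q = (\<rho> - 1) div n"
    have "\<rho> = r' + q * n"
      using r unfolding r'_def r(2)[symmetric] red_of_nat[OF r(1)] q_def
      by (metis add.commute add.assoc div_mult_mod_eq le_add_diff_inverse)
    then have "map (\<lambda>z. z + q * n) ?zs = [\<rho>..<\<rho> + (k - 1)] @ [\<rho> + m - 1]"
      using r' m by (simp add: map_plus_upt algebra_simps)
    moreover have "twisted_minor k n (map (\<lambda>z. z + q * n) ?zs) = twisted_minor k n ?zs"
      by (rule twisted_minor_shift_mult[OF len]) (use r' m n in auto)
    ultimately show ?thesis by (simp add: row_minor_def)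
  qed
  finally show ?thesis .
qed

lemma row_minor_rect_minor:
  assumes "1 \<le> r" "k \<le> m" "1 \<le> k"
  shows "row_minor k n r m = rect_minor k n (r - 1) 1 (m - k)"
proof -
  have "[r - 1 + (k - 1) + (m - k) + 1..<r - 1 + k + (m - k) + 1] = [r + m - 1..<Suc (r + m - 1)]"
    by (rule arg_cong2[where f = upt]) (use assms in auto)
  moreover have "[r - 1 + 1..<r - 1 + (k - 1) + 1] = [r..<r + (k - 1)]"
    by (rule arg_cong2[where f = upt]) (use assms in auto)
  ultimately show ?thesis unfolding row_minor_def rect_minor_def by simp
qed

lemma upt_Suc_end: "1 \<le> k \<Longrightarrow> [r..<r + (k - 1)] @ [r + (k - 1)] = [r..<r + k]"
  by (cases k) auto

lemma row_minor_first: "1 \<le> k \<Longrightarrow> row_minor k n r k = consec_minor k n r"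
  using upt_Suc_end[of k r] by (cases k) (simp_all add: row_minor_def consec_minor_def)

lemma row_minor_last:
  assumes "2 \<le> r" "1 \<le> k" "1 \<le> n"
  shows "row_minor k n r n = consec_minor k n (r - 1)"
proof -
  have "row_minor k n r n = twisted_minor k n ([r..<r + (k - 1)] @ map (\<lambda>z. z + n) [r - 1])"
    using assms by (simp add: row_minor_def add.commute)
  also have "\<dots> = twisted_minor k n ([r - 1] @ [r..<r + (k - 1)])"
    by (rule twisted_minor_wrap) (use assms in auto)
  also have "[r - 1] @ [r..<r + (k - 1)] = [r - 1..<r - 1 + k]"
    using assms by (subst upt_conv_Cons) auto
  finally show ?thesis by (simp add: consec_minor_def)
qed

section \<open>Determinants of diamonds\<close>

lemma diamond_tame:
  assumes "1 \<le> k"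
  shows "det (mat (k + 1) (k + 1) (\<lambda>(i, j). twisted_minor k n ([r + i..<r + i + (k - 1)] @ [c
      + j]))) = 0"
  unfolding twisted_minor_def
  using det_coldet_Suc[of k "\<lambda>i. [r + i..<r + i + (k - 1)]" "twisted k n" "\<lambda>j. c + j"] assms by simp

text \<open>
By \<open>det_coldet_square\<close> the determinants of the diamonds with first row \<open>r\<close> have a common factor,
times the consecutive minor at \<open>c\<close>. For \<open>c = r + k - 1\<close> the diamond is triangular, because below
the diagonal the last column is repeated, and its diagonal entries are consecutive minors.
\<close>

lemma diamond_det:
  assumes "1 \<le> k"
  shows "det (mat k k (\<lambda>(i, j). twisted_minor k n ([r + i..<r + i + (k - 1)] @ [c + j])))
      * consec_minor k n (r + (k - 1))
    = (\<Prod>i<k. consec_minor k n (r + i)) * consec_minor k n c"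
proof -
  let ?ws = "\<lambda>i. [r + i..<r + i + (k - 1)]"
  let ?O = "det (mat k k (\<lambda>(i, l). last_cofactor k (twisted k n) (?ws i) l))"
  have D: "det (mat k k (\<lambda>(i, j). twisted_minor k n (?ws i @ [c + j]))) = ?O * consec_minor k n c"
      for c
  proof -
    have "det (mat k k (\<lambda>(l, j). twisted k n (c + j) l)) = consec_minor k n c"
      unfolding consec_minor_def twisted_minor_def coldet_def
      by (intro arg_cong[where f = det] cong_mat) auto
    then show ?thesis unfolding twisted_minor_def
      using det_coldet_square[of k ?ws "twisted k n" "\<lambda>j. c + j"] assms by simp
  qed
  let ?U = "mat k k (\<lambda>(i, j). twisted_minor k n (?ws i @ [r + (k - 1) + j]))"
  have "upper_triangular ?U"
  proof (rule upper_triangularI)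
    fix i j assume ij: "j < i" "i < dim_row ?U"
    then have "\<not> distinct (?ws i @ [r + (k - 1) + j])" by auto
    then have "twisted_minor k n (?ws i @ [r + (k - 1) + j]) = 0"
      unfolding twisted_minor_def using assms by (intro coldet_not_distinct) auto
    then show "?U $$ (i, j) = 0" using ij by simp
  qed
  then have "det ?U = prod_list (diag_mat ?U)" by (intro det_upper_triangular) auto
  also have "diag_mat ?U = map (\<lambda>i. consec_minor k n (r + i)) [0..<k]"
  proof -
    have "twisted_minor k n (?ws i @ [r + (k - 1) + i]) = consec_minor k n (r + i)" for i
    proof -
      have "r + (k - 1) + i = r + i + (k - 1)" by simp
      then show ?thesis unfolding consec_minor_def by (simp only: upt_Suc_end[OF assms])
    qed
    then show ?thesis by (auto simp: diag_mat_def)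
  qed
  also have "prod_list \<dots> = (\<Prod>i<k. consec_minor k n (r + i))"
    using prod.distinct_set_conv_list[of "[0..<k]" "\<lambda>i. consec_minor k n (r + i)"]
    by (simp add: lessThan_atLeast0)
  finally have "?O * consec_minor k n (r + (k - 1)) = (\<Prod>i<k. consec_minor k n (r + i))"
      unfolding D .
  then show ?thesis unfolding D by (simp only: ac_simps)
qed

section \<open>The coordinate ring and its specializations\<close>

lemma ring_of_type_algebra_simps [simp]:
  "\<zero>\<^bsub>ring_of_type_algebra\<^esub> = 0" "\<one>\<^bsub>ring_of_type_algebra\<^esub> = 1"
  "x \<oplus>\<^bsub>ring_of_type_algebra\<^esub> y = x + y" "x \<otimes>\<^bsub>ring_of_type_algebra\<^esub> y = x * y"
  "carrier ring_of_type_algebra = UNIV"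
  by (simp_all add: ring_of_type_algebra_def)

lemma ring_of_type_algebra_uminus [simp]: "\<ominus>\<^bsub>ring_of_type_algebra\<^esub> x = - (x :: 'a :: field)"
proof -
  interpret R: Ring.field "ring_of_type_algebra :: 'a ring" by (rule field_from_type_algebra)
  show ?thesis using R.minus_equality[of "- x" x] by simp
qed

lemma grass_ring_simps [simp]:
  "\<zero>\<^bsub>grass_ring k n\<^esub> = 0" "\<one>\<^bsub>grass_ring k n\<^esub> = 1"
  "x \<oplus>\<^bsub>grass_ring k n\<^esub> y = x + y" "x \<otimes>\<^bsub>grass_ring k n\<^esub> y = x * y"
  by (simp_all add: grass_ring_def)

lemma grass_ring_ring: "ring (grass_ring k n)"
proof -
  interpret R: Ring.field "ring_of_type_algebra :: ratfun ring" by (rule field_from_type_algebra)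
  show ?thesis unfolding grass_ring_def by (rule R.generate_ring_is_ring) simp
qed

context
  fixes k n :: nat
begin

abbreviation "\<A> \<equiv> carrier (grass_ring k n)"

lemma grass_add: "x \<in> \<A> \<Longrightarrow> y \<in> \<A> \<Longrightarrow> x + y \<in> \<A>"
  and grass_mult: "x \<in> \<A> \<Longrightarrow> y \<in> \<A> \<Longrightarrow> x * y \<in> \<A>"
  and grass_uminus: "x \<in> \<A> \<Longrightarrow> - x \<in> \<A>"
  and grass_1: "1 \<in> \<A>"
  using generate_ring.intros[where R = "ring_of_type_algebra :: ratfun ring"
      and H = "range const \<union> {plucker k J |J. length J = k \<and> set J \<subseteq> {1..n}}"]
  by (auto simp: grass_ring_def)

lemma grass_0: "0 \<in> \<A>"
  using grass_add[OF grass_1 grass_uminus[OF grass_1]] by simp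

lemma grass_diff: "x \<in> \<A> \<Longrightarrow> y \<in> \<A> \<Longrightarrow> x - y \<in> \<A>"
  using grass_add[OF _ grass_uminus, of x y] by simp

lemma grass_power: "x \<in> \<A> \<Longrightarrow> x ^ m \<in> \<A>"
  by (induction m) (auto simp: grass_1 grass_mult)

lemma grass_sum: "(\<And>i. i \<in> I \<Longrightarrow> f i \<in> \<A>) \<Longrightarrow> sum f I \<in> \<A>"
  by (induction I rule: infinite_finite_induct) (auto simp: grass_0 grass_add)

lemma grass_prod: "(\<And>i. i \<in> I \<Longrightarrow> f i \<in> \<A>) \<Longrightarrow> prod f I \<in> \<A>"
  by (induction I rule: infinite_finite_induct) (auto simp: grass_1 grass_mult)

lemma grass_plucker: "length J = k \<Longrightarrow> set J \<subseteq> {1..n} \<Longrightarrow> plucker k J \<in> \<A>"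
  unfolding grass_ring_def by (auto intro!: generate_ring.incl)

lemma grass_twisted_minor:
  assumes "length zs = k" "1 \<le> n"
  shows "twisted_minor k n zs \<in> \<A>"
proof -
  have "prod_list (map (\<lambda>z. (-1) ^ ((k - 1) * ((z - 1) div n))) ys) \<in> \<A>" for ys
    by (induction ys) (auto intro!: grass_mult grass_power grass_uminus grass_1)
  moreover have "plucker k (map (\<lambda>z. red n (int z)) zs) \<in> \<A>"
    using assms red_mem[OF assms(2)] by (intro grass_plucker) auto
  ultimately show ?thesis
    unfolding twisted_minor_plucker[OF assms(1)] by (rule grass_mult)
qed

context
  fixes \<phi> :: "ratfun \<Rightarrow> complex"
  assumes hom: "grass_alg_hom k n \<phi>"
begin

lemma phi_add: "x \<in> \<A> \<Longrightarrow> y \<in> \<A> \<Longrightarrow> \<phi> (x + y) = \<phi> x + \<phi> y"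
  and phi_mult: "x \<in> \<A> \<Longrightarrow> y \<in> \<A> \<Longrightarrow> \<phi> (x * y) = \<phi> x * \<phi> y"
  and phi_1: "\<phi> 1 = 1"
  using hom unfolding grass_alg_hom_def Ring.ring_hom_def by auto

lemma phi_0: "\<phi> 0 = 0"
  using phi_add[OF grass_0 grass_0] by simp

lemma phi_uminus: "x \<in> \<A> \<Longrightarrow> \<phi> (- x) = - \<phi> x"
  using phi_add[OF _ grass_uminus, of x x] phi_0 by (simp add: eq_neg_iff_add_eq_0 add.commute)

lemma phi_diff: "x \<in> \<A> \<Longrightarrow> y \<in> \<A> \<Longrightarrow> \<phi> (x - y) = \<phi> x - \<phi> y"
  using phi_add[OF _ grass_uminus, of x y] by (simp add: phi_uminus)

lemma phi_sum: "(\<And>i. i \<in> I \<Longrightarrow> f i \<in> \<A>) \<Longrightarrow> \<phi> (sum f I) = (\<Sum>i\<in>I. \<phi> (f i))"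
  by (induction I rule: infinite_finite_induct) (auto simp: phi_0 phi_add grass_sum)

lemma phi_prod: "(\<And>i. i \<in> I \<Longrightarrow> f i \<in> \<A>) \<Longrightarrow> \<phi> (prod f I) = (\<Prod>i\<in>I. \<phi> (f i))"
  by (induction I rule: infinite_finite_induct) (auto simp: phi_1 phi_mult grass_prod)

lemma det_phi:
  assumes "\<And>i j. i < s \<Longrightarrow> j < s \<Longrightarrow> f (i, j) \<in> \<A>"
  shows "det (mat s s f) \<in> \<A>" "\<phi> (det (mat s s f)) = det (mat s s (\<lambda>x. \<phi> (f x)))"
proof -
  let ?P = "{p. p permutes {0..<s}}"
  have less: "p i < s" if "p \<in> ?P" "i < s" for p i
    using that permutes_in_image[of p "{0..<s}" i] by auto
  have d: "det (mat s s g) = (\<Sum>p\<in>?P. signof p * (\<Prod>i=0..<s. g (i, p i)))"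
      for g :: "nat \<times> nat \<Rightarrow> 'x::comm_ring_1"
  proof -
    have "det (mat s s g) = (\<Sum>p\<in>?P. signof p * (\<Prod>i=0..<s. mat s s g $$ (i, p i)))"
      by (rule det_def') simp
    also have "\<dots> = (\<Sum>p\<in>?P. signof p * (\<Prod>i=0..<s. g (i, p i)))"
      using less by (intro sum.cong refl arg_cong2[where f = "(*)"] prod.cong) auto
    finally show ?thesis .
  qed
  have e: "f (i, p i) \<in> \<A>" if "p \<in> ?P" "i \<in> {0..<s}" for p i
    using that assms less by auto
  have sg: "signof p \<in> \<A>" "\<phi> (signof p) = signof p" for p :: "nat \<Rightarrow> nat"
    by (auto simp: sign_def grass_1 grass_uminus phi_uminus phi_1)
  have t: "signof p * (\<Prod>i=0..<s. f (i, p i)) \<in> \<A>" if "p \<in> ?P" for p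
    using that e by (intro grass_mult sg grass_prod) auto
  show "det (mat s s f) \<in> \<A>" unfolding d by (intro grass_sum t)
  show "\<phi> (det (mat s s f)) = det (mat s s (\<lambda>x. \<phi> (f x)))"
    unfolding d
  proof (subst phi_sum[OF t], assumption, rule sum.cong[OF refl])
    fix p assume p: "p \<in> ?P"
    have "(\<Prod>i=0..<s. f (i, p i)) \<in> \<A>" by (rule grass_prod) (rule e[OF p])
    then have "\<phi> (signof p * (\<Prod>i=0..<s. f (i, p i))) = \<phi> (signof p) * \<phi> (\<Prod>i=0..<s. f (i, p i))"
      by (rule phi_mult[OF sg(1)])
    also have "\<phi> (\<Prod>i=0..<s. f (i, p i)) = (\<Prod>i=0..<s. \<phi> (f (i, p i)))"
      by (rule phi_prod) (rule e[OF p])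
    finally show "\<phi> (signof p * (\<Prod>i=0..<s. f (i, p i))) = signof p * (\<Prod>i=0..<s. \<phi> (f (i, p i)))"
      by (simp only: sg(2))
  qed
qed

text \<open>
The kernel of \<open>\<phi>\<close> is an ideal that contains the generators of the special ideal. So \<open>\<phi>\<close> is
constant on the cosets, and the induced map on the quotient returns the value of \<open>\<phi>\<close> on any
representative.
\<close>

lemma phi_special_ideal:
  assumes n: "1 \<le> n" and one: "\<And>x. x \<in> consecutive_pluckers k n \<Longrightarrow> x \<in> \<A> \<and> \<phi> x = 1"
  shows "special_ideal k n \<subseteq> {x \<in> \<A>. \<phi> x = 0}" and "0 \<in> special_ideal k n"
proof -
  interpret R: Ring.field "ring_of_type_algebra :: complex ring" by (rule field_from_type_algebra)
  interpret G: ring "grass_ring k n" by (rule grass_ring_ring)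
  have "ring_hom_ring (grass_ring k n) ring_of_type_algebra \<phi>"
    using hom unfolding grass_alg_hom_def
    by (intro ring_hom_ringI2 G.ring_axioms R.ring_axioms) auto
  then have "ideal (a_kernel (grass_ring k n) ring_of_type_algebra \<phi>) (grass_ring k n)"
    by (rule ring_hom_ring.kernel_is_ideal)
  moreover have "a_kernel (grass_ring k n) ring_of_type_algebra \<phi> = {x \<in> \<A>. \<phi> x = 0}"
    unfolding a_kernel_def' ring_of_type_algebra_simps ..
  ultimately have I: "ideal {x \<in> \<A>. \<phi> x = 0} (grass_ring k n)" by (simp only:)
  have S: "{x - 1 | x. x \<in> consecutive_pluckers k n} \<subseteq> {x \<in> \<A>. \<phi> x = 0}"
    using one by (auto simp: grass_diff grass_1 phi_diff phi_1)
  from I show "special_ideal k n \<subseteq> {x \<in> \<A>. \<phi> x = 0}"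
    unfolding special_ideal_def using S by (rule G.genideal_minimal)
  have "ideal (special_ideal k n) (grass_ring k n)"
    unfolding special_ideal_def using S by (intro G.genideal_ideal) blast
  then have "additive_subgroup (special_ideal k n) (grass_ring k n)" by (rule ideal.axioms)
  then show "0 \<in> special_ideal k n" using additive_subgroup.zero_closed by fastforce
qed

lemma specialized_frieze_eq:
  assumes n: "1 \<le> n" and one: "\<And>x. x \<in> consecutive_pluckers k n \<Longrightarrow> x \<in> \<A> \<and> \<phi> x = 1"
    and mem: "plucker_frieze k n r m \<in> \<A>"
  shows "specialized_frieze k n \<phi> r m = \<phi> (plucker_frieze k n r m)"
proof -
  let ?p = "plucker_frieze k n r m"
  have "special_plucker_frieze k n r m = (\<lambda>h. h + ?p) ` special_ideal k n"
    unfolding special_plucker_frieze_def a_r_coset_def' by auto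
  also have "\<phi> ` \<dots> = {\<phi> ?p}"
  proof -
    have "\<phi> (h + ?p) = \<phi> ?p" if "h \<in> special_ideal k n" for h
      using phi_special_ideal(1)[OF n one] that mem by (auto simp: phi_add)
    then show ?thesis using phi_special_ideal(2)[OF n one] by (force simp: image_image)
  qed
  finally show ?thesis by (simp add: specialized_frieze_def induced_map_def)
qed

end

end

section \<open>Rotation of the rectangles seed\<close>

text \<open>
The exchange matrix, restricted to the mutable vertices, while the rotation of the rectangles
seed is under way; \<open>d\<close> tells which vertices have been mutated. An edge of the grid is reversed
when exactly one of its ends has been mutated. The diagonal of a unit square of the grid, from
bottom right to top left, vanishes once the bottom left corner has been mutated and reappears
with the top right corner; the other diagonal, from bottom left to top right, is present after
the top left corner and before the bottom right corner. In the order of mutation, the corners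
are bottom left, top left, bottom right, top right.
\<close>

definition arrow :: "(nat \<times> nat \<Rightarrow> bool) \<Rightarrow> nat \<times> nat \<Rightarrow> nat \<times> nat \<Rightarrow> int" where
  "arrow d u v = (case (u, v) of ((i, j), (i', j')) \<Rightarrow>
     if i' = i \<and> j' = j + 1 \<or> i' = i + 1 \<and> j' = j then (if d u = d v then 1 else -1)
     else if i = i' + 1 \<and> j = j' + 1 then of_bool (\<not> d (i, j') \<or> d (i', j))
     else if i = i' + 1 \<and> j' = j + 1 then of_bool (d (i', j) \<and> \<not> d (i, j'))
     else 0)"

definition quiver :: "(nat \<times> nat \<Rightarrow> bool) \<Rightarrow> nat \<times> nat \<Rightarrow> nat \<times> nat \<Rightarrow> int" where
  "quiver d u v = arrow d u v - arrow d v u"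

text \<open>
The vertices that precede \<open>(i, j)\<close> in the order of mutation: by columns, and in each column from
large to small row index.
\<close>

definition processed :: "nat \<Rightarrow> nat \<Rightarrow> nat \<times> nat \<Rightarrow> bool" where
  "processed i j x \<longleftrightarrow> snd x < j \<or> snd x = j \<and> i < fst x"

lemma quiver_skew: "quiver d u v = - quiver d v u"
  by (simp add: quiver_def)

lemma quiver_True: "quiver (\<lambda>_. True) = quiver (\<lambda>_. False)"
  by (intro ext) (auto simp: quiver_def arrow_def split: prod.splits)

lemma quiver_cong:
  assumes "\<And>x. x \<in> I \<times> J \<Longrightarrow> d x = d' x" "u \<in> I \<times> J" "v \<in> I \<times> J"
  shows "quiver d u v = quiver d' u v"
proof -
  obtain i j i' j' where uv: "u = (i, j)" "v = (i', j')" by force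
  have "d x = d' x" if "x \<in> {(i, j), (i', j'), (i, j'), (i', j)}" for x
    using that assms uv by auto
  then show ?thesis unfolding quiver_def arrow_def uv by simp
qed

lemma quiver_far:
  assumes "Suc (fst u) < fst v \<or> Suc (fst v) < fst u \<or> Suc (snd u) < snd v \<or> Suc (snd v) < snd u"
  shows "quiver d u v = 0"
proof -
  have far: "arrow d (i, j) (i', j') = 0"
    if "Suc i < i' \<or> Suc i' < i \<or> Suc j < j' \<or> Suc j' < j" for i j i' j'
  proof -
    have "\<not> (i' = i \<and> j' = j + 1 \<or> i' = i + 1 \<and> j' = j)" "\<not> (i = i' + 1 \<and> j = j' + 1)"
      "\<not> (i = i' + 1 \<and> j' = j + 1)"
      using that by linarith+
    then show ?thesis unfolding arrow_def by (simp only: prod.case if_False)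
  qed
  obtain i j i' j' where uv: "u = (i, j)" "v = (i', j')" by force
  show ?thesis using far[of i i' j j'] far[of i' i j' j] assms unfolding quiver_def uv by auto
qed

text \<open>
The multiplicity of an arrow depends only on the state of the corners of the square spanned by
its ends.
\<close>

lemma quiver_local_cong:
  assumes "d u = d' u" "d v = d' v"
    and "fst u \<noteq> fst v \<Longrightarrow> snd u \<noteq> snd v \<Longrightarrow> d (fst u, snd v) = d' (fst u, snd v) \<and> d (fst v, snd u)
        = d' (fst v, snd u)"
  shows "quiver d u v = quiver d' u v"
proof -
  have arr: "arrow d (i, j) (i', j') = arrow d' (i, j) (i', j')"
    if "d (i, j) = d' (i, j)" "d (i', j') = d' (i', j')"
      "i \<noteq> i' \<Longrightarrow> j \<noteq> j' \<Longrightarrow> d (i, j') = d' (i, j') \<and> d (i', j) = d' (i', j)" for i j i' j'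
  proof (cases "i = i' \<or> j = j'")
    case True
    then have "\<not> (i = i' + 1 \<and> j = j' + 1)" "\<not> (i = i' + 1 \<and> j' = j + 1)" by linarith+
    then show ?thesis unfolding arrow_def by (simp only: prod.case if_False that(1,2))
  next
    case False
    then have "d (i, j') = d' (i, j')" "d (i', j) = d' (i', j)" using that(3) by auto
    then show ?thesis unfolding arrow_def by (simp only: prod.case that(1,2))
  qed
  obtain i j i' j' where uv: "u = (i, j)" "v = (i', j')" by force
  show ?thesis unfolding quiver_def uv
    using assms arr[of i j i' j'] arr[of i' j' i j] unfolding uv by simp
qed

text \<open>
When the turn of a vertex comes, only its four neighbours in the grid are joined to it. So the
exchange relation there has the shape of a three-term Pluecker relation.
\<close>

lemma quiver_processed:
  assumes "1 \<le> i" "1 \<le> j"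
  shows "quiver (processed i j) u (i, j) =
    (if u = (i - 1, j) \<or> u = (i + 1, j) then 1 else if u = (i, j - 1) \<or> u = (i, j + 1) then -1
        else 0)"
proof -
  obtain i0 j0 where ij: "i = Suc i0" "j = Suc j0" using assms by (metis Suc_le_D One_nat_def)
  obtain a c where u: "u = (a, c)" by force
  consider "Suc a < i \<or> Suc i < a \<or> Suc c < j \<or> Suc j < c"
    | "a \<in> {i0, i, Suc i}" "c \<in> {j0, j, Suc j}" unfolding ij by force
  then show ?thesis
  proof cases
    case 1
    then have "quiver (processed i j) u (i, j) = 0" by (intro quiver_far) (auto simp: u)
    with 1 show ?thesis by (auto simp: u ij)
  next
    case 2
    then show ?thesis unfolding u ij
      by (elim insertE) (simp_all add: quiver_def arrow_def processed_def)
  qed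
qed

text \<open>
Only the pairs formed by \<open>(i, j)\<close> and its four neighbours, and the pairs of these neighbours,
can be affected: for all other pairs the mutation changes nothing, and the state of \<open>(i, j)\<close>
does not enter.
\<close>

lemma mutate_quiver:
  assumes "1 \<le> i" "1 \<le> j"
  shows "mutate_matrix (quiver (processed i j)) (i, j) u v = quiver (processed (i - 1) j) u v"
proof -
  let ?d = "processed i j" and ?d' = "processed (i - 1) j" and ?t = "(i, j)"
  obtain i0 j0 where ij: "i = Suc i0" "j = Suc j0" using assms by (metis Suc_le_D One_nat_def)
  let ?N = "{(i0, j), (Suc i, j), (i, j0), (i, Suc j)}"
  have dd: "?d x = ?d' x" if "x \<noteq> ?t" for x
    using that by (cases x) (auto simp: processed_def ij)
  have qt: "quiver ?d ?t v = - quiver ?d v ?t" for v by (rule quiver_skew)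
  note p = quiver_processed[OF assms]
  have q': "quiver ?d' x ?t = - quiver ?d x ?t" for x
  proof -
    obtain a c where x: "x = (a, c)" by force
    consider "Suc a < i \<or> Suc i < a \<or> Suc c < j \<or> Suc j < c"
      | "a \<in> {i0, i, Suc i}" "c \<in> {j0, j, Suc j}" unfolding ij by force
    then show ?thesis
    proof cases
      case 1
      then show ?thesis by (subst (1 2) quiver_far) (auto simp: x)
    next
      case 2
      then show ?thesis unfolding x ij
        by (elim insertE) (simp_all add: quiver_def arrow_def processed_def)
    qed
  qed
  consider "u = ?t" | "v = ?t" | "u \<noteq> ?t" "v \<noteq> ?t" "u \<in> ?N" "v \<in> ?N"
    | "u \<noteq> ?t" "v \<noteq> ?t" "u \<notin> ?N \<or> v \<notin> ?N"
    by blast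
  then show ?thesis
  proof cases
    case 1
    have "mutate_matrix (quiver ?d) ?t u v = - quiver ?d u v" using 1
        by (simp add: mutate_matrix_def)
    then show ?thesis using q'[of v] quiver_skew[of ?d ?t v] quiver_skew[of ?d' ?t v] 1 by simp
  next
    case 2
    have "mutate_matrix (quiver ?d) ?t u v = - quiver ?d u v" using 2
        by (simp add: mutate_matrix_def)
    then show ?thesis using q'[of u] 2 by simp
  next
    case 3
    have m: "mutate_matrix (quiver ?d) ?t u v = quiver ?d u v
       + sgn (quiver ?d u ?t) * max (quiver ?d u ?t * (- quiver ?d v ?t)) 0"
      using 3 unfolding qt[symmetric] by (simp add: mutate_matrix_def)
    show ?thesis unfolding m p using 3(3,4) unfolding ij
      by (elim insertE) (simp_all add: quiver_def arrow_def processed_def)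
  next
    case 4
    have "quiver ?d u ?t = 0 \<or> quiver ?d v ?t = 0"
      using 4(3) unfolding p by (auto simp: ij)
    then have "mutate_matrix (quiver ?d) ?t u v = quiver ?d u v"
      using 4 by (auto simp: mutate_matrix_def qt)
    also have "\<dots> = quiver ?d' u v"
    proof (cases "Suc (fst u) < fst v \<or> Suc (fst v) < fst u \<or> Suc (snd u) < snd v
        \<or> Suc (snd v) < snd u")
      case True
      then show ?thesis by (simp add: quiver_far)
    next
      case False
      show ?thesis
      proof (rule quiver_local_cong)
        show "?d u = ?d' u" "?d v = ?d' v" using dd 4 by blast+
        assume n: "fst u \<noteq> fst v" "snd u \<noteq> snd v"
        have "(fst u, snd v) \<noteq> ?t" "(fst v, snd u) \<noteq> ?t"
        proof -
          have "u \<in> ?N \<and> v \<in> ?N" if h: "fst u = i" "snd v = j"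
          proof -
            have "snd u = j0 \<or> snd u = Suc j" "fst v = i0 \<or> fst v = Suc i"
              using False n h ij by linarith+
            with h show ?thesis by (cases u; cases v) auto
          qed
          moreover have "u \<in> ?N \<and> v \<in> ?N" if h: "fst v = i" "snd u = j"
          proof -
            have "snd v = j0 \<or> snd v = Suc j" "fst u = i0 \<or> fst u = Suc i"
              using False n h ij by linarith+
            with h show ?thesis by (cases u; cases v) auto
          qed
          ultimately show "(fst u, snd v) \<noteq> ?t" "(fst v, snd u) \<noteq> ?t" using 4(3) by auto
        qed
        then show "?d (fst u, snd v) = ?d' (fst u, snd v) \<and> ?d (fst v, snd u) = ?d' (fst v, snd u)"
          using dd by blast
      qed
    qed
    finally show ?thesis .
  qed
qed

lemma mutate_matrix_cong:
  "b u v = c u v \<Longrightarrow> b u t = c u t \<Longrightarrow> b t v = c t v \<Longrightarrow> mutate_matrix b t u v = mutate_matrix c t u v"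
  by (simp add: mutate_matrix_def)

text \<open>
Frozen variables with value \<open>1\<close> do not contribute to an exchange relation, so neither do the
rows of the exchange matrix at frozen vertices.
\<close>

lemma mutate_var_four:
  fixes y :: "'v \<Rightarrow> 'a::field"
  assumes V: "finite V" "T \<subseteq> V" and frozen: "\<And>v. v \<in> V - T \<Longrightarrow> y v = 1"
    and ne: "p \<noteq> p'" "q \<noteq> q'" "p \<noteq> q" "p \<noteq> q'" "p' \<noteq> q" "p' \<noteq> q'"
    and b: "\<And>u. u \<in> T \<Longrightarrow> b u t = (if u = p \<or> u = p' then 1 else if u = q \<or> u = q' then -1 else 0)"
  defines "e \<equiv> \<lambda>u. if u \<in> T then y u else 1"
  shows "mutate_var V b t y t = (e p * e p' + e q * e q') / y t"
proof -
  have prod2: "(\<Prod>u\<in>{r, r'} \<inter> T. y u) = e r * e r'" if "r \<noteq> r'" for r r'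
    using that by (cases "r \<in> T"; cases "r' \<in> T") (auto simp: e_def)
  have one: "y u = 1" if "u \<in> V" "u \<notin> T" for u using frozen that by blast
  have "(\<Prod>u\<in>{u \<in> V. b u t > 0}. y u ^ nat (b u t)) = (\<Prod>u\<in>{p, p'} \<inter> T. y u)"
  proof (intro prod.mono_neutral_cong_right ballI)
    fix i assume "i \<in> {u \<in> V. b u t > 0} - {p, p'} \<inter> T"
    then show "y i ^ nat (b i t) = 1"
      using b[of i] one[of i] by (cases "i \<in> T") (auto split: if_splits)
  qed (use V in \<open>auto simp: b\<close>)
  moreover have "(\<Prod>u\<in>{u \<in> V. b u t < 0}. y u ^ nat (- b u t)) = (\<Prod>u\<in>{q, q'} \<inter> T. y u)"
  proof (intro prod.mono_neutral_cong_right ballI)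
    fix i assume "i \<in> {u \<in> V. b u t < 0} - {q, q'} \<inter> T"
    then show "y i ^ nat (- b i t) = 1"
      using b[of i] one[of i] by (cases "i \<in> T") (auto split: if_splits)
  qed (use V ne in \<open>auto simp: b\<close>)
  ultimately show ?thesis using ne by (simp add: mutate_var_def prod2)
qed

text \<open>
The seed is halfway between the values \<open>F\<close> and their rotations \<open>G\<close>. All frozen variables are
\<open>1\<close>, so the mutations at mutable vertices depend only on the part of \<open>b\<close> between mutable
vertices.
\<close>

definition at_stage :: "(nat \<times> nat) set \<Rightarrow> (nat \<times> nat) set \<Rightarrow> (nat \<Rightarrow> nat \<Rightarrow> 'a::field) \<Rightarrow>
    (nat \<Rightarrow> nat \<Rightarrow> 'a) \<Rightarrow> (nat \<times> nat \<Rightarrow> bool) \<Rightarrow> (nat \<times> nat \<Rightarrow> 'a) \<Rightarrow>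
    (nat \<times> nat \<Rightarrow> nat \<times> nat \<Rightarrow> int) \<Rightarrow> bool" where
  "at_stage V T F G d y b \<longleftrightarrow>
     (\<forall>i j. (i, j) \<in> T \<longrightarrow> y (i, j) = (if d (i, j) then G i j else F i j)) \<and>
     (\<forall>v\<in>V - T. y v = 1) \<and> (\<forall>u\<in>T. \<forall>v\<in>T. b u v = quiver d u v)"

context
  fixes k l :: nat and V T :: "(nat \<times> nat) set" and F G :: "nat \<Rightarrow> nat \<Rightarrow> 'a::field"
  assumes T: "T = {1..<k} \<times> {1..<l}" and V: "finite V" "T \<subseteq> V"
    and F: "\<And>i j. (i, j) \<in> T \<Longrightarrow> F i j \<noteq> 0" "\<And>j. F 0 j = 1" "\<And>i. i < k \<Longrightarrow> F i l = 1"
    and G: "\<And>j. G k j = 1" "\<And>i. i < k \<Longrightarrow> G i 0 = 1"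
    and rel: "\<And>i j. (i, j) \<in> T \<Longrightarrow>
      F i j * G i j = F (i - 1) j * G (i + 1) j + F i (j + 1) * G i (j - 1)"
begin

lemma at_stage_cong:
  assumes st: "at_stage V T F G d y b" and d: "\<And>x. x \<in> T \<Longrightarrow> d x = d' x"
  shows "at_stage V T F G d' y b"
proof -
  have "quiver d u v = quiver d' u v" if "u \<in> T" "v \<in> T" for u v
    using quiver_cong[of "{1..<k}" "{1..<l}" d d' u v] d that unfolding T by blast
  then show ?thesis using st d unfolding at_stage_def by simp
qed

lemma at_stage_step:
  assumes st: "at_stage V T F G (processed i j) y b" and ij: "(i, j) \<in> T"
  shows "at_stage V T F G (processed (i - 1) j) (mutate_var V b (i, j) y) (mutate_matrix b (i, j))"
proof -
  have ij1: "1 \<le> i" "1 \<le> j" "i < k" "j < l" using ij by (auto simp: T)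
  let ?e = "\<lambda>u. if u \<in> T then y u else 1"
  have y: "y (a, c) = (if processed i j (a, c) then G a c else F a c)" if "(a, c) \<in> T" for a c
    using st that unfolding at_stage_def by blast
  have b: "b u v = quiver (processed i j) u v" if "u \<in> T" "v \<in> T" for u v
    using st that unfolding at_stage_def by blast
  have "mutate_var V b (i, j) y (i, j)
      = (?e (i - 1, j) * ?e (i + 1, j) + ?e (i, j - 1) * ?e (i, j + 1)) / y (i, j)"
  proof (rule mutate_var_four[OF V])
    show "y v = 1" if "v \<in> V - T" for v using st that unfolding at_stage_def by blast
    show "b u (i, j) = (if u = (i - 1, j) \<or> u = (i + 1, j) then 1
        else if u = (i, j - 1) \<or> u = (i, j + 1) then - 1 else 0)" if "u \<in> T" for u
      unfolding b[OF that ij] by (rule quiver_processed[OF ij1(1,2)])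
  qed (use ij1 in auto)
  also have "?e (i - 1, j) = F (i - 1) j"
    using ij1 F(2) y[of "i - 1" j] by (cases "i = 1") (auto simp: T processed_def)
  also have "?e (i + 1, j) = G (i + 1) j"
    using ij1 G(1)[of j] y[of "i + 1" j] by (cases "i + 1 = k") (auto simp: T processed_def)
  also have "?e (i, j - 1) = G i (j - 1)"
    using ij1 G(2)[of i] y[of i "j - 1"] by (cases "j = 1") (auto simp: T processed_def)
  also have "?e (i, j + 1) = F i (j + 1)"
    using ij1 F(3)[of i] y[of i "j + 1"] by (cases "j + 1 = l") (auto simp: T processed_def)
  also have "y (i, j) = F i j" using y[OF ij] by (simp add: processed_def)
  also have "(F (i - 1) j * G (i + 1) j + G i (j - 1) * F i (j + 1)) / F i j = G i j"
    using rel[OF ij] F(1)[OF ij] by (simp add: field_simps)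
  finally have new: "mutate_var V b (i, j) y (i, j) = G i j" .
  have other: "mutate_var V b (i, j) y v = y v" if "v \<noteq> (i, j)" for v
    using that by (simp add: mutate_var_def)
  show ?thesis
    unfolding at_stage_def
  proof (intro conjI allI impI ballI)
    fix a c assume ac: "(a, c) \<in> T"
    show "mutate_var V b (i, j) y (a, c) = (if processed (i - 1) j (a, c) then G a c else F a c)"
    proof (cases "(a, c) = (i, j)")
      case True
      then show ?thesis using new ij1 by (simp add: processed_def)
    next
      case False
      then have "processed (i - 1) j (a, c) = processed i j (a, c)"
        using ij1 by (auto simp: processed_def)
      then show ?thesis using other[OF False] y[OF ac] by simp
    qed
  next
    fix v assume v: "v \<in> V - T"
    then have "v \<noteq> (i, j)" using ij by blast
    then show "mutate_var V b (i, j) y v = 1"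
      using other[of v] st v unfolding at_stage_def by simp
  next
    fix u v assume "u \<in> T" "v \<in> T"
    then have "mutate_matrix b (i, j) u v = mutate_matrix (quiver (processed i j)) (i, j) u v"
      using ij by (intro mutate_matrix_cong b)
    then show "mutate_matrix b (i, j) u v = quiver (processed (i - 1) j) u v"
      by (simp only: mutate_quiver[OF ij1(1,2)])
  qed
qed

lemma at_stage_column:
  assumes "at_stage V T F G (processed i j) y b" "i < k" "1 \<le> j" "j < l"
  shows "\<exists>w. set w \<subseteq> T \<and> at_stage V T F G (processed 0 j) (mutate_along V b w y) (matrix_along b w)"
  using assms
proof (induction i arbitrary: y b)
  case 0
  then show ?case by (intro exI[of _ "[]"]) simp
next
  case (Suc i)
  have ij: "(Suc i, j) \<in> T" using Suc.prems by (auto simp: T)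
  let ?t = "(Suc i, j)"
  have "at_stage V T F G (processed i j) (mutate_var V b ?t y) (mutate_matrix b ?t)"
    using at_stage_step[OF Suc.prems(1) ij] by simp
  from Suc.IH[OF this] Suc.prems obtain w where
    "set w \<subseteq> T" "at_stage V T F G (processed 0 j) (mutate_along V (mutate_matrix b ?t) w
        (mutate_var V b ?t y))
      (matrix_along (mutate_matrix b ?t) w)" by auto
  then show ?case using ij by (intro exI[of _ "?t # w"]) simp
qed

lemma at_stage_columns:
  assumes "at_stage V T F G (processed (k - 1) 1) y b" "1 \<le> k" "j < l"
  shows "\<exists>w. set w \<subseteq> T \<and> at_stage V T F G (processed (k
      - 1) (Suc j)) (mutate_along V b w y) (matrix_along b w)"
  using assms(3)
proof (induction j)
  case 0
  then show ?case using assms(1) by (intro exI[of _ "[]"]) simp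
next
  case (Suc j)
  then obtain w where w: "set w \<subseteq> T"
    "at_stage V T F G (processed (k - 1) (Suc j)) (mutate_along V b w y) (matrix_along b w)" by auto
  from at_stage_column[OF w(2)] Suc.prems assms(2) obtain w' where w': "set w' \<subseteq> T"
    "at_stage V T F G (processed 0 (Suc j)) (mutate_along V (matrix_along b w) w' (mutate_along V
        b w y)) (matrix_along (matrix_along b w) w')"
    by auto
  have "processed 0 (Suc j) x = processed (k - 1) (Suc (Suc j)) x" if "x \<in> T" for x
    using that by (auto simp: T processed_def)
  then have "at_stage V T F G (processed (k - 1) (Suc (Suc j))) (mutate_along V b (w @ w') y)
      (matrix_along b (w @ w'))"
    unfolding mutate_along_append matrix_along_append by (rule at_stage_cong[OF w'(2)])
  then show ?case using w w' by (intro exI[of _ "w @ w'"]) auto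
qed

text \<open>
At the end every vertex has been mutated, and the quiver is the initial one again
(\<open>quiver_True\<close>); so the rotation can be repeated.
\<close>

lemma rotation:
  assumes "1 \<le> k" "1 \<le> l" "at_stage V T F G (\<lambda>_. False) y b"
  shows "\<exists>w. set w \<subseteq> T \<and> at_stage V T F G (\<lambda>_. True) (mutate_along V b w y) (matrix_along b w)"
proof -
  have "False = processed (k - 1) 1 x" if "x \<in> T" for x
    using that by (auto simp: T processed_def)
  then have "at_stage V T F G (processed (k - 1) 1) y b" by (rule at_stage_cong[OF assms(3)])
  from at_stage_columns[OF this assms(1), of "l - 1"] assms(2) obtain w where w: "set w \<subseteq> T"
    "at_stage V T F G (processed (k - 1) l) (mutate_along V b w y) (matrix_along b w)" by auto
  have "processed (k - 1) l x = True" if "x \<in> T" for x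
    using that by (auto simp: T processed_def)
  then have "at_stage V T F G (\<lambda>_. True) (mutate_along V b w y) (matrix_along b w)"
      by (rule at_stage_cong[OF w(2)])
  then show ?thesis using w(1) by blast
qed

end

section \<open>The exchange matrix of the rectangles seed\<close>

lemma initial_matrix_skew: "skew (initial_matrix k n)"
  unfolding skew_def initial_matrix_def by auto

text \<open>
A weight function with prescribed values \<open>a\<close> on the columns of the exchange matrix of the
rectangles seed: the column at \<open>(i, j)\<close> involves \<open>(i + 1, j + 1)\<close>, and its other entries belong
to vertices that the recursion has reached before.
\<close>

fun solve_exchange :: "(nat \<times> nat \<Rightarrow> int) \<Rightarrow> nat \<Rightarrow> nat \<Rightarrow> int" where
  "solve_exchange a (Suc (Suc i)) (Suc (Suc j)) = a (Suc i, Suc j)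
     - solve_exchange a (Suc i) j - solve_exchange a i (Suc j)
     + solve_exchange a (Suc i) (Suc (Suc j)) + solve_exchange a (Suc (Suc i)) (Suc j)
         + solve_exchange a i j"
| "solve_exchange a _ _ = 0"

lemma solve_rec_0: "solve_exchange a 0 j = 0" "solve_exchange a i 0 = 0"
  by (cases j; simp) (cases i; simp)

text \<open>
The vertex \<open>(0, 0)\<close> is left out: it plays the part of all vertices with a coordinate \<open>0\<close>, and
carries the weight \<open>0\<close> below.
\<close>

lemma initial_matrix_entry:
  assumes s: "(i, j) \<in> mutable_verts k n" and u: "u \<in> verts k n" "u \<noteq> (0, 0)"
  shows "initial_matrix k n u (i, j) =
    of_bool (u = (i, j - 1)) + of_bool (u = (i - 1, j)) + of_bool (u = (i + 1, j + 1))
    - of_bool (u = (i, j + 1)) - of_bool (u = (i + 1, j)) - of_bool (u = (i - 1, j - 1))"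
proof -
  obtain i0 j0 where ij: "i = Suc i0" "j = Suc j0"
    using s by (auto simp: mutable_verts_def Suc_le_eq gr0_conv_Suc)
  obtain a c where uu: "u = (Suc a, Suc c)"
    using u by (auto simp: verts_def Suc_le_eq gr0_conv_Suc)
  have "(i, j) \<in> verts k n" using s by (auto simp: verts_def mutable_verts_def)
  then have "initial_matrix k n u (i, j) = of_bool (rect_arrow u (i, j))
      - of_bool (rect_arrow (i, j) u)"
    using s u by (simp add: initial_matrix_def)
  also have "of_bool (rect_arrow u (i, j)) = of_bool (u = (i, j - 1)) + of_bool (u = (i - 1, j))
      + (of_bool (u = (i + 1, j + 1)) :: int)"
    by (auto simp: rect_arrow_def ij uu)
  also have "of_bool (rect_arrow (i, j) u) = of_bool (u = (i, j + 1)) + of_bool (u = (i + 1, j))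
      + (of_bool (u = (i - 1, j - 1)) :: int)"
    by (auto simp: rect_arrow_def ij uu)
  finally show ?thesis by simp
qed

lemma finite_verts: "finite (verts k n)"
  by (simp add: verts_def)

lemma mutable_verts_subset: "mutable_verts k n \<subseteq> verts k n"
  by (auto simp: verts_def mutable_verts_def)

lemma initial_matrix_unimodular: "unimodular (verts k n) (mutable_verts k n) (initial_matrix k n)"
  unfolding unimodular_def
proof
  fix a :: "nat \<times> nat \<Rightarrow> int"
  define l where "l u = solve_exchange a (fst u) (snd u)" for u
  have delta: "(\<Sum>u\<in>verts k n. l u * of_bool (u = p)) = l p"
    if "p \<in> verts k n \<or> fst p = 0 \<or> snd p = 0" for p
  proof (cases "p \<in> verts k n")
    case True
    then show ?thesis using finite_verts
      by (simp add: of_bool_def if_distrib[of "\<lambda>x. _ * x"] sum.delta' cong: if_cong)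
  next
    case False
    then have "l p = 0" using that solve_rec_0 by (auto simp: l_def)
    moreover have "(\<Sum>u\<in>verts k n. l u * of_bool (u = p)) = 0"
      using False by (intro sum.neutral) auto
    ultimately show ?thesis by simp
  qed
  have "weight (verts k n) l (\<lambda>u. initial_matrix k n u s) = a s" if s: "s \<in> mutable_verts k n" for s
  proof -
    obtain i j where ij: "s = (Suc i, Suc j)" using s
      by (auto simp: mutable_verts_def Suc_le_eq gr0_conv_Suc)
    have m: "(Suc i, Suc j) \<in> mutable_verts k n" using s ij by simp
    have "weight (verts k n) l (\<lambda>u. initial_matrix k n u s) = (\<Sum>u\<in>verts k n.
       l u * of_bool (u = (Suc i, j)) + l u * of_bool (u = (i, Suc j)) + l u * of_bool (u
           = (Suc (Suc i), Suc (Suc j)))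
       - l u * of_bool (u = (Suc i, Suc (Suc j))) - l u * of_bool (u = (Suc (Suc i), Suc j)) - l u
           * of_bool (u = (i, j)))"
      unfolding weight_def
    proof (rule sum.cong[OF refl])
      fix u assume u: "u \<in> verts k n"
      show "l u * initial_matrix k n u s =
       l u * of_bool (u = (Suc i, j)) + l u * of_bool (u = (i, Suc j)) + l u * of_bool (u
           = (Suc (Suc i), Suc (Suc j)))
       - l u * of_bool (u = (Suc i, Suc (Suc j))) - l u * of_bool (u = (Suc (Suc i), Suc j)) - l u
           * of_bool (u = (i, j))"
      proof (cases "u = (0, 0)")
        case True
        then have "l u = 0" by (simp add: l_def solve_rec_0)
        then show ?thesis by simp
      next
        case False
        show ?thesis unfolding ij initial_matrix_entry[OF m u False]
          by (simp only: algebra_simps) simp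
      qed
    qed
    also have "\<dots> = l (Suc i, j) + l (i, Suc j) + l (Suc (Suc i), Suc (Suc j))
       - l (Suc i, Suc (Suc j)) - l (Suc (Suc i), Suc j) - l (i, j)"
      unfolding sum_subtractf sum.distrib
      using m by (subst (1 2 3 4 5 6) delta) (auto simp: verts_def mutable_verts_def)
    also have "\<dots> = a s" by (simp add: l_def ij)
    finally show ?thesis .
  qed
  then show "\<exists>l. \<forall>s\<in>mutable_verts k n. weight (verts k n) l (\<lambda>u. initial_matrix k n u s) = a s"
    by blast
qed

lemma initial_matrix_quiver:
  assumes "u \<in> mutable_verts k n" "v \<in> mutable_verts k n"
  shows "initial_matrix k n u v = quiver (\<lambda>_. False) u v"
proof -
  have arr: "of_bool (rect_arrow u v) = arrow (\<lambda>_. False) u v"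
    if "u \<in> mutable_verts k n" "v \<in> mutable_verts k n" for u v
    using that by (cases u; cases v) (auto simp: rect_arrow_def arrow_def mutable_verts_def)
  show ?thesis
    using assms mutable_verts_subset[of k n] unfolding quiver_def arr[OF assms, symmetric] arr[OF
        assms(2,1), symmetric]
    by (auto simp: initial_matrix_def)
qed

lemma grass_seed_invariant:
  assumes "grass_seed k n x b"
  shows "skew b \<and> unimodular (verts k n) (mutable_verts k n) b \<and>
    (\<forall>v. v \<notin> mutable_verts k n \<longrightarrow> x v = initial_var k v)"
  using assms
proof induction
  case initial
  show ?case using initial_matrix_skew initial_matrix_unimodular by blast
next
  case (mutate x b t)
  then show ?case
    using skew_mutate[of b t] unimodular_mutate[OF finite_verts mutate.hyps(2)
        mutable_verts_subset, of b]
    by (auto simp: mutate_var_def)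
qed

section \<open>Values of cluster variables\<close>

context
  fixes k n :: nat and \<phi> :: "ratfun \<Rightarrow> complex"
  assumes hom: "grass_alg_hom k n \<phi>"
begin

text \<open>
The homomorphism \<open>\<phi>\<close> extends to quotients of elements of the coordinate ring. The elements on
which this extension is positive contain the given cluster and are closed under subtraction-free
expressions.
\<close>

definition has_value :: "ratfun \<Rightarrow> real \<Rightarrow> bool" where
  "has_value f r \<longleftrightarrow> (\<exists>a\<in>\<A> k n. \<exists>c\<in>\<A> k n. \<exists>\<alpha>>0. \<exists>\<gamma>>0.
     \<phi> a = of_real \<alpha> \<and> \<phi> c = of_real \<gamma> \<and> f * c = a \<and> r = \<alpha> / \<gamma>)"

lemma has_valueI:
  "a \<in> \<A> k n \<Longrightarrow> c \<in> \<A> k n \<Longrightarrow> 0 < \<alpha> \<Longrightarrow> 0 < \<gamma> \<Longrightarrow>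
   \<phi> a = of_real \<alpha> \<Longrightarrow> \<phi> c = of_real \<gamma> \<Longrightarrow> f * c = a \<Longrightarrow> r = \<alpha> / \<gamma> \<Longrightarrow> has_value f r"
  unfolding has_value_def by blast

lemma has_value_ring:
  assumes "f \<in> \<A> k n" "has_value f r"
  shows "\<phi> f = of_real r"
proof -
  obtain a c \<alpha> \<gamma> where *: "a \<in> \<A> k n" "c \<in> \<A> k n" "0 < \<alpha>" "0 < \<gamma>"
    "\<phi> a = of_real \<alpha>" "\<phi> c = of_real \<gamma>" "f * c = a" "r = \<alpha> / \<gamma>"
    using assms(2) unfolding has_value_def by blast
  have "\<phi> f * of_real \<gamma> = of_real \<alpha>"
    using phi_mult[OF hom assms(1) *(2)] * by simp
  then have "\<phi> f = of_real \<alpha> / of_real \<gamma>" using *(4) by (simp add: eq_divide_eq)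
  then show ?thesis using *(8) by simp
qed

lemma has_value_nonzero: "has_value f r \<Longrightarrow> f \<noteq> 0"
  unfolding has_value_def using phi_0[OF hom] by fastforce

lemma has_value_1: "f \<in> \<A> k n \<Longrightarrow> \<phi> f = 1 \<Longrightarrow> has_value f 1"
  by (rule has_valueI[of f 1 1 1]) (simp_all add: grass_1 phi_1[OF hom])

lemma has_value_add:
  assumes "has_value f r" "has_value g s"
  shows "has_value (f + g) (r + s)"
proof -
  obtain a c \<alpha> \<gamma> where 1: "a \<in> \<A> k n" "c \<in> \<A> k n" "0 < \<alpha>" "0 < \<gamma>"
    "\<phi> a = of_real \<alpha>" "\<phi> c = of_real \<gamma>" "f * c = a" "r = \<alpha> / \<gamma>"
    using assms(1) unfolding has_value_def by blast
  obtain a' c' \<alpha>' \<gamma>' where 2: "a' \<in> \<A> k n" "c' \<in> \<A> k n" "0 < \<alpha>'" "0 < \<gamma>'"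
    "\<phi> a' = of_real \<alpha>'" "\<phi> c' = of_real \<gamma>'" "g * c' = a'" "s = \<alpha>' / \<gamma>'"
    using assms(2) unfolding has_value_def by blast
  show ?thesis
  proof (rule has_valueI[of "a * c' + a' * c" "c * c'" "\<alpha> * \<gamma>' + \<alpha>' * \<gamma>" "\<gamma> * \<gamma>'"])
    show "(f + g) * (c * c') = a * c' + a' * c"
      unfolding 1(7)[symmetric] 2(7)[symmetric] by (simp add: algebra_simps)
    show "r + s = (\<alpha> * \<gamma>' + \<alpha>' * \<gamma>) / (\<gamma> * \<gamma>')" using 1 2 by (simp add: field_simps)
  qed (use 1 2 in \<open>auto intro!: grass_add grass_mult add_pos_pos
      simp: phi_add[OF hom] phi_mult[OF hom] grass_mult\<close>)
qed

lemma has_value_mult: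
  assumes "has_value f r" "has_value g s"
  shows "has_value (f * g) (r * s)"
proof -
  obtain a c \<alpha> \<gamma> where 1: "a \<in> \<A> k n" "c \<in> \<A> k n" "0 < \<alpha>" "0 < \<gamma>"
    "\<phi> a = of_real \<alpha>" "\<phi> c = of_real \<gamma>" "f * c = a" "r = \<alpha> / \<gamma>"
    using assms(1) unfolding has_value_def by blast
  obtain a' c' \<alpha>' \<gamma>' where 2: "a' \<in> \<A> k n" "c' \<in> \<A> k n" "0 < \<alpha>'" "0 < \<gamma>'"
    "\<phi> a' = of_real \<alpha>'" "\<phi> c' = of_real \<gamma>'" "g * c' = a'" "s = \<alpha>' / \<gamma>'"
    using assms(2) unfolding has_value_def by blast
  show ?thesis
  proof (rule has_valueI[of "a * a'" "c * c'" "\<alpha> * \<alpha>'" "\<gamma> * \<gamma>'"])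
    show "f * g * (c * c') = a * a'"
      unfolding 1(7)[symmetric] 2(7)[symmetric] by (simp only: ac_simps)
  qed (use 1 2 in \<open>auto intro!: grass_mult simp: phi_mult[OF hom]\<close>)
qed

lemma has_value_inverse:
  assumes "has_value f r"
  shows "has_value (1 / f) (1 / r)"
proof -
  obtain a c \<alpha> \<gamma> where 1: "a \<in> \<A> k n" "c \<in> \<A> k n" "0 < \<alpha>" "0 < \<gamma>"
    "\<phi> a = of_real \<alpha>" "\<phi> c = of_real \<gamma>" "f * c = a" "r = \<alpha> / \<gamma>"
    using assms(1) unfolding has_value_def by blast
  show ?thesis
  proof (rule has_valueI[OF 1(2,1,4,3,6,5)])
    show "1 / f * a = c" unfolding 1(7)[symmetric] using has_value_nonzero[OF assms] by simp
    show "1 / r = \<gamma> / \<alpha>" unfolding 1(8) by simp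
  qed
qed

lemma has_value_divide: "has_value f r \<Longrightarrow> has_value g s \<Longrightarrow> has_value (f / g) (r / s)"
  using has_value_mult[OF _ has_value_inverse, of f r g s] by simp

lemma has_value_power: "has_value f r \<Longrightarrow> has_value (f ^ m) (r ^ m)"
  by (induction m) (auto intro: has_value_mult has_value_1 simp: grass_1 phi_1[OF hom])

lemma has_value_prod:
  "(\<And>i. i \<in> I \<Longrightarrow> has_value (f i) (r i)) \<Longrightarrow> has_value (prod f I) (prod r I)"
  by (induction I rule: infinite_finite_induct)
    (auto intro: has_value_mult has_value_1 simp: grass_1 phi_1[OF hom])

lemma has_value_mutate:
  assumes "\<And>v. v \<in> V \<Longrightarrow> has_value (x v) (y v)" "t \<in> V" "v \<in> V"
  shows "has_value (mutate_var V b t x v) (mutate_var V b t y v)"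
  unfolding mutate_var_def using assms
  by (auto intro!: has_value_divide has_value_add has_value_prod has_value_power)

text \<open>
The mutations that lead to the seed \<open>x\<close> are undone one after the other. If the variable \<open>x\<^sub>t\<close>
before a mutation at \<open>t\<close> were \<open>0\<close>, then so would be the variable after it, as \<open>z / 0 = 0\<close>; but
that variable has a value. Hence the mutation can be inverted and \<open>x\<^sub>t\<close> has a value, too.
\<close>

lemma seed_backwards:
  assumes "grass_seed k n x b"
  shows "(\<forall>v\<in>verts k n. has_value (x v) (y v)) \<Longrightarrow>
    \<exists>w. set w \<subseteq> mutable_verts k n \<and> matrix_along b w = initial_matrix k n \<and>
      (\<forall>v\<in>verts k n. has_value (initial_var k v) (mutate_along (verts k n) b w y v))"
  using assms
proof (induction arbitrary: y)
  case initial
  then show ?case by (intro exI[of _ "[]"]) simp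
next
  case (mutate x b t)
  let ?V = "verts k n" and ?b = "mutate_matrix b t"
  let ?x = "mutate_var ?V b t x" and ?y = "mutate_var ?V ?b t y"
  have t: "t \<in> ?V" using mutate.hyps(2) mutable_verts_subset by blast
  have diag: "b t t = 0" by (rule skew_diag[OF conjunct1[OF grass_seed_invariant[OF
      mutate.hyps(1)]]])
  have nz: "?x t \<noteq> 0" by (rule has_value_nonzero[OF mutate.prems[rule_format, OF t]])
  then have "x t \<noteq> 0" by (auto simp: mutate_var_def)
  then have inv: "mutate_var ?V ?b t ?x = x" using diag nz by (intro mutate_var_involution)
  have "\<forall>v\<in>?V. has_value (x v) (?y v)"
    using has_value_mutate[of ?V ?x y t _ ?b] mutate.prems t unfolding inv by blast
  from mutate.IH[OF this] obtain w where w: "set w \<subseteq> mutable_verts k n"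
    "matrix_along b w = initial_matrix k n"
    "\<forall>v\<in>?V. has_value (initial_var k v) (mutate_along ?V b w ?y v)" by blast
  then show ?case using mutate.hyps(2)
    by (intro exI[of _ "t # w"]) (simp add: mutate_matrix_involution)
qed

end

section \<open>The specialized frieze\<close>

context
  fixes k n :: nat and xs :: "ratfun list" and \<phi> :: "ratfun \<Rightarrow> complex"
  assumes k: "2 \<le> k" and kn: "2 * k \<le> n"
    and cluster: "grass_cluster k n xs" and spec: "specialization_to_1 k n xs \<phi>"
begin

lemma specialization_hom: "grass_alg_hom k n \<phi>"
  using spec by (simp add: specialization_to_1_def)

lemma size_bounds: "1 \<le> n" "1 \<le> k" "k \<le> n" using k kn by auto

lemma cluster_seed:
  obtains x b where "grass_seed k n x b"
    "\<And>v. v \<in> verts k n \<Longrightarrow> x v \<in> \<A> k n"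
    "\<And>v. v \<in> verts k n \<Longrightarrow> \<phi> (x v) = 1"
proof -
  obtain x b where x: "grass_seed k n x b" "mset xs = image_mset x (mset_set (verts k n))"
    using cluster unfolding grass_cluster_def by blast
  have "set xs = x ` verts k n"
    using arg_cong[OF x(2), of set_mset] finite_verts by simp
  then show thesis using that[OF x(1)] spec unfolding specialization_to_1_def by blast
qed

lemma phi_frozen:
  assumes "v \<in> verts k n" "v \<notin> mutable_verts k n"
  shows "\<phi> (initial_var k v) = 1"
proof (rule cluster_seed)
  fix x b assume x: "grass_seed k n x b" "\<And>v. v \<in> verts k n \<Longrightarrow> \<phi> (x v) = 1"
  have "x v = initial_var k v" using grass_seed_invariant[OF x(1)] assms(2) by blast
  then show ?thesis using x(2)[OF assms(1)] by simp
qed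

lemma consec_minor_mem: "consec_minor k n z \<in> \<A> k n"
  unfolding consec_minor_def using size_bounds by (intro grass_twisted_minor) auto

lemma rect_minor_mem: "i \<le> k \<Longrightarrow> rect_minor k n s i j \<in> \<A> k n"
  unfolding rect_minor_def using size_bounds by (intro grass_twisted_minor) auto

text \<open>
The consecutive minors are frozen variables of the rectangles seed, and these belong to every
cluster.
\<close>

lemma phi_consec_minor: "1 \<le> z \<Longrightarrow> \<phi> (consec_minor k n z) = 1"
proof (induction z rule: less_induct)
  case (less z)
  consider "z = 1" | "2 \<le> z" "z \<le> n - k + 1" | "n - k + 1 < z" "z \<le> n" | "n < z"
    using less.prems by linarith
  then show ?case
  proof cases
    case 1
    have "initial_var k (0, 0) = consec_minor k n 1"
      using initial_var_rect_minor[of 0 k 0 n] rect_minor_boundary(1)[of 0 k n 0 0] size_bounds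
          by simp
    moreover have "\<phi> (initial_var k (0, 0)) = 1"
      by (rule phi_frozen) (auto simp: verts_def mutable_verts_def)
    ultimately show ?thesis using 1 by simp
  next
    case 2
    have "initial_var k (k, z - 1) = consec_minor k n z"
      using initial_var_rect_minor[of k k "z - 1" n] rect_minor_boundary(3)[of k k n 0 "z
          - 1"] 2 size_bounds by simp
    moreover have "\<phi> (initial_var k (k, z - 1)) = 1"
      by (rule phi_frozen) (use 2 k in \<open>auto simp: verts_def mutable_verts_def\<close>)
    ultimately show ?thesis by simp
  next
    case 3
    let ?i = "n + 1 - z"
    have i: "?i \<le> k" "n - ?i + 1 = z" using 3 by auto
    have "initial_var k (?i, n - k) = consec_minor k n z"
      using initial_var_rect_minor[of ?i k "n - k" n] rect_minor_last[of ?i k n 0] i size_bounds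
          by simp
    moreover have "\<phi> (initial_var k (?i, n - k)) = 1"
      by (rule phi_frozen) (use 3 k kn in \<open>auto simp: verts_def mutable_verts_def\<close>)
    ultimately show ?thesis by simp
  next
    case 4
    then have "consec_minor k n z = consec_minor k n (z - n)"
      using consec_minor_add[of n "z - n" k] size_bounds by simp
    moreover have "\<phi> (consec_minor k n (z - n)) = 1" using less.IH[of "z - n"] 4 size_bounds by simp
    ultimately show ?thesis by simp
  qed
qed

lemma phi_rect_exchange:
  assumes ij: "(i, j) \<in> mutable_verts k n" and nz: "\<phi> (rect_minor k n s (i - 1) j) \<noteq> 0"
  shows "\<phi> (rect_minor k n s i j) * \<phi> (rect_minor k n (Suc s) i j) =
    \<phi> (rect_minor k n s (i - 1) j) * \<phi> (rect_minor k n (Suc s) (i + 1) j)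
    + \<phi> (rect_minor k n s i (j + 1)) * \<phi> (rect_minor k n (Suc s) i (j - 1))"
proof -
  have i: "1 \<le> i" "i < k" "1 \<le> j" using ij by (auto simp: mutable_verts_def)
  have "rect_minor k n s (i - 1) j \<noteq> 0" using nz phi_0[OF specialization_hom] by auto
  from arg_cong[OF rect_minor_exchange[OF i this], of \<phi>] show ?thesis
    using i by (simp add: phi_add[OF specialization_hom] phi_mult[OF specialization_hom]
        grass_mult rect_minor_mem)
qed

text \<open>
Every rotation of the rectangles seed is reached from the given seed. The first sequence of
mutations goes back to the rectangles seed; each further rotation appends the sequence provided
by \<open>rotation\<close>, whose assumption that no value vanishes holds because the values reached so far
are positive.
\<close>

lemma rect_stage:
  "\<exists>b w. skew b \<and> unimodular (verts k n) (mutable_verts k n) b \<and> set w \<subseteq> mutable_verts k n \<and>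
    at_stage (verts k n) (mutable_verts k n) (\<lambda>i j. \<phi> (rect_minor k n s i j)) (\<lambda>i j. \<phi> (rect_minor
        k n (Suc s) i j))
      (\<lambda>_. False) (mutate_along (verts k n) b w (\<lambda>_. 1)) (matrix_along b w)"
proof -
  let ?V = "verts k n" and ?T = "mutable_verts k n"
  obtain x b where x: "grass_seed k n x b" "\<And>v. v \<in> ?V \<Longrightarrow> x v \<in> \<A> k n"
    "\<And>v. v \<in> ?V \<Longrightarrow> \<phi> (x v) = 1" using cluster_seed by metis
  have b: "skew b" "unimodular ?V ?T b" using grass_seed_invariant[OF x(1)] by auto
  have T: "?T = {1..<k} \<times> {1..<n - k}" by (simp add: mutable_verts_def)
  have "\<exists>w. set w \<subseteq> ?T \<and>
    at_stage ?V ?T (\<lambda>i j. \<phi> (rect_minor k n s i j)) (\<lambda>i j. \<phi> (rect_minor k n (Suc s) i j))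
      (\<lambda>_. False) (mutate_along ?V b w (\<lambda>_. 1)) (matrix_along b w)"
  proof (induction s)
    case 0
    \<comment> \<open>back from the given seed, in which all values are \<open>1\<close>\<close>
    have "\<forall>v\<in>?V. has_value k n \<phi> (x v) 1" using has_value_1[OF specialization_hom] x by blast
    from seed_backwards[OF specialization_hom x(1) this] obtain w where w: "set w \<subseteq> ?T"
      "matrix_along b w = initial_matrix k n"
      "\<And>v. v \<in> ?V \<Longrightarrow> has_value k n \<phi> (initial_var k v) (mutate_along ?V b w (\<lambda>_. 1) v)" by blast
    have "mutate_along ?V b w (\<lambda>_. 1) (i, j) = \<phi> (rect_minor k n 0 i j)" if ij: "(i, j) \<in> ?T"
        for i j
    proof -
      have e: "initial_var k (i, j) = rect_minor k n 0 i j" and ik: "i \<le> k"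
        using ij by (auto simp: T intro!: initial_var_rect_minor)
      have "\<phi> (rect_minor k n 0 i j) = of_real (mutate_along ?V b w (\<lambda>_. 1::real) (i, j))"
        using w(3)[of "(i, j)"] ij mutable_verts_subset[of k n] rect_minor_mem[OF ik, of 0 j]
            has_value_ring[OF specialization_hom]
        unfolding e by blast
      then show ?thesis using mutate_along_of_real[of ?V b w "\<lambda>_. 1" "(i, j)"] by simp
    qed
    moreover have "mutate_along ?V b w (\<lambda>_. 1) v = (1::complex)" if "v \<in> ?V - ?T" for v
      using that w(1) by (subst mutate_along_frozen) auto
    ultimately have "at_stage ?V ?T (\<lambda>i j. \<phi> (rect_minor k n 0 i j)) (\<lambda>i j. \<phi> (rect_minor k n (Suc
        0) i j))
      (\<lambda>_. False) (mutate_along ?V b w (\<lambda>_. 1)) (matrix_along b w)"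
      unfolding at_stage_def w(2) by (simp add: initial_matrix_quiver)
    then show ?case using w(1) by blast
  next
    case (Suc s)
    let ?F = "\<lambda>s i j. \<phi> (rect_minor k n s i j)"
    from Suc obtain w where w: "set w \<subseteq> ?T" "at_stage ?V ?T (?F s) (?F (Suc s))
      (\<lambda>_. False) (mutate_along ?V b w (\<lambda>_. 1)) (matrix_along b w)" by blast
    have bd: "?F s 0 j = 1" "?F s k j = 1" "i \<le> k \<Longrightarrow> ?F s i 0 = 1" "i \<le> k \<Longrightarrow> ?F s i (n - k) = 1"
        for s i j
      using rect_minor_boundary(1,3)[of k k n s j] rect_minor_boundary(2)[of i k n s]
          rect_minor_last[of i k n s] size_bounds
      by (simp_all add: phi_consec_minor)
    have nz: "?F s i j \<noteq> 0" if ij: "(i, j) \<in> ?T" for i j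
    proof -
      have "?F s i j = mutate_along ?V b w (\<lambda>_. 1) (i, j)" using w(2) ij unfolding at_stage_def
          by simp
      also have "\<dots> = of_real (mutate_along ?V b w (\<lambda>_. 1::real) (i, j))"
        using mutate_along_of_real[of ?V b w "\<lambda>_. 1" "(i, j)"] by simp
      finally show ?thesis
        using mutate_along_ones[OF finite_verts mutable_verts_subset _ b w(1), of "(i, j)"] ij
            mutable_verts_subset[of k n]
        by force
    qed
    have rel: "?F s i j * ?F (Suc s) i j = ?F s (i - 1) j * ?F (Suc s) (i + 1) j + ?F s i (j + 1)
        * ?F (Suc s) i (j - 1)"
      if ij: "(i, j) \<in> ?T" for i j
    proof (rule phi_rect_exchange[OF ij])
      show "?F s (i - 1) j \<noteq> 0"
      proof (cases "i = 1")
        case True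
        then show ?thesis using bd(1)[of s j] by simp
      next
        case False
        then have "1 \<le> i - 1 \<and> i - 1 < k \<and> 1 \<le> j \<and> j < n - k" using ij unfolding T by auto
        then have "(i - 1, j) \<in> ?T" unfolding T by simp
        then show ?thesis by (rule nz)
      qed
    qed
    have F3: "?F s i (n - k) = 1" and G2: "?F (Suc s) i 0 = 1" if "i < k" for i
      using bd(3,4)[of i] that by simp_all
    have nk: "1 \<le> n - k" using k kn by simp
    have "\<exists>w'. set w' \<subseteq> ?T \<and> at_stage ?V ?T (?F s) (?F (Suc s)) (\<lambda>_. True)
      (mutate_along ?V (matrix_along b w) w' (mutate_along ?V b w (\<lambda>_. 1))) (matrix_along
          (matrix_along b w) w')"
      by (rule rotation[OF T finite_verts mutable_verts_subset nz bd(1) F3 bd(2) G2 rel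
          size_bounds(2) nk w(2)])
    then obtain w' where w': "set w' \<subseteq> ?T" "at_stage ?V ?T (?F s) (?F (Suc s)) (\<lambda>_. True)
      (mutate_along ?V (matrix_along b w) w' (mutate_along ?V b w (\<lambda>_. 1))) (matrix_along
          (matrix_along b w) w')" by blast
    have "at_stage ?V ?T (?F (Suc s)) (?F (Suc (Suc s))) (\<lambda>_. False)
      (mutate_along ?V b (w @ w') (\<lambda>_. 1)) (matrix_along b (w @ w'))"
      using w'(2) unfolding at_stage_def mutate_along_append matrix_along_append quiver_True by simp
    then show ?case using w(1) w'(1) by (intro exI[of _ "w @ w'"]) auto
  qed
  then show ?thesis using b by blast
qed

lemma phi_rect_pos_int:
  assumes "(i, j) \<in> mutable_verts k n"
  shows "\<exists>c::nat. 0 < c \<and> \<phi> (rect_minor k n s i j) = of_nat c"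
proof -
  let ?V = "verts k n" and ?T = "mutable_verts k n"
  obtain b w where w: "skew b" "unimodular ?V ?T b" "set w \<subseteq> ?T"
    "at_stage ?V ?T (\<lambda>i j. \<phi> (rect_minor k n s i j)) (\<lambda>i j. \<phi> (rect_minor k n (Suc s) i j))
      (\<lambda>_. False) (mutate_along ?V b w (\<lambda>_. 1)) (matrix_along b w)" using rect_stage by blast
  have "\<phi> (rect_minor k n s i j) = mutate_along ?V b w (\<lambda>_. 1) (i, j)"
    using w(4) assms unfolding at_stage_def by simp
  also have "\<dots> = of_real (mutate_along ?V b w (\<lambda>_. 1::real) (i, j))"
    using mutate_along_of_real[of ?V b w "\<lambda>_. 1" "(i, j)"] by simp
  finally show ?thesis
    using mutate_along_ones[OF finite_verts mutable_verts_subset _ w(1-3), of "(i, j)"] assms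
        mutable_verts_subset[of k n]
    by force
qed

lemma consecutive_plucker_value: "x \<in> consecutive_pluckers k n \<Longrightarrow> x \<in> \<A> k n \<and> \<phi> x = 1"
proof -
  assume "x \<in> consecutive_pluckers k n"
  then obtain r where r: "1 \<le> r" "r \<le> n" "x = plucker k (sort (cyc n r k))"
    unfolding consecutive_pluckers_def by auto
  have "cyc n r k = map (\<lambda>z. red n (int z)) (map (\<lambda>i. i + r) [0..<k])"
    by (simp add: cyc_def add.commute)
  also have "\<dots> = map (\<lambda>z. red n (int z)) [r..<r + k]" unfolding map_plus_upt
      by (simp add: add.commute)
  finally have "x = consec_minor k n r"
    unfolding r(3) consec_minor_def using r size_bounds
        by (simp only:) (intro twisted_minor_window, auto)
  then show ?thesis using consec_minor_mem phi_consec_minor r by simp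
qed

lemma frieze_entry:
  assumes "1 \<le> m" "m \<le> int (n + k) - 1" "1 \<le> \<rho>" "red n (int \<rho>) = red n r"
  shows "specialized_frieze k n \<phi> r m = \<phi> (row_minor k n \<rho> (nat m))"
    and "row_minor k n \<rho> (nat m) \<in> \<A> k n"
proof -
  have e: "plucker_frieze k n r m = row_minor k n \<rho> (nat m)"
    using plucker_frieze_row_minor[OF size_bounds, of "nat m" \<rho> r] assms by simp
  show mem: "row_minor k n \<rho> (nat m) \<in> \<A> k n"
    unfolding row_minor_def using size_bounds by (intro grass_twisted_minor) auto
  show "specialized_frieze k n \<phi> r m = \<phi> (row_minor k n \<rho> (nat m))"
    using specialized_frieze_eq[OF specialization_hom size_bounds(1) consecutive_plucker_value, of
        r m] mem unfolding e by simp
qed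

lemma red_shift: "red n (int (red n r + i)) = red n (r + int i)"
proof -
  have "int (red n r) = (r - 1) mod int n + 1"
    using size_bounds by (simp add: red_def)
  then have "(int (red n r + i) - 1) mod int n = ((r - 1) mod int n + int i) mod int n"
    by simp
  also have "\<dots> = (r - 1 + int i) mod int n" by (rule mod_add_left_eq)
  also have "r - 1 + int i = r + int i - 1" by simp
  finally show ?thesis unfolding red_def by (simp only:)
qed

text \<open>
In row \<open>r + i\<close> of the diamond the last column of the minor is at \<open>(r + i) + (m + j - i) - 1\<close>,
which is independent of \<open>i\<close>.
\<close>

lemma diamond_entries:
  fixes r m :: int
  assumes grid: "diamond_in_grid k (n - k - 1) s m" and s: "1 \<le> s"
  defines "c \<equiv> red n r + nat m - 1"
  defines "M \<equiv> mat s s (\<lambda>(i, j). twisted_minor k n ([red n r + i..<red n r + i + (k - 1)] @ [c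
      + j]))"
  shows "1 \<le> c" and "det M \<in> \<A> k n"
    and "det (diamond (specialized_frieze k n \<phi>) s r m) = \<phi> (det M)"
proof -
  let ?e = "\<lambda>(i, j). twisted_minor k n ([red n r + i..<red n r + i + (k - 1)] @ [c + j])"
  have rr: "1 \<le> red n r" using red_mem[OF size_bounds(1), of r] by simp
  have g: "1 \<le> m + int j - int i \<and> m + int j - int i \<le> int (n + k) - 1" if "i < s" "j < s" for i j
    using grid that size_bounds kn k unfolding diamond_in_grid_def by (force simp: of_nat_diff)
  have m1: "1 \<le> m" using g[of 0 0] s by simp
  show "1 \<le> c" using rr m1 by (simp add: c_def)
  have ent: "row_minor k n (red n r + i) (nat (m + int j - int i)) = ?e (i, j)" if "i < s" "j < s"
      for i j
  proof -
    have "red n r + i + nat (m + int j - int i) - 1 = c + j"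
      using g[OF that] m1 rr unfolding c_def by linarith
    then show ?thesis by (simp add: row_minor_def)
  qed
  have mem: "?e (i, j) \<in> \<A> k n" if "i < s" "j < s" for i j
    using size_bounds by (simp add: grass_twisted_minor)
  show "det M \<in> \<A> k n"
    unfolding M_def by (rule det_phi(1)[where f = ?e and s = s, OF specialization_hom]) (rule mem)
  have "diamond (specialized_frieze k n \<phi>) s r m = mat s s (\<lambda>x. \<phi> (?e x))"
    unfolding diamond_def
  proof (rule cong_mat[OF refl refl])
    fix i j assume ij: "i < s" "j < s"
    have "specialized_frieze k n \<phi> (r + int i) (m + int j - int i)
        = \<phi> (row_minor k n (red n r + i) (nat (m + int j - int i)))"
      by (rule frieze_entry(1)) (use g[OF ij] rr red_shift in auto)
    then show "(case (i, j) of (i, j) \<Rightarrow> specialized_frieze k n \<phi> (r + int i) (m + int j - int i))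
       = \<phi> (?e (i, j))"
      using ent[OF ij] by simp
  qed
  then show "det (diamond (specialized_frieze k n \<phi>) s r m) = \<phi> (det M)"
    unfolding M_def using det_phi(2)[where f = ?e and s = s, OF specialization_hom] mem by simp
qed

lemma frieze_SL: "SL_frieze k (n - k - 1) (specialized_frieze k n \<phi>)"
proof -
  let ?a = "specialized_frieze k n \<phi>"
  have w: "int (n - k - 1) = int n - int k - 1" "1 \<le> n - k - 1" using k kn by auto
  have rr: "1 \<le> red n r" for r using red_mem[OF size_bounds(1), of r] by simp
  have red: "red n (int (red n r)) = red n r" for r using red_shift[of r 0] by simp
  have zero: "?a r m = 0" if "m \<in> {1..int (n - k - 1) + 2 * int k}"
    "m \<le> int k - 1 \<or> m \<ge> int (n - k - 1) + int k + 2" for r m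
  proof -
    have m: "1 \<le> m" "m \<le> int (n + k) - 1" "nat m < k \<or> n < nat m" using that w by auto
    have "?a r m = \<phi> (row_minor k n (red n r) (nat m))" by (rule frieze_entry(1)[OF m(1,2) rr red])
    also have "row_minor k n (red n r) (nat m) = 0"
      by (rule row_minor_zero(2)[OF size_bounds(2) rr _ _ m(3)]) (use m in auto)
    finally show ?thesis using phi_0[OF specialization_hom] by simp
  qed
  have low: "?a r (int k) = 1" for r
  proof -
    have "?a r (int k) = \<phi> (row_minor k n (red n r) (nat (int k)))"
      by (rule frieze_entry(1)[OF _ _ rr red]) (use size_bounds in auto)
    also have "\<dots> = \<phi> (consec_minor k n (red n r))" using row_minor_first[OF size_bounds(2)] by simp
    finally show ?thesis by (simp only: phi_consec_minor[OF rr])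
  qed
  \<comment> \<open>The minor is the consecutive one that starts in the preceding row, hence the shift
      by a period.\<close>
  have high: "?a r (int (n - k - 1) + int k + 1) = 1" for r
  proof -
    have "red n (int (red n r + n)) = red n r" using red_add[of n "int (red n r)"] red by simp
    then have "?a r (int n) = \<phi> (row_minor k n (red n r + n) (nat (int n)))"
      by (intro frieze_entry(1)) (use size_bounds rr in auto)
    also have "row_minor k n (red n r + n) (nat (int n)) = consec_minor k n (red n r + n - 1)"
      using row_minor_last[of "red n r + n" k n] size_bounds rr[of r] by simp
    also have "\<phi> \<dots> = 1" by (rule phi_consec_minor) (use size_bounds rr[of r] in linarith)
    finally have "?a r (int n) = 1" .
    moreover have "int (n - k - 1) + int k + 1 = int n" using w by simp
    ultimately show ?thesis by (simp only:)
  qed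
  have dia: "det (diamond ?a k r m) = 1" if grid: "diamond_in_grid k (n - k - 1) k m" for r m
  proof -
    let ?c = "red n r + nat m - 1"
    let ?M = "mat k k (\<lambda>(i, j). twisted_minor k n ([red n r + i..<red n r + i + (k - 1)] @ [?c
        + j]))"
    note d = diamond_entries[OF grid size_bounds(2), of r]
    have P: "(\<Prod>i<k. consec_minor k n (red n r + i)) \<in> \<A> k n"
      by (rule grass_prod) (rule consec_minor_mem)
    have one: "\<phi> (consec_minor k n (red n r + i)) = 1" for i
      using rr[of r] by (intro phi_consec_minor) simp
    have "\<phi> (det ?M) * \<phi> (consec_minor k n (red n r + (k - 1)))
        = \<phi> (\<Prod>i<k. consec_minor k n (red n r + i)) * \<phi> (consec_minor k n ?c)"
      using arg_cong[OF diamond_det[OF size_bounds(2), of n "red n r" ?c], of \<phi>]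
      unfolding phi_mult[OF specialization_hom d(2) consec_minor_mem] phi_mult[OF
          specialization_hom P consec_minor_mem] .
    then have "\<phi> (det ?M) = \<phi> (\<Prod>i<k. consec_minor k n (red n r + i))"
      unfolding one phi_consec_minor[OF d(1)] by simp
    also have "\<dots> = 1" using phi_prod[OF specialization_hom, of "{..<k}" "\<lambda>i. consec_minor k n (red
        n r + i)"] one
      by (simp add: consec_minor_mem)
    finally have "\<phi> (det ?M) = 1" .
    then show ?thesis using d(3) by simp
  qed
  show ?thesis unfolding SL_frieze_def using k w(2) zero low high dia by blast
qed

lemma frieze_tame: "tame_frieze k (n - k - 1) (specialized_frieze k n \<phi>)"
  unfolding tame_frieze_def
proof (intro allI impI)
  fix r m assume grid: "diamond_in_grid k (n - k - 1) (k + 1) m"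
  show "det (diamond (specialized_frieze k n \<phi>) (k + 1) r m) = 0"
    using diamond_entries(3)[OF grid, of r] diamond_tame[OF size_bounds(2), of n "red n r"]
        phi_0[OF specialization_hom] by simp
qed

lemma frieze_integral: "integral_frieze k (n - k - 1) (specialized_frieze k n \<phi>)"
  unfolding integral_frieze_def
proof (intro allI ballI)
  fix r m assume m: "m \<in> {int k + 1..int (n - k - 1) + int k}"
  have rr: "1 \<le> red n r" using red_mem[OF size_bounds(1), of r] by simp
  have red: "red n (int (red n r)) = red n r" using red_shift[of r 0] by simp
  have mm: "1 \<le> m" "m \<le> int (n + k) - 1" "k \<le> nat m" "(1, nat m - k) \<in> mutable_verts k n"
    using m k kn by (auto simp: mutable_verts_def)
  have "specialized_frieze k n \<phi> r m = \<phi> (row_minor k n (red n r) (nat m))"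
    by (rule frieze_entry(1)[OF mm(1,2) rr red])
  also have "\<dots> = \<phi> (rect_minor k n (red n r - 1) 1 (nat m - k))"
    using row_minor_rect_minor[OF rr mm(3) size_bounds(2), of n] by simp
  finally show "\<exists>c::nat. c > 0 \<and> specialized_frieze k n \<phi> r m = of_nat c"
    using phi_rect_pos_int[OF mm(4)] by simp
qed

end

theorem corollary3p12:
  fixes k n :: nat and xs :: "ratfun list" and \<phi> :: "ratfun \<Rightarrow> complex"
  assumes "2 \<le> k" and "real k \<le> real n / 2"
    and "grass_cluster k n xs"
    and "specialization_to_1 k n xs \<phi>"
  shows "SL_frieze k (n - k - 1) (specialized_frieze k n \<phi>) \<and>
         tame_frieze k (n - k - 1) (specialized_frieze k n \<phi>) \<and>
         integral_frieze k (n - k - 1) (specialized_frieze k n \<phi>)"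
proof -
  have "2 * k \<le> n" using assms(2) by linarith
  then show ?thesis
    using frieze_SL[OF assms(1) _ assms(3,4)] frieze_tame[OF assms(1) _ assms(3,4)]
      frieze_integral[OF assms(1) _ assms(3,4)] by blast
qed

end
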